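(* Let $N\to M$ be a D2 extension of rings with left D2 quasibasis $b_i\in(M\otimes_NM)^N$, $\beta_i\in\mathrm{End}({}_NM_N)$. Let $R=C_M(N)$ and let $B=(M\otimes_NM)^N$, a ring with multiplication $bb'={b'}^1b^1\otimes b^2{b'}^2$ and unit $1\otimes1$. Set $s_B(r)=1\otimes r$, $t_B(r)=r\otimes1$ for $r\in R$ (so that $r\cdot b\cdot r'=rb^1\otimes b^2r'$), and $$\Delta_B(b)=\sum_i(b_i^1\otimes_Nb_i^2)\otimes_R(\beta_i(b^1)\otimes_Nb^2),\qquad\varepsilon_B(b)=b^1b^2 .$$ Then $\langle B,R,s_B,t_B,\Delta_B,\varepsilon_B\rangle$ is a right bialgebroid over $R$, and $\mathrm{End}({}_NM)$ (under composition) is a right $B$-module algebroid with respect to the action $\xi\triangleleft b=b^1\xi(b^2\,-)$, i.e. $(\xi\triangleleft b)(m)=b^1\xi(b^2m)$. The subring of invariants $\{\xi\in\mathrm{End}({}_NM):\xi\triangleleft b=\lambda(\varepsilon_B(b))\circ\xi\ \ \forall b\in B\}$ is $\rho(M)$, the set of right multiplications $x\mapsto xm$ by elements $m$ of $M$.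
   Context: Rings are unital; a ring extension is a unital ring homomorphism $N\to M$. It is left D2 if $M\otimes_NM$ is isomorphic as an $N$-$M$-bimodule to a direct summand of $\oplus^n\,{}_NM_M$ for some $n\ge1$; right D2 if $M\otimes_NM$ is isomorphic as an $M$-$N$-bimodule to a direct summand of $\oplus^m\,{}_MM_N$ for some $m\ge1$; D2 if both. $X^N$ denotes the elements of an $N$-$N$-bimodule $X$ commuting with $N$, $C_M(N)=M^N$; elements of $(M\otimes_NM)^N$ are written $b=b^1\otimes b^2$ (summation suppressed). A left D2 quasibasis (which exists iff $M|N$ is left D2) consists of finitely many $b_i\in(M\otimes_NM)^N$, $\beta_i\in\mathrm{End}({}_NM_N)$ with $\sum_ib_i^1\otimes b_i^2\beta_i(m)=m\otimes1$ for all $m\in M$. $\lambda(m)$ is left multiplication by $m$. Right bialgebroid over a ring $R$: a ring $B$ with ring homomorphisms $s:R\to B$, $t:R^{op}\to B$ with $s(r')t(r)=t(r)s(r')$; $B$ is an $R$-$R$-bimodule via $r\cdot b\cdot r'=b\,t(r)s(r')$; and $R$-$R$-bimodule maps $\Delta:B\to B\otimes_RB$, $\Delta(b)=b_{(1)}\otimes b_{(2)}$, $\varepsilon:B\to R$ such that $\Delta$ is coassociative with counit $\varepsilon$; the image of $\Delta$ lies in $B\times_RB=\{X\in B\otimes_RB:(s(r)\otimes1)X=(1\otimes t(r))X\ \forall r\in R\}$, which is a ring under $(a\otimes a')(a''\otimes a''')=aa''\otimes a'a'''$, and $\Delta:B\to B\times_RB$ is a unital ring homomorphism; $\varepsilon(1)=1_R$;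 $\varepsilon(t(\varepsilon(a))b)=\varepsilon(ab)=\varepsilon(s(\varepsilon(a))b)$. Right $B$-module algebroid: a right $B$-module $P$ (with $R$-$R$-bimodule structure $r\cdot p\cdot r'=p\triangleleft t(r)s(r')$) with an associative multiplication $P\otimes_RP\to P$ satisfying $(pp')\triangleleft b=(p\triangleleft b_{(1)})(p'\triangleleft b_{(2)})$ and a unit $1_P$, $R\to P$, $r\mapsto r\cdot1_P=1_P\cdot r$, satisfying $1_P\triangleleft b=1_P\cdot\varepsilon(b)$. *)

theory Defs
  imports "HOL-Algebra.Free_Abelian_Groups" "HOL-Algebra.Subrings"
begin

section \<open>Bimodules\<close>

text \<open>As for modules in \<^theory>\<open>HOL-Algebra.Module\<close>, the record of bimodules extends \<^typ>\<open>'a ring\<close>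
  only for its additive part; the fields \<open>mult\<close> and \<open>one\<close> carry no meaning.\<close>

record ('l, 'r, 'a) bimodule = "'a ring" +
  lact :: "'l \<Rightarrow> 'a \<Rightarrow> 'a"
  ract :: "'a \<Rightarrow> 'r \<Rightarrow> 'a"

locale bimodule = L?: ring L + R?: ring R + X?: abelian_group X
  for L :: "('l, 'i) ring_scheme" and R :: "('r, 'j) ring_scheme"
    and X :: "('l, 'r, 'a, 'k) bimodule_scheme" (structure) +
  assumes lact_closed: "\<lbrakk>l \<in> carrier L; x \<in> carrier X\<rbrakk> \<Longrightarrow> lact X l x \<in> carrier X"
    and ract_closed: "\<lbrakk>r \<in> carrier R; x \<in> carrier X\<rbrakk> \<Longrightarrow> ract X x r \<in> carrier X"
    and lact_add: "\<lbrakk>l \<in> carrier L; x \<in> carrier X; y \<in> carrier X\<rbrakk>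
      \<Longrightarrow> lact X l (x \<oplus> y) = lact X l x \<oplus> lact X l y"
    and ract_add: "\<lbrakk>r \<in> carrier R; x \<in> carrier X; y \<in> carrier X\<rbrakk>
      \<Longrightarrow> ract X (x \<oplus> y) r = ract X x r \<oplus> ract X y r"
    and add_lact: "\<lbrakk>l \<in> carrier L; l' \<in> carrier L; x \<in> carrier X\<rbrakk>
      \<Longrightarrow> lact X (l \<oplus>\<^bsub>L\<^esub> l') x = lact X l x \<oplus> lact X l' x"
    and add_ract: "\<lbrakk>r \<in> carrier R; r' \<in> carrier R; x \<in> carrier X\<rbrakk>
      \<Longrightarrow> ract X x (r \<oplus>\<^bsub>R\<^esub> r') = ract X x r \<oplus> ract X x r'"
    and mult_lact: "\<lbrakk>l \<in> carrier L; l' \<in> carrier L; x \<in> carrier X\<rbrakk>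
      \<Longrightarrow> lact X (l \<otimes>\<^bsub>L\<^esub> l') x = lact X l (lact X l' x)"
    and mult_ract: "\<lbrakk>r \<in> carrier R; r' \<in> carrier R; x \<in> carrier X\<rbrakk>
      \<Longrightarrow> ract X x (r \<otimes>\<^bsub>R\<^esub> r') = ract X (ract X x r) r'"
    and one_lact: "x \<in> carrier X \<Longrightarrow> lact X \<one>\<^bsub>L\<^esub> x = x"
    and one_ract: "x \<in> carrier X \<Longrightarrow> ract X x \<one>\<^bsub>R\<^esub> = x"
    and lact_ract: "\<lbrakk>l \<in> carrier L; r \<in> carrier R; x \<in> carrier X\<rbrakk>
      \<Longrightarrow> ract X (lact X l x) r = lact X l (ract X x r)"

definition bimodule_hom ::
  "('l, 'i) ring_scheme \<Rightarrow> ('r, 'j) ring_scheme \<Rightarrow> ('l, 'r, 'a, 'k) bimodule_scheme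
    \<Rightarrow> ('l, 'r, 'b, 'm) bimodule_scheme \<Rightarrow> ('a \<Rightarrow> 'b) set"
  where "bimodule_hom L R X Y = {h. h \<in> carrier X \<rightarrow> carrier Y
    \<and> (\<forall>x\<in>carrier X. \<forall>x'\<in>carrier X. h (x \<oplus>\<^bsub>X\<^esub> x') = h x \<oplus>\<^bsub>Y\<^esub> h x')
    \<and> (\<forall>l\<in>carrier L. \<forall>x\<in>carrier X. h (lact X l x) = lact Y l (h x))
    \<and> (\<forall>r\<in>carrier R. \<forall>x\<in>carrier X. h (ract X x r) = ract Y (h x) r)}"

definition regular_bimodule :: "('a, 'i) ring_scheme \<Rightarrow> ('a, 'a, 'a) bimodule"
  where "regular_bimodule M = \<lparr>carrier = carrier M, mult = mult M, one = \<one>\<^bsub>M\<^esub>,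
    zero = \<zero>\<^bsub>M\<^esub>, add = add M, lact = mult M, ract = mult M\<rparr>"

definition restrict_scalars ::
  "('l' \<Rightarrow> 'l) \<Rightarrow> ('r' \<Rightarrow> 'r) \<Rightarrow> ('l, 'r, 'a, 'k) bimodule_scheme \<Rightarrow> ('l', 'r', 'a) bimodule"
  where "restrict_scalars g h X = \<lparr>carrier = carrier X, mult = mult X, one = \<one>\<^bsub>X\<^esub>,
    zero = \<zero>\<^bsub>X\<^esub>, add = add X, lact = (\<lambda>l. lact X (g l)), ract = (\<lambda>x r. ract X x (h r))\<rparr>"

definition bimodule_power ::
  "nat \<Rightarrow> ('l, 'r, 'a, 'k) bimodule_scheme \<Rightarrow> ('l, 'r, nat \<Rightarrow> 'a) bimodule"
  where "bimodule_power n X = \<lparr>carrier = {..<n} \<rightarrow>\<^sub>E carrier X, mult = undefined, one = undefined,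
    zero = (\<lambda>i\<in>{..<n}. \<zero>\<^bsub>X\<^esub>), add = (\<lambda>u v. \<lambda>i\<in>{..<n}. u i \<oplus>\<^bsub>X\<^esub> v i),
    lact = (\<lambda>l u. \<lambda>i\<in>{..<n}. lact X l (u i)), ract = (\<lambda>u r. \<lambda>i\<in>{..<n}. ract X (u i) r)\<rparr>"

definition subbimodule ::
  "('l, 'i) ring_scheme \<Rightarrow> ('r, 'j) ring_scheme \<Rightarrow> 'a set \<Rightarrow> ('l, 'r, 'a, 'k) bimodule_scheme \<Rightarrow> bool"
  where "subbimodule L R P X \<longleftrightarrow> subgroup P (add_monoid X)
    \<and> (\<forall>l\<in>carrier L. \<forall>x\<in>P. lact X l x \<in> P) \<and> (\<forall>r\<in>carrier R. \<forall>x\<in>P. ract X x r \<in> P)"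

definition direct_summand ::
  "('l, 'i) ring_scheme \<Rightarrow> ('r, 'j) ring_scheme \<Rightarrow> 'a set \<Rightarrow> ('l, 'r, 'a, 'k) bimodule_scheme \<Rightarrow> bool"
  where "direct_summand L R P X \<longleftrightarrow> subbimodule L R P X
    \<and> (\<exists>Q. subbimodule L R Q X \<and> P \<inter> Q = {\<zero>\<^bsub>X\<^esub>} \<and> P <+>\<^bsub>X\<^esub> Q = carrier X)"

definition iso_to_direct_summand ::
  "('l, 'i) ring_scheme \<Rightarrow> ('r, 'j) ring_scheme \<Rightarrow> ('l, 'r, 'a, 'k) bimodule_scheme
    \<Rightarrow> ('l, 'r, 'b, 'm) bimodule_scheme \<Rightarrow> bool"
  where "iso_to_direct_summand L R X Y \<longleftrightarrow>
    (\<exists>P h. direct_summand L R P Y \<and> h \<in> bimodule_hom L R X (Y\<lparr>carrier := P\<rparr>)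
      \<and> bij_betw h (carrier X) P)"


section \<open>Tensor products over a noncommutative ring\<close>

text \<open>\<open>X \<otimes> Y\<close> over \<open>R\<close>, for a right \<open>R\<close>-module \<open>X\<close> and a left \<open>R\<close>-module \<open>Y\<close>, is the free abelian
  group on \<open>carrier X \<times> carrier Y\<close> modulo the subgroup generated by the usual relations.\<close>

definition tensor_relations ::
  "('r, 'i) ring_scheme \<Rightarrow> ('l, 'r, 'a, 'j) bimodule_scheme \<Rightarrow> ('r, 's, 'b, 'k) bimodule_scheme
    \<Rightarrow> (('a \<times> 'b) \<Rightarrow>\<^sub>0 int) set"
  where "tensor_relations R X Y =
    {frag_of (x \<oplus>\<^bsub>X\<^esub> x', y) - frag_of (x, y) - frag_of (x', y) | x x' y.
        x \<in> carrier X \<and> x' \<in> carrier X \<and> y \<in> carrier Y}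
    \<union> {frag_of (x, y \<oplus>\<^bsub>Y\<^esub> y') - frag_of (x, y) - frag_of (x, y') | x y y'.
        x \<in> carrier X \<and> y \<in> carrier Y \<and> y' \<in> carrier Y}
    \<union> {frag_of (ract X x r, y) - frag_of (x, lact Y r y) | x r y.
        x \<in> carrier X \<and> r \<in> carrier R \<and> y \<in> carrier Y}"

definition tensor_kernel ::
  "('r, 'i) ring_scheme \<Rightarrow> ('l, 'r, 'a, 'j) bimodule_scheme \<Rightarrow> ('r, 's, 'b, 'k) bimodule_scheme
    \<Rightarrow> (('a \<times> 'b) \<Rightarrow>\<^sub>0 int) set"
  where "tensor_kernel R X Y =
    generate (free_Abelian_group (carrier X \<times> carrier Y)) (tensor_relations R X Y)"

definition tensor_group ::
  "('r, 'i) ring_scheme \<Rightarrow> ('l, 'r, 'a, 'j) bimodule_scheme \<Rightarrow> ('r, 's, 'b, 'k) bimodule_scheme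
    \<Rightarrow> (('a \<times> 'b) \<Rightarrow>\<^sub>0 int) set ring"
  where "tensor_group R X Y =
    (let Q = free_Abelian_group (carrier X \<times> carrier Y) Mod tensor_kernel R X Y
     in \<lparr>carrier = carrier Q, mult = undefined, one = undefined, zero = \<one>\<^bsub>Q\<^esub>, add = mult Q\<rparr>)"

definition pure_tensor ::
  "('r, 'i) ring_scheme \<Rightarrow> ('l, 'r, 'a, 'j) bimodule_scheme \<Rightarrow> ('r, 's, 'b, 'k) bimodule_scheme
    \<Rightarrow> 'a \<Rightarrow> 'b \<Rightarrow> (('a \<times> 'b) \<Rightarrow>\<^sub>0 int) set"
  where "pure_tensor R X Y x y =
    tensor_kernel R X Y #>\<^bsub>free_Abelian_group (carrier X \<times> carrier Y)\<^esub> frag_of (x, y)"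

text \<open>The homomorphism \<open>X \<otimes> Y \<rightarrow> A\<close> induced by a balanced biadditive map \<open>\<phi>\<close>, evaluated through
  an arbitrary representative of \<open>u\<close>; it interprets the convention of writing \<open>u = u1 \<otimes> u2\<close> with
  suppressed summation: \<open>tensor_lift A (\<lambda>u1 u2. \<phi> u1 u2) u\<close> is \<open>\<Sum> \<phi> u1 u2\<close>.
  See \<open>tensor_lift_pure\<close> and \<open>tensor_lift_add\<close> below.\<close>

definition tensor_lift ::
  "('c, 'i) ring_scheme \<Rightarrow> ('a \<Rightarrow> 'b \<Rightarrow> 'c) \<Rightarrow> (('a \<times> 'b) \<Rightarrow>\<^sub>0 int) set \<Rightarrow> 'c"
  where "tensor_lift A \<phi> u =
    (let c = (SOME c. c \<in> u)
     in \<Oplus>\<^bsub>A\<^esub>p\<in>Poly_Mapping.keys c. [Poly_Mapping.lookup c p] \<cdot>\<^bsub>A\<^esub> \<phi> (fst p) (snd p))"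

definition tensor ::
  "('r, 'i) ring_scheme \<Rightarrow> ('l, 'r, 'a, 'j) bimodule_scheme \<Rightarrow> ('r, 's, 'b, 'k) bimodule_scheme
    \<Rightarrow> ('l, 's, (('a \<times> 'b) \<Rightarrow>\<^sub>0 int) set) bimodule"
  where "tensor R X Y = ring.extend (tensor_group R X Y) (bimodule.fields
    (\<lambda>l. tensor_lift (tensor_group R X Y) (\<lambda>x y. pure_tensor R X Y (lact X l x) y))
    (\<lambda>u s. tensor_lift (tensor_group R X Y) (\<lambda>x y. pure_tensor R X Y x (ract Y y s)) u))"

definition balanced_map ::
  "('r, 'i) ring_scheme \<Rightarrow> ('l, 'r, 'a, 'j) bimodule_scheme \<Rightarrow> ('r, 's, 'b, 'k) bimodule_scheme
    \<Rightarrow> ('c, 'm) ring_scheme \<Rightarrow> ('a \<Rightarrow> 'b \<Rightarrow> 'c) \<Rightarrow> bool"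
  where "balanced_map R X Y A \<phi> \<longleftrightarrow>
    (\<forall>x\<in>carrier X. \<forall>y\<in>carrier Y. \<phi> x y \<in> carrier A)
    \<and> (\<forall>x\<in>carrier X. \<forall>x'\<in>carrier X. \<forall>y\<in>carrier Y. \<phi> (x \<oplus>\<^bsub>X\<^esub> x') y = \<phi> x y \<oplus>\<^bsub>A\<^esub> \<phi> x' y)
    \<and> (\<forall>x\<in>carrier X. \<forall>y\<in>carrier Y. \<forall>y'\<in>carrier Y. \<phi> x (y \<oplus>\<^bsub>Y\<^esub> y') = \<phi> x y \<oplus>\<^bsub>A\<^esub> \<phi> x y')
    \<and> (\<forall>x\<in>carrier X. \<forall>r\<in>carrier R. \<forall>y\<in>carrier Y. \<phi> (ract X x r) y = \<phi> x (lact Y r y))"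

lemma keys_diff_subset:
  "\<lbrakk>Poly_Mapping.keys a \<subseteq> C; Poly_Mapping.keys b \<subseteq> C\<rbrakk> \<Longrightarrow> Poly_Mapping.keys (a - b) \<subseteq> C"
  using keys_diff[of a b] by blast

lemma tensor_relations_subset:
  assumes "bimodule L R X" "bimodule R S Y"
  shows "tensor_relations R X Y \<subseteq> carrier (free_Abelian_group (carrier X \<times> carrier Y))"
proof -
  interpret X: bimodule L R X by fact
  interpret Y: bimodule R S Y by fact
  show ?thesis
    unfolding tensor_relations_def
    by (intro Un_least subsetI; elim CollectE exE conjE; simp only: carrier_free_Abelian_group_iff)
      (intro keys_diff_subset; simp add: X.ract_closed Y.lact_closed)+
qed

lemma tensor_lift_coset:
  assumes X: "bimodule L R X" and Y: "bimodule R S Y" and A: "abelian_group A"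
    and \<phi>: "balanced_map R X Y A \<phi>"
  obtains h where "h \<in> hom (free_Abelian_group (carrier X \<times> carrier Y)) (add_monoid A)"
    and "\<And>x y. \<lbrakk>x \<in> carrier X; y \<in> carrier Y\<rbrakk> \<Longrightarrow> h (frag_of (x, y)) = \<phi> x y"
    and "\<And>c. Poly_Mapping.keys c \<subseteq> carrier X \<times> carrier Y \<Longrightarrow>
      tensor_lift A \<phi> (tensor_kernel R X Y #>\<^bsub>free_Abelian_group (carrier X \<times> carrier Y)\<^esub> c) = h c"
proof -
  interpret X: bimodule L R X by fact
  interpret Y: bimodule R S Y by fact
  interpret A: abelian_group A by fact
  have AC: "comm_group (add_monoid A)" by (rule A.a_comm_group)
  then have AG: "group (add_monoid A)" by (rule comm_group.axioms)
  let ?S = "carrier X \<times> carrier Y"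
  let ?F = "free_Abelian_group ?S"
  let ?K = "tensor_kernel R X Y"
  interpret F: comm_group ?F by (rule abelian_free_Abelian_group)
  have "(\<lambda>p. \<phi> (fst p) (snd p)) ` ?S \<subseteq> carrier (add_monoid A)"
    using \<phi> by (auto simp: balanced_map_def)
  then obtain h where h: "h \<in> hom ?F (add_monoid A)" and hf: "\<And>p. p \<in> ?S \<Longrightarrow> h (frag_of p) = \<phi> (fst p) (snd p)"
    using comm_group.free_Abelian_group_universal[OF AC] by blast
  interpret h: group_hom ?F "add_monoid A" h
    using h AG by (simp add: group_hom_def group_hom_axioms_def)
  have eval: "(\<Oplus>\<^bsub>A\<^esub>p\<in>Poly_Mapping.keys c. [Poly_Mapping.lookup c p] \<cdot>\<^bsub>A\<^esub> \<phi> (fst p) (snd p)) = h c"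
    if c: "Poly_Mapping.keys c \<subseteq> ?S" for c
  proof -
    have "(\<Oplus>\<^bsub>A\<^esub>p\<in>J. [Poly_Mapping.lookup c p] \<cdot>\<^bsub>A\<^esub> \<phi> (fst p) (snd p))
        = h (\<Sum>p\<in>J. frag_cmul (Poly_Mapping.lookup c p) (frag_of p))"
      if "finite J" "J \<subseteq> ?S" for J
      using that
    proof (induction J)
      case empty
      have "h 0 = \<zero>\<^bsub>A\<^esub>" using h.hom_one by simp
      then show ?case by simp
    next
      case (insert p J)
      have c1: "frag_cmul (Poly_Mapping.lookup c q) (frag_of q) \<in> carrier ?F" if "q \<in> ?S" for q
        using that keys_cmul[of _ "frag_of q"] by fastforce
      have c2: "(\<Sum>q\<in>J. frag_cmul (Poly_Mapping.lookup c q) (frag_of q)) \<in> carrier ?F"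
        by (rule sum_closed_free_Abelian_group) (use insert.prems c1 in blast)
      have "h (frag_cmul (Poly_Mapping.lookup c p) (frag_of p)) = [Poly_Mapping.lookup c p] \<cdot>\<^bsub>A\<^esub> \<phi> (fst p) (snd p)"
      proof -
        have "h (frag_of p [^]\<^bsub>?F\<^esub> Poly_Mapping.lookup c p) = h (frag_of p) [^]\<^bsub>add_monoid A\<^esub> Poly_Mapping.lookup c p"
          by (rule h.hom_int_pow) (use insert.prems in simp)
        then show ?thesis using insert.prems hf by (simp add: add_pow_def)
      qed
      moreover have "(\<lambda>p. [Poly_Mapping.lookup c p] \<cdot>\<^bsub>A\<^esub> \<phi> (fst p) (snd p)) \<in> insert p J \<rightarrow> carrier A"
      proof
        fix q assume "q \<in> insert p J"
        then have "\<phi> (fst q) (snd q) \<in> carrier A" using insert.prems \<phi> by (auto simp: balanced_map_def)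
        then show "[Poly_Mapping.lookup c q] \<cdot>\<^bsub>A\<^esub> \<phi> (fst q) (snd q) \<in> carrier A"
          using group.int_pow_closed[OF AG] by (simp add: add_pow_def)
      qed
      moreover have "h (frag_cmul (Poly_Mapping.lookup c p) (frag_of p) + (\<Sum>q\<in>J. frag_cmul (Poly_Mapping.lookup c q) (frag_of q)))
         = h (frag_cmul (Poly_Mapping.lookup c p) (frag_of p)) \<oplus>\<^bsub>A\<^esub> h (\<Sum>q\<in>J. frag_cmul (Poly_Mapping.lookup c q) (frag_of q))"
        using h.hom_mult[OF c1[of p] c2] insert.prems by simp
      ultimately show ?case
        using insert A.finsum_insert[of J p "\<lambda>p. [Poly_Mapping.lookup c p] \<cdot>\<^bsub>A\<^esub> \<phi> (fst p) (snd p)"]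
        by (simp add: Pi_iff)
    qed
    from this[OF finite_keys c] show ?thesis
      by (simp only: frag_extend_def[symmetric] frag_expansion[symmetric])
  qed
  have rel: "h u = \<zero>\<^bsub>A\<^esub>" if "u \<in> tensor_relations R X Y" for u
  proof -
    have d: "h (frag_of p - frag_of q) = h (frag_of p) \<ominus>\<^bsub>A\<^esub> h (frag_of q)" if "p \<in> ?S" "q \<in> ?S" for p q
    proof -
      have "h (frag_of p \<otimes>\<^bsub>?F\<^esub> inv\<^bsub>?F\<^esub> frag_of q) = h (frag_of p) \<otimes>\<^bsub>add_monoid A\<^esub> inv\<^bsub>add_monoid A\<^esub> h (frag_of q)"
        using that h.hom_mult[of "frag_of p" "inv\<^bsub>?F\<^esub> frag_of q"] h.hom_inv[of "frag_of q"] F.inv_closed[of "frag_of q"] by simp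
      then show ?thesis using that by (simp add: a_minus_def a_inv_def)
    qed
    have d3: "h (frag_of p - frag_of q - frag_of q') = \<zero>\<^bsub>A\<^esub>"
      if "p \<in> ?S" "q \<in> ?S" "q' \<in> ?S" and e: "h (frag_of p) = h (frag_of q) \<oplus>\<^bsub>A\<^esub> h (frag_of q')" for p q q'
    proof -
      have m: "frag_of q + frag_of q' \<in> carrier ?F"
        using F.m_closed[of "frag_of q" "frag_of q'"] that by simp
      have s: "h (frag_of q + frag_of q') = h (frag_of p)"
        using h.hom_mult[of "frag_of q" "frag_of q'"] that by simp
      have "h (frag_of p \<otimes>\<^bsub>?F\<^esub> inv\<^bsub>?F\<^esub> (frag_of q + frag_of q')) = h (frag_of p) \<otimes>\<^bsub>add_monoid A\<^esub> inv\<^bsub>add_monoid A\<^esub> h (frag_of p)"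
        using that m s h.hom_mult[of "frag_of p" "inv\<^bsub>?F\<^esub> (frag_of q + frag_of q')"] h.hom_inv[OF m] F.inv_closed[OF m] by simp
      also have "\<dots> = \<zero>\<^bsub>A\<^esub>"
        using group.r_inv[OF AG, of "h (frag_of p)"] h.hom_closed[of "frag_of p"] that by simp
      finally show ?thesis using m by (simp add: algebra_simps)
    qed
    have hc: "h (frag_of p) \<in> carrier A" if "p \<in> ?S" for p using h.hom_closed[of "frag_of p"] that by simp
    show ?thesis
      using that unfolding tensor_relations_def
      apply (elim UnE CollectE exE conjE)
      subgoal by (simp only:) (rule d3, use \<phi> hf in \<open>auto simp: balanced_map_def\<close>)
      subgoal by (simp only:) (rule d3, use \<phi> hf in \<open>auto simp: balanced_map_def\<close>)
      subgoal for x r y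
        using d[of "(ract X x r, y)" "(x, lact Y r y)"] hf[of "(ract X x r, y)"] hf[of "(x, lact Y r y)"] \<phi> hc[of "(x, lact Y r y)"]
        by (simp add: balanced_map_def X.ract_closed Y.lact_closed A.r_neg a_minus_def)
      done
  qed
  have sub: "tensor_relations R X Y \<subseteq> carrier ?F" by (rule tensor_relations_subset[OF X Y])
  have ker: "h u = \<zero>\<^bsub>A\<^esub>" if "u \<in> ?K" for u
  proof -
    have "subgroup (kernel ?F (add_monoid A) h) ?F" by (rule h.subgroup_kernel)
    moreover have "tensor_relations R X Y \<subseteq> kernel ?F (add_monoid A) h"
      using rel sub by (auto simp: kernel_def simp del: carrier_free_Abelian_group_iff)
    ultimately have "?K \<subseteq> kernel ?F (add_monoid A) h"
      unfolding tensor_kernel_def by (rule F.generate_subgroup_incl[rotated])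
    then show ?thesis using that by (auto simp: kernel_def)
  qed
  have K: "subgroup ?K ?F" unfolding tensor_kernel_def by (rule F.generate_is_subgroup[OF sub])
  have "tensor_lift A \<phi> (?K #>\<^bsub>?F\<^esub> c) = h c" if c: "Poly_Mapping.keys c \<subseteq> ?S" for c
  proof -
    define d where "d = (SOME d. d \<in> ?K #>\<^bsub>?F\<^esub> c)"
    have "c \<in> ?K #>\<^bsub>?F\<^esub> c" using F.rcos_self[OF _ K, of c] c by simp
    then have "d \<in> ?K #>\<^bsub>?F\<^esub> c" unfolding d_def by (rule someI)
    then obtain k where k: "k \<in> ?K" "d = k \<otimes>\<^bsub>?F\<^esub> c" by (auto simp: r_coset_def)
    have kF: "k \<in> carrier ?F" using subgroup.subset[OF K] k(1) by (rule subsetD)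
    have dF: "d \<in> carrier ?F" unfolding k(2) by (rule F.m_closed[OF kF]) (use c in simp)
    have "h d = h k \<oplus>\<^bsub>A\<^esub> h c" using h.hom_mult[OF kF, of c] c k(2) by simp
    also have "\<dots> = h c" using ker[OF k(1)] h.hom_closed[of c] c by simp
    finally show ?thesis unfolding tensor_lift_def Let_def d_def[symmetric] using eval[of d] dF by simp
  qed
  with h hf show thesis
    by (intro that[of h]) simp_all
qed

lemma tensor_lift_pure:
  assumes "bimodule L R X" "bimodule R S Y" "abelian_group A" "balanced_map R X Y A \<phi>"
    and "x \<in> carrier X" "y \<in> carrier Y"
  shows "tensor_lift A \<phi> (pure_tensor R X Y x y) = \<phi> x y"
proof -
  obtain h where "h (frag_of (x, y)) = \<phi> x y"
    and "tensor_lift A \<phi> (tensor_kernel R X Y #>\<^bsub>free_Abelian_group (carrier X \<times> carrier Y)\<^esub>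
      frag_of (x, y)) = h (frag_of (x, y))"
    by (rule tensor_lift_coset[OF assms(1-4)]) (use assms(5,6) in auto)
  then show ?thesis by (simp add: pure_tensor_def)
qed

lemma tensor_lift_add:
  assumes X: "bimodule L R X" and Y: "bimodule R S Y" and A: "abelian_group A"
    and \<phi>: "balanced_map R X Y A \<phi>"
    and u: "u \<in> carrier (tensor R X Y)" and v: "v \<in> carrier (tensor R X Y)"
  shows "tensor_lift A \<phi> (u \<oplus>\<^bsub>tensor R X Y\<^esub> v) = tensor_lift A \<phi> u \<oplus>\<^bsub>A\<^esub> tensor_lift A \<phi> v"
proof -
  let ?F = "free_Abelian_group (carrier X \<times> carrier Y)"
  let ?K = "tensor_kernel R X Y"
  interpret F: comm_group ?F by (rule abelian_free_Abelian_group)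
  have "subgroup ?K ?F"
    unfolding tensor_kernel_def by (rule F.generate_is_subgroup[OF tensor_relations_subset[OF X Y]])
  then interpret K: normal ?K ?F by (rule F.subgroup_imp_normal)
  obtain h where h: "h \<in> hom ?F (add_monoid A)"
    and lift: "\<And>c. c \<in> carrier ?F \<Longrightarrow> tensor_lift A \<phi> (?K #>\<^bsub>?F\<^esub> c) = h c"
    by (rule tensor_lift_coset[OF X Y A \<phi>]) auto
  obtain c d where c: "c \<in> carrier ?F" "u = ?K #>\<^bsub>?F\<^esub> c" and d: "d \<in> carrier ?F" "v = ?K #>\<^bsub>?F\<^esub> d"
    using u v by (auto simp: tensor_def tensor_group_def Let_def FactGroup_def RCOSETS_def
        ring.defs bimodule.defs simp del: carrier_free_Abelian_group_iff)
  have "u \<oplus>\<^bsub>tensor R X Y\<^esub> v = ?K #>\<^bsub>?F\<^esub> (c \<otimes>\<^bsub>?F\<^esub> d)"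
    using K.rcos_sum[OF c(1) d(1)] c(2) d(2)
    by (simp add: tensor_def tensor_group_def Let_def FactGroup_def ring.defs bimodule.defs)
  then show ?thesis
    using lift[OF F.m_closed[OF c(1) d(1)]] lift c d hom_mult[OF h c(1) d(1)] by simp
qed

definition tensor_map ::
  "('r, 'i) ring_scheme \<Rightarrow> ('l, 'r, 'c, 'j) bimodule_scheme \<Rightarrow> ('r, 's, 'd, 'k) bimodule_scheme
    \<Rightarrow> ('a \<Rightarrow> 'c) \<Rightarrow> ('b \<Rightarrow> 'd) \<Rightarrow> (('a \<times> 'b) \<Rightarrow>\<^sub>0 int) set \<Rightarrow> (('c \<times> 'd) \<Rightarrow>\<^sub>0 int) set"
  where "tensor_map R X' Y' h k = tensor_lift (tensor R X' Y') (\<lambda>x y. pure_tensor R X' Y' (h x) (k y))"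

text \<open>\<open>(X \<otimes> Y) \<otimes> Z \<rightarrow> X \<otimes> (Y \<otimes> Z)\<close>\<close>

definition tensor_assoc ::
  "('r, 'i) ring_scheme \<Rightarrow> ('s, 'j) ring_scheme \<Rightarrow> ('l, 'r, 'a, 'k) bimodule_scheme
    \<Rightarrow> ('r, 's, 'b, 'm) bimodule_scheme \<Rightarrow> ('s, 't, 'c, 'n) bimodule_scheme
    \<Rightarrow> (((('a \<times> 'b) \<Rightarrow>\<^sub>0 int) set \<times> 'c) \<Rightarrow>\<^sub>0 int) set \<Rightarrow> (('a \<times> (('b \<times> 'c) \<Rightarrow>\<^sub>0 int) set) \<Rightarrow>\<^sub>0 int) set"
  where "tensor_assoc R S X Y Z = (let T = tensor R X (tensor S Y Z) in
    tensor_lift T (\<lambda>u z. tensor_lift T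
      (\<lambda>x y. pure_tensor R X (tensor S Y Z) x (pure_tensor S Y Z y z)) u))"


section \<open>Right bialgebroids and their module algebroids\<close>

definition opposite_ring :: "('a, 'i) ring_scheme \<Rightarrow> ('a, 'i) ring_scheme"
  where "opposite_ring R = R\<lparr>mult := (\<lambda>x y. y \<otimes>\<^bsub>R\<^esub> x)\<rparr>"

definition bialgebroid_bimodule ::
  "('b, 'i) ring_scheme \<Rightarrow> ('r \<Rightarrow> 'b) \<Rightarrow> ('r \<Rightarrow> 'b) \<Rightarrow> ('r, 'r, 'b) bimodule"
  where "bialgebroid_bimodule B s t = \<lparr>carrier = carrier B, mult = mult B, one = \<one>\<^bsub>B\<^esub>,
    zero = \<zero>\<^bsub>B\<^esub>, add = add B, lact = (\<lambda>r b. b \<otimes>\<^bsub>B\<^esub> t r), ract = (\<lambda>b r. b \<otimes>\<^bsub>B\<^esub> s r)\<rparr>"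

definition bialgebroid_square ::
  "('r, 'i) ring_scheme \<Rightarrow> ('b, 'j) ring_scheme \<Rightarrow> ('r \<Rightarrow> 'b) \<Rightarrow> ('r \<Rightarrow> 'b)
    \<Rightarrow> ('r, 'r, (('b \<times> 'b) \<Rightarrow>\<^sub>0 int) set) bimodule"
  where "bialgebroid_square R B s t =
    tensor R (bialgebroid_bimodule B s t) (bialgebroid_bimodule B s t)"

definition bialgebroid_tensor ::
  "('r, 'i) ring_scheme \<Rightarrow> ('b, 'j) ring_scheme \<Rightarrow> ('r \<Rightarrow> 'b) \<Rightarrow> ('r \<Rightarrow> 'b)
    \<Rightarrow> 'b \<Rightarrow> 'b \<Rightarrow> (('b \<times> 'b) \<Rightarrow>\<^sub>0 int) set"
  where "bialgebroid_tensor R B s t =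
    pure_tensor R (bialgebroid_bimodule B s t) (bialgebroid_bimodule B s t)"

text \<open>The order of the two lifts in the product \<open>U V\<close> matters: for fixed \<open>a, a'\<close> the inner map is
  balanced in the components of \<open>V\<close>; the outer one is balanced in those of \<open>U\<close> because \<open>V\<close>
  satisfies the Takeuchi condition.\<close>

definition takeuchi_product ::
  "('r, 'i) ring_scheme \<Rightarrow> ('b, 'j) ring_scheme \<Rightarrow> ('r \<Rightarrow> 'b) \<Rightarrow> ('r \<Rightarrow> 'b)
    \<Rightarrow> (('b \<times> 'b) \<Rightarrow>\<^sub>0 int) set ring"
  where "takeuchi_product R B s t = (let T = bialgebroid_square R B s t;
      tens = bialgebroid_tensor R B s t in
    \<lparr>carrier = {U \<in> carrier T. \<forall>r\<in>carrier R.
        tensor_lift T (\<lambda>a a'. tens (s r \<otimes>\<^bsub>B\<^esub> a) a') U = tensor_lift T (\<lambda>a a'. tens a (t r \<otimes>\<^bsub>B\<^esub> a')) U},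
     mult = (\<lambda>U V. tensor_lift T (\<lambda>a a'. tensor_lift T
        (\<lambda>c c'. tens (a \<otimes>\<^bsub>B\<^esub> c) (a' \<otimes>\<^bsub>B\<^esub> c')) V) U),
     one = tens \<one>\<^bsub>B\<^esub> \<one>\<^bsub>B\<^esub>, zero = \<zero>\<^bsub>T\<^esub>, add = add T\<rparr>)"

locale right_bialgebroid = R?: ring R + B?: ring B
  for R :: "('r, 'i) ring_scheme" and B :: "('b, 'j) ring_scheme" +
  fixes s t :: "'r \<Rightarrow> 'b"
    and \<Delta> :: "'b \<Rightarrow> (('b \<times> 'b) \<Rightarrow>\<^sub>0 int) set" and \<epsilon> :: "'b \<Rightarrow> 'r"
  assumes source_hom: "s \<in> ring_hom R B"
    and target_hom: "t \<in> ring_hom (opposite_ring R) B"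
    and source_target: "\<lbrakk>r \<in> carrier R; r' \<in> carrier R\<rbrakk> \<Longrightarrow> s r' \<otimes>\<^bsub>B\<^esub> t r = t r \<otimes>\<^bsub>B\<^esub> s r'"
    and bimodule: "bimodule R R (bialgebroid_bimodule B s t)"
    and comult_hom: "\<Delta> \<in> bimodule_hom R R (bialgebroid_bimodule B s t) (bialgebroid_square R B s t)"
    and counit_hom: "\<epsilon> \<in> bimodule_hom R R (bialgebroid_bimodule B s t) (regular_bimodule R)"
    and coassoc: "b \<in> carrier B \<Longrightarrow>
      (let X = bialgebroid_bimodule B s t; X2 = bialgebroid_square R B s t in
        tensor_assoc R R X X X (tensor_map R X2 X \<Delta> (\<lambda>a. a) (\<Delta> b))
          = tensor_map R X X2 (\<lambda>a. a) \<Delta> (\<Delta> b))"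
    and counit_left: "b \<in> carrier B \<Longrightarrow>
      tensor_lift B (\<lambda>a a'. lact (bialgebroid_bimodule B s t) (\<epsilon> a) a') (\<Delta> b) = b"
    and counit_right: "b \<in> carrier B \<Longrightarrow>
      tensor_lift B (\<lambda>a a'. ract (bialgebroid_bimodule B s t) a (\<epsilon> a')) (\<Delta> b) = b"
    and comult_takeuchi: "ring_hom_ring B (takeuchi_product R B s t) \<Delta>"
    and counit_one: "\<epsilon> \<one>\<^bsub>B\<^esub> = \<one>\<^bsub>R\<^esub>"
    and counit_target: "\<lbrakk>a \<in> carrier B; b \<in> carrier B\<rbrakk> \<Longrightarrow> \<epsilon> (t (\<epsilon> a) \<otimes>\<^bsub>B\<^esub> b) = \<epsilon> (a \<otimes>\<^bsub>B\<^esub> b)"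
    and counit_source: "\<lbrakk>a \<in> carrier B; b \<in> carrier B\<rbrakk> \<Longrightarrow> \<epsilon> (s (\<epsilon> a) \<otimes>\<^bsub>B\<^esub> b) = \<epsilon> (a \<otimes>\<^bsub>B\<^esub> b)"

locale right_module = B?: ring B + P?: abelian_group P
  for B :: "('b, 'i) ring_scheme" and P :: "('p, 'j) ring_scheme" +
  fixes act :: "'p \<Rightarrow> 'b \<Rightarrow> 'p"
  assumes act_closed: "\<lbrakk>p \<in> carrier P; b \<in> carrier B\<rbrakk> \<Longrightarrow> act p b \<in> carrier P"
    and add_act: "\<lbrakk>p \<in> carrier P; p' \<in> carrier P; b \<in> carrier B\<rbrakk>
      \<Longrightarrow> act (p \<oplus>\<^bsub>P\<^esub> p') b = act p b \<oplus>\<^bsub>P\<^esub> act p' b"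
    and act_add: "\<lbrakk>p \<in> carrier P; b \<in> carrier B; b' \<in> carrier B\<rbrakk>
      \<Longrightarrow> act p (b \<oplus>\<^bsub>B\<^esub> b') = act p b \<oplus>\<^bsub>P\<^esub> act p b'"
    and act_mult: "\<lbrakk>p \<in> carrier P; b \<in> carrier B; b' \<in> carrier B\<rbrakk>
      \<Longrightarrow> act p (b \<otimes>\<^bsub>B\<^esub> b') = act (act p b) b'"
    and act_one: "p \<in> carrier P \<Longrightarrow> act p \<one>\<^bsub>B\<^esub> = p"

definition module_algebroid_bimodule ::
  "('p, 'i) ring_scheme \<Rightarrow> ('p \<Rightarrow> 'b \<Rightarrow> 'p) \<Rightarrow> ('r \<Rightarrow> 'b) \<Rightarrow> ('r \<Rightarrow> 'b) \<Rightarrow> ('r, 'r, 'p) bimodule"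
  where "module_algebroid_bimodule P act s t = \<lparr>carrier = carrier P, mult = mult P, one = \<one>\<^bsub>P\<^esub>,
    zero = \<zero>\<^bsub>P\<^esub>, add = add P, lact = (\<lambda>r p. act p (t r)), ract = (\<lambda>p r. act p (s r))\<rparr>"

locale right_module_algebroid = right_bialgebroid R B s t \<Delta> \<epsilon> + P?: ring P + right_module B P act
  for R :: "('r, 'i) ring_scheme" and B :: "('b, 'j) ring_scheme" and s t \<Delta> \<epsilon>
    and P :: "('p, 'k) ring_scheme" and act +
  assumes bimodule_P: "bimodule R R (module_algebroid_bimodule P act s t)"
    and mult_tensor: "let X = module_algebroid_bimodule P act s t in
      \<exists>\<mu> \<in> bimodule_hom R R (tensor R X X) X.
        \<forall>p\<in>carrier P. \<forall>p'\<in>carrier P. \<mu> (pure_tensor R X X p p') = p \<otimes>\<^bsub>P\<^esub> p'"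
    and mult_act: "\<lbrakk>p \<in> carrier P; p' \<in> carrier P; b \<in> carrier B\<rbrakk>
      \<Longrightarrow> act (p \<otimes>\<^bsub>P\<^esub> p') b = tensor_lift P (\<lambda>a a'. act p a \<otimes>\<^bsub>P\<^esub> act p' a') (\<Delta> b)"
    and unit_bimodule: "r \<in> carrier R \<Longrightarrow>
      lact (module_algebroid_bimodule P act s t) r \<one>\<^bsub>P\<^esub>
        = ract (module_algebroid_bimodule P act s t) \<one>\<^bsub>P\<^esub> r"
    and unit_act: "b \<in> carrier B \<Longrightarrow>
      act \<one>\<^bsub>P\<^esub> b = ract (module_algebroid_bimodule P act s t) \<one>\<^bsub>P\<^esub> (\<epsilon> b)"


section \<open>Depth two ring extensions\<close>

text \<open>In this section \<open>f\<close> is the homomorphism \<open>N \<rightarrow> M\<close> of the extension.\<close>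

definition ext_tensor ::
  "('n, 'i) ring_scheme \<Rightarrow> ('m, 'j) ring_scheme \<Rightarrow> ('n \<Rightarrow> 'm)
    \<Rightarrow> ('m, 'm, (('m \<times> 'm) \<Rightarrow>\<^sub>0 int) set) bimodule"
  where "ext_tensor N M f = tensor N (restrict_scalars (\<lambda>x. x) f (regular_bimodule M))
    (restrict_scalars f (\<lambda>x. x) (regular_bimodule M))"

definition ext_pure ::
  "('n, 'i) ring_scheme \<Rightarrow> ('m, 'j) ring_scheme \<Rightarrow> ('n \<Rightarrow> 'm) \<Rightarrow> 'm \<Rightarrow> 'm \<Rightarrow> (('m \<times> 'm) \<Rightarrow>\<^sub>0 int) set"
  where "ext_pure N M f = pure_tensor N (restrict_scalars (\<lambda>x. x) f (regular_bimodule M))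
    (restrict_scalars f (\<lambda>x. x) (regular_bimodule M))"

definition left_D2 :: "('n, 'i) ring_scheme \<Rightarrow> ('m, 'j) ring_scheme \<Rightarrow> ('n \<Rightarrow> 'm) \<Rightarrow> bool"
  where "left_D2 N M f \<longleftrightarrow> (\<exists>n\<ge>1. iso_to_direct_summand N M
    (restrict_scalars f (\<lambda>x. x) (ext_tensor N M f))
    (bimodule_power n (restrict_scalars f (\<lambda>x. x) (regular_bimodule M))))"

definition right_D2 :: "('n, 'i) ring_scheme \<Rightarrow> ('m, 'j) ring_scheme \<Rightarrow> ('n \<Rightarrow> 'm) \<Rightarrow> bool"
  where "right_D2 N M f \<longleftrightarrow> (\<exists>n\<ge>1. iso_to_direct_summand M N
    (restrict_scalars (\<lambda>x. x) f (ext_tensor N M f))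
    (bimodule_power n (restrict_scalars (\<lambda>x. x) f (regular_bimodule M))))"

definition D2 :: "('n, 'i) ring_scheme \<Rightarrow> ('m, 'j) ring_scheme \<Rightarrow> ('n \<Rightarrow> 'm) \<Rightarrow> bool"
  where "D2 N M f \<longleftrightarrow> left_D2 N M f \<and> right_D2 N M f"

definition invariant_elements ::
  "('n, 'i) ring_scheme \<Rightarrow> ('n, 'n, 'a, 'j) bimodule_scheme \<Rightarrow> 'a set"
  where "invariant_elements N X = {x \<in> carrier X. \<forall>n\<in>carrier N. lact X n x = ract X x n}"

definition centralizer_ring ::
  "('n, 'i) ring_scheme \<Rightarrow> ('m, 'j) ring_scheme \<Rightarrow> ('n \<Rightarrow> 'm) \<Rightarrow> ('m, 'j) ring_scheme"
  where "centralizer_ring N M f =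
    M\<lparr>carrier := invariant_elements N (restrict_scalars f f (regular_bimodule M))\<rparr>"

text \<open>In the product \<open>b b' = b'1 b1 \<otimes> b2 b'2\<close> the order of the lifts matters: for fixed \<open>x', y'\<close> the
  inner map is balanced in the components of \<open>b\<close>; the outer one is balanced in those of \<open>b'\<close>
  because \<open>b\<close> commutes with \<open>N\<close>.\<close>

definition tensor_ring ::
  "('n, 'i) ring_scheme \<Rightarrow> ('m, 'j) ring_scheme \<Rightarrow> ('n \<Rightarrow> 'm) \<Rightarrow> (('m \<times> 'm) \<Rightarrow>\<^sub>0 int) set ring"
  where "tensor_ring N M f = (let T = ext_tensor N M f in
    \<lparr>carrier = invariant_elements N (restrict_scalars f f T),
     mult = (\<lambda>b b'. tensor_lift T (\<lambda>x' y'. tensor_lift T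
        (\<lambda>x y. ext_pure N M f (x' \<otimes>\<^bsub>M\<^esub> x) (y \<otimes>\<^bsub>M\<^esub> y')) b) b'),
     one = ext_pure N M f \<one>\<^bsub>M\<^esub> \<one>\<^bsub>M\<^esub>, zero = \<zero>\<^bsub>T\<^esub>, add = add T\<rparr>)"

definition left_D2_quasibasis ::
  "('n, 'i) ring_scheme \<Rightarrow> ('m, 'j) ring_scheme \<Rightarrow> ('n \<Rightarrow> 'm) \<Rightarrow> 'k set
    \<Rightarrow> ('k \<Rightarrow> (('m \<times> 'm) \<Rightarrow>\<^sub>0 int) set) \<Rightarrow> ('k \<Rightarrow> 'm \<Rightarrow> 'm) \<Rightarrow> bool"
  where "left_D2_quasibasis N M f I b \<beta> \<longleftrightarrow> finite I
    \<and> (\<forall>i\<in>I. b i \<in> invariant_elements N (restrict_scalars f f (ext_tensor N M f)))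
    \<and> (\<forall>i\<in>I. \<beta> i \<in> bimodule_hom N N (restrict_scalars f f (regular_bimodule M))
                                     (restrict_scalars f f (regular_bimodule M)))
    \<and> (\<forall>m\<in>carrier M. (\<Oplus>\<^bsub>ext_tensor N M f\<^esub>i\<in>I. ract (ext_tensor N M f) (b i) (\<beta> i m))
          = ext_pure N M f m \<one>\<^bsub>M\<^esub>)"

definition D2_source ::
  "('n, 'i) ring_scheme \<Rightarrow> ('m, 'j) ring_scheme \<Rightarrow> ('n \<Rightarrow> 'm) \<Rightarrow> 'm \<Rightarrow> (('m \<times> 'm) \<Rightarrow>\<^sub>0 int) set"
  where "D2_source N M f r = ext_pure N M f \<one>\<^bsub>M\<^esub> r"

definition D2_target ::
  "('n, 'i) ring_scheme \<Rightarrow> ('m, 'j) ring_scheme \<Rightarrow> ('n \<Rightarrow> 'm) \<Rightarrow> 'm \<Rightarrow> (('m \<times> 'm) \<Rightarrow>\<^sub>0 int) set"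
  where "D2_target N M f r = ext_pure N M f r \<one>\<^bsub>M\<^esub>"

definition D2_comult ::
  "('n, 'i) ring_scheme \<Rightarrow> ('m, 'j) ring_scheme \<Rightarrow> ('n \<Rightarrow> 'm) \<Rightarrow> 'k set
    \<Rightarrow> ('k \<Rightarrow> (('m \<times> 'm) \<Rightarrow>\<^sub>0 int) set) \<Rightarrow> ('k \<Rightarrow> 'm \<Rightarrow> 'm)
    \<Rightarrow> (('m \<times> 'm) \<Rightarrow>\<^sub>0 int) set
    \<Rightarrow> (((('m \<times> 'm) \<Rightarrow>\<^sub>0 int) set \<times> (('m \<times> 'm) \<Rightarrow>\<^sub>0 int) set) \<Rightarrow>\<^sub>0 int) set"
  where "D2_comult N M f I b \<beta> c =
    (let R = centralizer_ring N M f; B = tensor_ring N M f; s = D2_source N M f; t = D2_target N M f in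
      \<Oplus>\<^bsub>bialgebroid_square R B s t\<^esub>i\<in>I. bialgebroid_tensor R B s t (b i)
        (tensor_lift (ext_tensor N M f) (\<lambda>x y. ext_pure N M f (\<beta> i x) y) c))"

definition D2_counit :: "('m, 'j) ring_scheme \<Rightarrow> (('m \<times> 'm) \<Rightarrow>\<^sub>0 int) set \<Rightarrow> 'm"
  where "D2_counit M = tensor_lift M (\<lambda>x y. x \<otimes>\<^bsub>M\<^esub> y)"

text \<open>Endomorphisms of the left \<open>N\<close>-module \<open>M\<close>, normalised to be \<^const>\<open>extensional\<close> on the carrier so
  that equality of endomorphisms is equality of functions.\<close>

definition left_End ::
  "('n, 'i) ring_scheme \<Rightarrow> ('m, 'j) ring_scheme \<Rightarrow> ('n \<Rightarrow> 'm) \<Rightarrow> ('m \<Rightarrow> 'm) ring"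
  where "left_End N M f =
    \<lparr>carrier = {\<xi> \<in> carrier M \<rightarrow>\<^sub>E carrier M.
        (\<forall>x\<in>carrier M. \<forall>y\<in>carrier M. \<xi> (x \<oplus>\<^bsub>M\<^esub> y) = \<xi> x \<oplus>\<^bsub>M\<^esub> \<xi> y)
        \<and> (\<forall>n\<in>carrier N. \<forall>x\<in>carrier M. \<xi> (f n \<otimes>\<^bsub>M\<^esub> x) = f n \<otimes>\<^bsub>M\<^esub> \<xi> x)},
     mult = (\<lambda>\<xi> \<eta>. compose (carrier M) \<xi> \<eta>), one = (\<lambda>x\<in>carrier M. x),
     zero = (\<lambda>x\<in>carrier M. \<zero>\<^bsub>M\<^esub>), add = (\<lambda>\<xi> \<eta>. \<lambda>x\<in>carrier M. \<xi> x \<oplus>\<^bsub>M\<^esub> \<eta> x)\<rparr>"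

definition End_action ::
  "('m, 'j) ring_scheme \<Rightarrow> ('m \<Rightarrow> 'm) \<Rightarrow> (('m \<times> 'm) \<Rightarrow>\<^sub>0 int) set \<Rightarrow> 'm \<Rightarrow> 'm"
  where "End_action M \<xi> b = (\<lambda>m\<in>carrier M. tensor_lift M (\<lambda>x y. x \<otimes>\<^bsub>M\<^esub> \<xi> (y \<otimes>\<^bsub>M\<^esub> m)) b)"

definition left_mult :: "('m, 'j) ring_scheme \<Rightarrow> 'm \<Rightarrow> 'm \<Rightarrow> 'm"
  where "left_mult M m = (\<lambda>x\<in>carrier M. m \<otimes>\<^bsub>M\<^esub> x)"

definition right_mult :: "('m, 'j) ring_scheme \<Rightarrow> 'm \<Rightarrow> 'm \<Rightarrow> 'm"
  where "right_mult M m = (\<lambda>x\<in>carrier M. x \<otimes>\<^bsub>M\<^esub> m)"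

definition End_invariants ::
  "('n, 'i) ring_scheme \<Rightarrow> ('m, 'j) ring_scheme \<Rightarrow> ('n \<Rightarrow> 'm) \<Rightarrow> ('m \<Rightarrow> 'm) set"
  where "End_invariants N M f = {\<xi> \<in> carrier (left_End N M f). \<forall>b\<in>carrier (tensor_ring N M f).
    End_action M \<xi> b = compose (carrier M) (left_mult M (D2_counit M b)) \<xi>}"

end

theory Submission
  imports Defs
begin

text \<open>For a right \<open>N\<close>-linear additive map \<open>\<phi>\<close> of \<open>M\<close>, put \<open>\<mu>\<^sub>\<phi>(x \<otimes> y) = \<phi>(x) y\<close> and
  \<open>\<phi>\<^sub>*(x \<otimes> y) = \<phi>(x) \<otimes> y\<close>. The quasibasis identity yields \<open>\<Sum> b\<^sub>i \<mu>\<^sub>\<beta>\<^sub>i(a) = a\<close> for \<open>a \<in> M \<otimes> M\<close> and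
  \<open>\<Sum> \<mu>\<^sub>\<phi>(b\<^sub>i) \<beta>\<^sub>i(x) = \<phi>(x)\<close>. By the first of these, any \<open>U\<close> in \<open>B \<otimes>\<^sub>R B\<close> can be recovered from its images
  under the maps \<open>a \<otimes> a' \<mapsto> \<mu>\<^sub>\<phi>(a) a'\<close> to \<open>M \<otimes>\<^sub>N M\<close>; by the second, these maps send \<open>\<Delta>(c)\<close> to
  \<open>\<phi>\<^sub>*(c)\<close>. All axioms on \<open>\<Delta>\<close> thereby become identities in \<open>M \<otimes>\<^sub>N M\<close>. Right depth two is needed only
  for the invariants: \<open>B\<close> generates \<open>M \<otimes>\<^sub>N M\<close> as a left \<open>M\<close>-module, and for invariant \<open>\<xi>\<close> the left
  \<open>M\<close>-linear maps \<open>x \<otimes> y \<mapsto> x \<xi>(y)\<close> and \<open>x \<otimes> y \<mapsto> x y \<xi>(1)\<close> agree on \<open>B\<close>; at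
  \<open>1 \<otimes> m\<close> this says \<open>\<xi>(m) = m \<xi>(1)\<close>.\<close>

section \<open>Tensor products\<close>

text \<open>The recurring obstacle is that an element of B is a sum of pure tensors that need not
  commute with N themselves, and an element of the Takeuchi ring is likewise a sum of pure tensors
  that may lie outside it. Each operation is therefore defined with its varying argument in the
  whole tensor product (\<open>bimod_end\<close>, \<open>contract\<close>,
  \<open>apply_left\<close>, \<open>act_at\<close> on M \<otimes> M, the left factor in
  \<open>takeuchi_mult\<close>), where identities can be checked on pure tensors; only the fixed
  argument carries the commutation or Takeuchi condition, because that is what makes the lift well
  defined.\<close>

lemma additive_zero:
  assumes "abelian_group A" "abelian_group A'"
    and "\<And>x. x \<in> carrier A \<Longrightarrow> h x \<in> carrier A'"
    and "\<And>x y. \<lbrakk>x \<in> carrier A; y \<in> carrier A\<rbrakk> \<Longrightarrow> h (x \<oplus>\<^bsub>A\<^esub> y) = h x \<oplus>\<^bsub>A'\<^esub> h y"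
  shows "h \<zero>\<^bsub>A\<^esub> = \<zero>\<^bsub>A'\<^esub>"
proof -
  interpret A: abelian_group A by fact
  interpret A': abelian_group A' by fact
  have "h \<zero>\<^bsub>A\<^esub> \<oplus>\<^bsub>A'\<^esub> h \<zero>\<^bsub>A\<^esub> = h \<zero>\<^bsub>A\<^esub>" using assms(4)[of "\<zero>\<^bsub>A\<^esub>" "\<zero>\<^bsub>A\<^esub>"] by simp
  then show ?thesis using assms(3)[of "\<zero>\<^bsub>A\<^esub>"] A'.add.l_cancel_one' by fastforce
qed

lemma additive_finsum:
  assumes A: "abelian_group A" and A': "abelian_group A'"
    and closed: "\<And>x. x \<in> carrier A \<Longrightarrow> h x \<in> carrier A'"
    and add: "\<And>x y. \<lbrakk>x \<in> carrier A; y \<in> carrier A\<rbrakk> \<Longrightarrow> h (x \<oplus>\<^bsub>A\<^esub> y) = h x \<oplus>\<^bsub>A'\<^esub> h y"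
    and g: "\<And>i. i \<in> J \<Longrightarrow> g i \<in> carrier A"
  shows "h (\<Oplus>\<^bsub>A\<^esub>i\<in>J. g i) = (\<Oplus>\<^bsub>A'\<^esub>i\<in>J. h (g i))"
proof -
  interpret A: abelian_group A by fact
  interpret A': abelian_group A' by fact
  note zero = additive_zero[OF A A' closed add]
  \<comment> \<open>Over an infinite \<open>J\<close> both sums have the default value zero, so that
    case is \<open>additive_zero\<close>.\<close>
  show ?thesis
    using g
  proof (induction J rule: infinite_finite_induct)
    case (insert i J)
    then show ?case by (simp add: A.finsum_insert A'.finsum_insert closed add Pi_iff A.finsum_closed)
  qed (simp_all add: zero)
qed

lemma (in abelian_group) finsum_swap:
  assumes "finite J" and "\<And>i j. \<lbrakk>i \<in> J; j \<in> K\<rbrakk> \<Longrightarrow> g i j \<in> carrier G"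
  shows "(\<Oplus>i\<in>J. \<Oplus>j\<in>K. g i j) = (\<Oplus>j\<in>K. \<Oplus>i\<in>J. g i j)"
  using assms
proof (induction J)
  case (insert i J)
  then have "(\<Oplus>j\<in>K. \<Oplus>i\<in>insert i J. g i j) = (\<Oplus>j\<in>K. g i j \<oplus> (\<Oplus>i\<in>J. g i j))"
    by (intro finsum_cong') (auto simp: Pi_iff)
  then show ?case using insert by (simp add: Pi_iff finsum_addf)
qed simp

lemma subbimoduleD:
  assumes "subbimodule L R P X" "abelian_group X"
  shows "P \<subseteq> carrier X" "\<zero>\<^bsub>X\<^esub> \<in> P" "\<lbrakk>x \<in> P; y \<in> P\<rbrakk> \<Longrightarrow> x \<oplus>\<^bsub>X\<^esub> y \<in> P" "x \<in> P \<Longrightarrow> \<ominus>\<^bsub>X\<^esub> x \<in> P"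
    "\<lbrakk>l \<in> carrier L; x \<in> P\<rbrakk> \<Longrightarrow> lact X l x \<in> P" "\<lbrakk>r \<in> carrier R; x \<in> P\<rbrakk> \<Longrightarrow> ract X x r \<in> P"
proof -
  interpret S: subgroup P "add_monoid X"
    using assms(1) by (simp add: subbimodule_def)
  show "P \<subseteq> carrier X" "\<zero>\<^bsub>X\<^esub> \<in> P" "\<lbrakk>x \<in> P; y \<in> P\<rbrakk> \<Longrightarrow> x \<oplus>\<^bsub>X\<^esub> y \<in> P" "x \<in> P \<Longrightarrow> \<ominus>\<^bsub>X\<^esub> x \<in> P"
    using S.subset S.one_closed S.m_closed S.m_inv_closed by (simp_all add: a_inv_def)
qed (use assms(1) in \<open>auto simp: subbimodule_def\<close>)

text \<open>\<open>tensor\<close> defines its two actions by lifting into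
  \<open>tensor_group\<close>, a record without actions; this turns such lifts into lifts into the
  bimodule itself.\<close>

lemma tensor_lift_cong_group:
  assumes "carrier A = carrier A'" "\<zero>\<^bsub>A\<^esub> = \<zero>\<^bsub>A'\<^esub>" "add A = add A'"
  shows "tensor_lift A = tensor_lift A'"
proof -
  have pow: "add_pow A k x = add_pow A' k x" for k :: int and x
    unfolding add_pow_def int_pow_def nat_pow_def Let_def m_inv_def by (simp add: assms)
  show ?thesis
    by (simp add: tensor_lift_def fun_eq_iff Let_def finsum_def finprod_def pow assms)
qed

lemma balanced_mapI:
  assumes "\<And>x y. \<lbrakk>x \<in> carrier X; y \<in> carrier Y\<rbrakk> \<Longrightarrow> \<phi> x y \<in> carrier A"
    and "\<And>x x' y. \<lbrakk>x \<in> carrier X; x' \<in> carrier X; y \<in> carrier Y\<rbrakk> \<Longrightarrow> \<phi> (x \<oplus>\<^bsub>X\<^esub> x') y = \<phi> x y \<oplus>\<^bsub>A\<^esub> \<phi> x' y"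
    and "\<And>x y y'. \<lbrakk>x \<in> carrier X; y \<in> carrier Y; y' \<in> carrier Y\<rbrakk> \<Longrightarrow> \<phi> x (y \<oplus>\<^bsub>Y\<^esub> y') = \<phi> x y \<oplus>\<^bsub>A\<^esub> \<phi> x y'"
    and "\<And>x r y. \<lbrakk>x \<in> carrier X; r \<in> carrier R; y \<in> carrier Y\<rbrakk> \<Longrightarrow> \<phi> (ract X x r) y = \<phi> x (lact Y r y)"
  shows "balanced_map R X Y A \<phi>"
  using assms by (simp add: balanced_map_def)

section \<open>The bimodule structure on a tensor product\<close>

locale tensor_product = X: bimodule L R X + Y: bimodule R S Y
  for L :: "('l, 'i) ring_scheme" and R :: "('r, 'j) ring_scheme" and S :: "('s, 'k) ring_scheme"
    and X :: "('l, 'r, 'a, 'm) bimodule_scheme" and Y :: "('r, 's, 'b, 'n) bimodule_scheme"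
begin

abbreviation "F \<equiv> free_Abelian_group (carrier X \<times> carrier Y)"
abbreviation "K \<equiv> tensor_kernel R X Y"
abbreviation "T \<equiv> tensor R X Y"
abbreviation pt (infixl \<open>\<boxtimes>\<close> 72) where "x \<boxtimes> y \<equiv> pure_tensor R X Y x y"

interpretation F: comm_group F by (rule abelian_free_Abelian_group)

lemma kernel_normal: "normal K F"
  unfolding tensor_kernel_def
  by (intro F.subgroup_imp_normal F.generate_is_subgroup
      tensor_relations_subset[OF X.bimodule_axioms Y.bimodule_axioms])

interpretation K: normal K F by (rule kernel_normal)

lemma tensor_simps:
  "carrier T = carrier (F Mod K)" "zero T = \<one>\<^bsub>F Mod K\<^esub>" "add T = mult (F Mod K)"
  by (simp_all add: tensor_def tensor_group_def Let_def ring.defs bimodule.defs)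

lemma abelian_group_tensor: "abelian_group T"
proof -
  interpret Q: comm_group "F Mod K"
    by (rule F.abelian_FactGroup) (rule K.subgroup_axioms)
  show ?thesis
    by (rule abelian_groupI; simp only: tensor_simps)
      (assumption | rule Q.m_closed Q.one_closed Q.m_assoc Q.m_comm Q.l_one bexI Q.l_inv Q.inv_closed)+
qed

lemma tensor_lift_tensor_group: "tensor_lift (tensor_group R X Y) = tensor_lift T"
  by (rule tensor_lift_cong_group)
    (simp_all add: tensor_def tensor_group_def Let_def ring.defs bimodule.defs)

sublocale T: abelian_group T by (rule abelian_group_tensor)

lemma coset_add:
  assumes "c \<in> carrier F" "d \<in> carrier F"
  shows "(K #>\<^bsub>F\<^esub> c) \<oplus>\<^bsub>T\<^esub> (K #>\<^bsub>F\<^esub> d) = K #>\<^bsub>F\<^esub> (c + d)"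
  using K.rcos_sum[OF assms] by (simp add: tensor_simps FactGroup_def)

lemma pure_closed: "\<lbrakk>x \<in> carrier X; y \<in> carrier Y\<rbrakk> \<Longrightarrow> x \<boxtimes> y \<in> carrier T"
  by (auto simp: tensor_simps pure_tensor_def FactGroup_def RCOSETS_def)

lemma coset_eqI:
  assumes "c \<in> carrier F" "d \<in> carrier F" "c - d \<in> K"
  shows "K #>\<^bsub>F\<^esub> c = K #>\<^bsub>F\<^esub> d"
proof -
  have "c \<otimes>\<^bsub>F\<^esub> inv\<^bsub>F\<^esub> d \<in> K" using assms by simp
  then show ?thesis
    using assms(1,2) F.repr_independence K.subgroup_axioms K.rcos_module_rev F.is_group by metis
qed

lemma relation_in_kernel: "u \<in> tensor_relations R X Y \<Longrightarrow> u \<in> K"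
  unfolding tensor_kernel_def by (rule generate.incl)

lemma pure_add_left:
  assumes "x \<in> carrier X" "x' \<in> carrier X" "y \<in> carrier Y"
  shows "(x \<oplus>\<^bsub>X\<^esub> x') \<boxtimes> y = x \<boxtimes> y \<oplus>\<^bsub>T\<^esub> x' \<boxtimes> y"
proof -
  have "frag_of (x \<oplus>\<^bsub>X\<^esub> x', y) - (frag_of (x, y) + frag_of (x', y)) \<in> K"
    by (rule relation_in_kernel) (use assms in \<open>force simp: tensor_relations_def algebra_simps\<close>)
  moreover have "frag_of (x, y) + frag_of (x', y) \<in> carrier F"
    using F.m_closed[of "frag_of (x, y)" "frag_of (x', y)"] assms by simp
  ultimately show ?thesis
    unfolding pure_tensor_def using assms by (subst coset_add) (simp_all add: coset_eqI)
qed

lemma pure_add_right: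
  assumes "x \<in> carrier X" "y \<in> carrier Y" "y' \<in> carrier Y"
  shows "x \<boxtimes> (y \<oplus>\<^bsub>Y\<^esub> y') = x \<boxtimes> y \<oplus>\<^bsub>T\<^esub> x \<boxtimes> y'"
proof -
  have "frag_of (x, y \<oplus>\<^bsub>Y\<^esub> y') - (frag_of (x, y) + frag_of (x, y')) \<in> K"
    by (rule relation_in_kernel) (use assms in \<open>force simp: tensor_relations_def algebra_simps\<close>)
  moreover have "frag_of (x, y) + frag_of (x, y') \<in> carrier F"
    using F.m_closed[of "frag_of (x, y)" "frag_of (x, y')"] assms by simp
  ultimately show ?thesis
    unfolding pure_tensor_def using assms by (subst coset_add) (simp_all add: coset_eqI)
qed

lemma pure_balanced:
  assumes "x \<in> carrier X" "r \<in> carrier R" "y \<in> carrier Y"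
  shows "ract X x r \<boxtimes> y = x \<boxtimes> lact Y r y"
  unfolding pure_tensor_def
  by (rule coset_eqI, use assms X.ract_closed Y.lact_closed in simp_all)
    (rule relation_in_kernel, use assms in \<open>force simp: tensor_relations_def\<close>)

lemma pure_uminus_left:
  assumes "x \<in> carrier X" "y \<in> carrier Y"
  shows "(\<ominus>\<^bsub>X\<^esub> x) \<boxtimes> y = \<ominus>\<^bsub>T\<^esub> (x \<boxtimes> y)"
proof -
  have z: "\<zero>\<^bsub>X\<^esub> \<boxtimes> y = \<zero>\<^bsub>T\<^esub>"
    by (rule additive_zero[where A=X and h="\<lambda>x. x \<boxtimes> y"])
      (simp_all add: X.X.abelian_group_axioms abelian_group_tensor pure_closed pure_add_left assms)
  have "(\<ominus>\<^bsub>X\<^esub> x) \<boxtimes> y \<oplus>\<^bsub>T\<^esub> x \<boxtimes> y = \<zero>\<^bsub>T\<^esub>"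
    using pure_add_left[of "\<ominus>\<^bsub>X\<^esub> x" x y] assms z by (simp add: X.X.l_neg)
  then show ?thesis using T.minus_equality pure_closed assms by simp
qed

text \<open>Zero and negatives have no case of their own: \<open>pure_uminus_left\<close> absorbs a
  sign into the left factor, so sums of pure tensors already exhaust the group.\<close>

lemma tensor_induct [consumes 1, case_names pure add]:
  assumes "u \<in> carrier T"
    and pure: "\<And>x y. \<lbrakk>x \<in> carrier X; y \<in> carrier Y\<rbrakk> \<Longrightarrow> P (x \<boxtimes> y)"
    and add: "\<And>u v. \<lbrakk>u \<in> carrier T; v \<in> carrier T; P u; P v\<rbrakk> \<Longrightarrow> P (u \<oplus>\<^bsub>T\<^esub> v)"
  shows "P u"
proof -
  have z: "\<zero>\<^bsub>X\<^esub> \<boxtimes> \<zero>\<^bsub>Y\<^esub> = \<zero>\<^bsub>T\<^esub>"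
    by (rule additive_zero[where A=X and h="\<lambda>x. x \<boxtimes> \<zero>\<^bsub>Y\<^esub>"])
      (simp_all add: X.X.abelian_group_axioms abelian_group_tensor pure_closed pure_add_left)
  have c0: "K #>\<^bsub>F\<^esub> 0 = \<zero>\<^bsub>T\<^esub>"
    using F.coset_mult_one[OF K.subset] by (simp add: tensor_simps FactGroup_def)
  have in_T: "K #>\<^bsub>F\<^esub> c \<in> carrier T" if "c \<in> carrier F" for c
    using that by (auto simp: tensor_simps FactGroup_def RCOSETS_def)
  have neg: "-c \<in> carrier F" if "c \<in> carrier F" for c
    using that by simp
  have cneg: "K #>\<^bsub>F\<^esub> (-c) = \<ominus>\<^bsub>T\<^esub> (K #>\<^bsub>F\<^esub> c)" if "c \<in> carrier F" for c
    using coset_add[OF neg[OF that] that] c0 T.minus_equality in_T that neg[OF that] by simp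
  \<comment> \<open>\<open>frag_induction\<close> builds elements by differences. Carrying the claim
    for \<open>-c\<close> along turns a - b into the sum of a and -b, for which the additive case is
    available.\<close>
  have "c \<in> carrier F \<and> P (K #>\<^bsub>F\<^esub> c) \<and> P (K #>\<^bsub>F\<^esub> (-c))" if "Poly_Mapping.keys c \<subseteq> carrier X \<times> carrier Y" for c
    using that
  proof (induction c rule: frag_induction)
    case zero
    show ?case using pure[of "\<zero>\<^bsub>X\<^esub>" "\<zero>\<^bsub>Y\<^esub>"] z c0 by simp
  next
    case (one p)
    obtain x y where p: "p = (x, y)" by force
    have "K #>\<^bsub>F\<^esub> (- frag_of p) = (\<ominus>\<^bsub>X\<^esub> x) \<boxtimes> y"
      using pure_uminus_left[of x y] one cneg[of "frag_of p"] by (simp add: p pure_tensor_def)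
    then show ?case using pure[of x y] pure[of "\<ominus>\<^bsub>X\<^esub> x" y] one by (simp add: p pure_tensor_def)
  next
    case (diff a b)
    then have ab: "a \<in> carrier F" "b \<in> carrier F" by auto
    have d: "a - b \<in> carrier F" using ab keys_diff_subset[of a _ b] by simp
    have "P (K #>\<^bsub>F\<^esub> (a + -b))"
      using add[of "K #>\<^bsub>F\<^esub> a" "K #>\<^bsub>F\<^esub> (-b)"] ab diff coset_add[OF ab(1) neg[OF ab(2)]] in_T neg by simp
    moreover have "P (K #>\<^bsub>F\<^esub> (-a + b))"
      using add[of "K #>\<^bsub>F\<^esub> (-a)" "K #>\<^bsub>F\<^esub> b"] ab diff coset_add[OF neg[OF ab(1)] ab(2)] in_T neg by simp
    ultimately show ?case using d by simp
  qed
  moreover obtain c where "c \<in> carrier F" "u = K #>\<^bsub>F\<^esub> c"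
    using assms(1) by (auto simp: tensor_simps FactGroup_def RCOSETS_def simp del: carrier_free_Abelian_group_iff)
  ultimately show ?thesis by simp
qed

lemmas lift_pure = tensor_lift_pure[OF X.bimodule_axioms Y.bimodule_axioms]
lemmas lift_add = tensor_lift_add[OF X.bimodule_axioms Y.bimodule_axioms]

lemma lift_closed:
  assumes "abelian_group A" "balanced_map R X Y A \<phi>" "u \<in> carrier T"
  shows "tensor_lift A \<phi> u \<in> carrier A"
proof -
  interpret A: abelian_group A by fact
  show ?thesis
    using assms(3)
  proof (induction u rule: tensor_induct)
    case (pure x y)
    then show ?case using lift_pure[OF assms(1,2)] assms(2) by (simp add: balanced_map_def)
  next
    case (add u v)
    then show ?case using lift_add[OF assms(1,2)] by simp
  qed
qed

text \<open>Serves when the lifted function is itself a lift, whose value is known only on carriers,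
  as in the product of B.\<close>

lemma lift_cong:
  assumes "abelian_group A" "balanced_map R X Y A \<phi>" "u \<in> carrier T"
    and "\<And>x y. \<lbrakk>x \<in> carrier X; y \<in> carrier Y\<rbrakk> \<Longrightarrow> \<psi> x y = \<phi> x y"
  shows "tensor_lift A \<psi> u = tensor_lift A \<phi> u"
proof -
  have \<psi>: "balanced_map R X Y A \<psi>"
    using assms(2,4) by (auto simp: balanced_map_def X.ract_closed Y.lact_closed)
  show ?thesis
    using assms(3) by (induction u rule: tensor_induct)
      (simp_all add: lift_pure[OF assms(1)] lift_add[OF assms(1)] \<psi> assms(2,4))
qed

lemma lift_finsum:
  assumes "abelian_group A" "balanced_map R X Y A \<phi>" "\<And>i. i \<in> J \<Longrightarrow> g i \<in> carrier T"
  shows "tensor_lift A \<phi> (\<Oplus>\<^bsub>T\<^esub>i\<in>J. g i) = (\<Oplus>\<^bsub>A\<^esub>i\<in>J. tensor_lift A \<phi> (g i))"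
  by (rule additive_finsum) (use assms lift_add lift_closed abelian_group_tensor in auto)

lemma balanced_lact: "l \<in> carrier L \<Longrightarrow> balanced_map R X Y T (\<lambda>x y. lact X l x \<boxtimes> y)"
  by (rule balanced_mapI)
    (simp_all add: pure_closed pure_add_left pure_add_right pure_balanced[symmetric]
      X.lact_closed X.lact_add X.lact_ract)

lemma balanced_ract: "s \<in> carrier S \<Longrightarrow> balanced_map R X Y T (\<lambda>x y. x \<boxtimes> ract Y y s)"
  by (rule balanced_mapI)
    (simp_all add: pure_closed pure_add_left pure_add_right pure_balanced
      Y.ract_closed Y.ract_add Y.lact_ract Y.lact_closed)

lemma lact_tensor: "lact T l = tensor_lift T (\<lambda>x y. lact X l x \<boxtimes> y)"
  and ract_tensor: "ract T u s = tensor_lift T (\<lambda>x y. x \<boxtimes> ract Y y s) u"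
proof -
  have "lact T l = tensor_lift (tensor_group R X Y) (\<lambda>x y. lact X l x \<boxtimes> y)"
    "ract T u s = tensor_lift (tensor_group R X Y) (\<lambda>x y. x \<boxtimes> ract Y y s) u"
    by (simp_all add: tensor_def tensor_group_def Let_def ring.defs bimodule.defs)
  then show "lact T l = tensor_lift T (\<lambda>x y. lact X l x \<boxtimes> y)"
    "ract T u s = tensor_lift T (\<lambda>x y. x \<boxtimes> ract Y y s) u"
    by (simp_all only: tensor_lift_tensor_group)
qed

lemma lact_pure: "\<lbrakk>l \<in> carrier L; x \<in> carrier X; y \<in> carrier Y\<rbrakk> \<Longrightarrow> lact T l (x \<boxtimes> y) = lact X l x \<boxtimes> y"
  by (simp add: lact_tensor lift_pure abelian_group_tensor balanced_lact)

lemma ract_pure: "\<lbrakk>s \<in> carrier S; x \<in> carrier X; y \<in> carrier Y\<rbrakk> \<Longrightarrow> ract T (x \<boxtimes> y) s = x \<boxtimes> ract Y y s"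
  by (simp add: ract_tensor lift_pure abelian_group_tensor balanced_ract)

lemma bimodule_tensor: "bimodule L S T"
proof -
  have lc: "\<lbrakk>l \<in> carrier L; u \<in> carrier T\<rbrakk> \<Longrightarrow> lact T l u \<in> carrier T" for l u
    by (simp add: lact_tensor lift_closed abelian_group_tensor balanced_lact)
  have rc: "\<lbrakk>s \<in> carrier S; u \<in> carrier T\<rbrakk> \<Longrightarrow> ract T u s \<in> carrier T" for s u
    by (simp add: ract_tensor lift_closed abelian_group_tensor balanced_ract)
  have la: "\<lbrakk>l \<in> carrier L; u \<in> carrier T; v \<in> carrier T\<rbrakk>
      \<Longrightarrow> lact T l (u \<oplus>\<^bsub>T\<^esub> v) = lact T l u \<oplus>\<^bsub>T\<^esub> lact T l v" for l u v
    by (simp add: lact_tensor lift_add abelian_group_tensor balanced_lact)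
  have ra: "\<lbrakk>s \<in> carrier S; u \<in> carrier T; v \<in> carrier T\<rbrakk>
      \<Longrightarrow> ract T (u \<oplus>\<^bsub>T\<^esub> v) s = ract T u s \<oplus>\<^bsub>T\<^esub> ract T v s" for s u v
    by (simp add: ract_tensor lift_add abelian_group_tensor balanced_ract)
  note simps = lc rc la ra lact_pure ract_pure X.lact_closed Y.ract_closed pure_closed
  show ?thesis
  proof
    fix l l' u assume *: "l \<in> carrier L" "l' \<in> carrier L" "u \<in> carrier T"
    show "lact T (l \<oplus>\<^bsub>L\<^esub> l') u = lact T l u \<oplus>\<^bsub>T\<^esub> lact T l' u"
      using *(3) by (induction u rule: tensor_induct)
        (use * in \<open>simp_all add: simps X.add_lact pure_add_left T.add.m_ac\<close>)
    show "lact T (l \<otimes>\<^bsub>L\<^esub> l') u = lact T l (lact T l' u)"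
      using *(3) by (induction u rule: tensor_induct) (use * in \<open>simp_all add: simps X.mult_lact\<close>)
  next
    fix s s' u assume *: "s \<in> carrier S" "s' \<in> carrier S" "u \<in> carrier T"
    show "ract T u (s \<oplus>\<^bsub>S\<^esub> s') = ract T u s \<oplus>\<^bsub>T\<^esub> ract T u s'"
      using *(3) by (induction u rule: tensor_induct)
        (use * in \<open>simp_all add: simps Y.add_ract pure_add_right T.add.m_ac\<close>)
    show "ract T u (s \<otimes>\<^bsub>S\<^esub> s') = ract T (ract T u s) s'"
      using *(3) by (induction u rule: tensor_induct) (use * in \<open>simp_all add: simps Y.mult_ract\<close>)
  next
    fix u assume *: "u \<in> carrier T"
    show "lact T \<one>\<^bsub>L\<^esub> u = u"
      using * by (induction u rule: tensor_induct) (simp_all add: simps X.one_lact)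
    show "ract T u \<one>\<^bsub>S\<^esub> = u"
      using * by (induction u rule: tensor_induct) (simp_all add: simps Y.one_ract)
  next
    fix l s u assume *: "l \<in> carrier L" "s \<in> carrier S" "u \<in> carrier T"
    show "ract T (lact T l u) s = lact T l (ract T u s)"
      using *(3) by (induction u rule: tensor_induct) (use * in \<open>simp_all add: simps\<close>)
  qed (use lc rc la ra in auto)
qed

end

section \<open>Reassociation of a triple tensor product\<close>

locale tensor_triple =
  XY: tensor_product L R S X Y + YZ: tensor_product R S V Y Z
  for L :: "('l, 'i) ring_scheme" and R :: "('r, 'j) ring_scheme" and S :: "('s, 'k) ring_scheme"
    and V :: "('v, 'o) ring_scheme"
    and X :: "('l, 'r, 'a, 'm) bimodule_scheme" and Y :: "('r, 's, 'b, 'n) bimodule_scheme"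
    and Z :: "('s, 'v, 'c, 'p) bimodule_scheme"
begin

sublocale X_YZ: tensor_product L R V X YZ.T
  using YZ.bimodule_tensor XY.X.bimodule_axioms by (simp add: tensor_product_def)

sublocale XY_Z: tensor_product L S V XY.T Z
  using XY.bimodule_tensor YZ.Y.bimodule_axioms by (simp add: tensor_product_def)

abbreviation assoc_slice where
  "assoc_slice u z \<equiv> tensor_lift X_YZ.T (\<lambda>x y. pure_tensor R X YZ.T x (pure_tensor S Y Z y z)) u"

lemma balanced_assoc_inner:
  assumes "z \<in> carrier Z"
  shows "balanced_map R X Y X_YZ.T (\<lambda>x y. pure_tensor R X YZ.T x (pure_tensor S Y Z y z))"
  by (rule balanced_mapI)
    (use assms in \<open>simp_all add: YZ.pure_closed X_YZ.pure_closed X_YZ.pure_add_left X_YZ.pure_add_right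
      YZ.pure_add_left X_YZ.pure_balanced YZ.lact_pure\<close>)

lemmas slice_simps =
  XY.lift_pure[OF X_YZ.abelian_group_tensor balanced_assoc_inner]
  XY.lift_add[OF X_YZ.abelian_group_tensor balanced_assoc_inner]
  XY.lift_closed[OF X_YZ.abelian_group_tensor balanced_assoc_inner]

text \<open>Balancing over S is checked on pure \<open>u\<close>: there an element of S crosses from
  Y to Z inside the inner pure tensor.\<close>

lemma balanced_assoc: "balanced_map S XY.T Z X_YZ.T assoc_slice"
proof (rule balanced_mapI)
  fix u z z' assume *: "u \<in> carrier XY.T" "z \<in> carrier Z" "z' \<in> carrier Z"
  show "assoc_slice u (z \<oplus>\<^bsub>Z\<^esub> z') = assoc_slice u z \<oplus>\<^bsub>X_YZ.T\<^esub> assoc_slice u z'"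
    using *(1) by (induction u rule: XY.tensor_induct)
      (use *(2,3) in \<open>simp_all add: slice_simps YZ.pure_add_right X_YZ.pure_add_right YZ.pure_closed
        X_YZ.T.add.m_ac\<close>)
next
  fix u s z assume *: "u \<in> carrier XY.T" "s \<in> carrier S" "z \<in> carrier Z"
  show "assoc_slice (ract XY.T u s) z = assoc_slice u (lact Z s z)"
    using *(1) by (induction u rule: XY.tensor_induct)
      (use *(2,3) in \<open>simp_all add: slice_simps YZ.Y.lact_closed XY.ract_pure XY.Y.ract_closed
        YZ.pure_balanced XY_Z.X.ract_add XY_Z.X.ract_closed\<close>)
qed (simp_all add: slice_simps)

lemma tensor_assoc_eq: "tensor_assoc R S X Y Z = tensor_lift X_YZ.T assoc_slice"
  by (simp add: tensor_assoc_def Let_def fun_eq_iff)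

end

section \<open>The Takeuchi product\<close>

text \<open>The data of a bialgebroid before comultiplication and counit. The tensor square and the
  Takeuchi ring are built on it, so that both are available while the properties of \<Delta> are
  being proved.\<close>

locale source_target = R: ring R + B: ring B
  for R :: "('r, 'i) ring_scheme" and B :: "('b, 'j) ring_scheme" +
  fixes s t :: "'r \<Rightarrow> 'b"
  assumes source_hom: "s \<in> ring_hom R B"
    and target_hom: "t \<in> ring_hom (opposite_ring R) B"
    and source_target: "\<lbrakk>r \<in> carrier R; r' \<in> carrier R\<rbrakk> \<Longrightarrow> s r' \<otimes>\<^bsub>B\<^esub> t r = t r \<otimes>\<^bsub>B\<^esub> s r'"
begin

abbreviation "X \<equiv> bialgebroid_bimodule B s t"

lemma source [simp]:
  "r \<in> carrier R \<Longrightarrow> s r \<in> carrier B"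
  "\<lbrakk>r \<in> carrier R; r' \<in> carrier R\<rbrakk> \<Longrightarrow> s (r \<oplus>\<^bsub>R\<^esub> r') = s r \<oplus>\<^bsub>B\<^esub> s r'"
  "\<lbrakk>r \<in> carrier R; r' \<in> carrier R\<rbrakk> \<Longrightarrow> s (r \<otimes>\<^bsub>R\<^esub> r') = s r \<otimes>\<^bsub>B\<^esub> s r'"
  "s \<one>\<^bsub>R\<^esub> = \<one>\<^bsub>B\<^esub>"
  using source_hom by (auto simp: ring_hom_def)

lemma target [simp]:
  "r \<in> carrier R \<Longrightarrow> t r \<in> carrier B"
  "\<lbrakk>r \<in> carrier R; r' \<in> carrier R\<rbrakk> \<Longrightarrow> t (r \<oplus>\<^bsub>R\<^esub> r') = t r \<oplus>\<^bsub>B\<^esub> t r'"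
  "\<lbrakk>r \<in> carrier R; r' \<in> carrier R\<rbrakk> \<Longrightarrow> t (r \<otimes>\<^bsub>R\<^esub> r') = t r' \<otimes>\<^bsub>B\<^esub> t r"
  "t \<one>\<^bsub>R\<^esub> = \<one>\<^bsub>B\<^esub>"
  using target_hom by (auto simp: ring_hom_def opposite_ring_def)

lemma X_simps [simp]:
  "carrier X = carrier B" "\<zero>\<^bsub>X\<^esub> = \<zero>\<^bsub>B\<^esub>" "x \<oplus>\<^bsub>X\<^esub> y = x \<oplus>\<^bsub>B\<^esub> y"
  "lact X r x = x \<otimes>\<^bsub>B\<^esub> t r" "ract X x r = x \<otimes>\<^bsub>B\<^esub> s r"
  by (simp_all add: bialgebroid_bimodule_def)

lemma abelian_group_X: "abelian_group X"
  by (rule abelian_groupI) (auto simp: B.add.m_ac intro: bexI B.l_neg)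

lemma bimodule_X: "bimodule R R X"
proof -
  interpret X: abelian_group X by (rule abelian_group_X)
  show ?thesis
    by standard (simp_all add: B.l_distr B.r_distr B.m_assoc source_target)
qed

sublocale XX: tensor_product R R R X X
  by (simp add: tensor_product_def bimodule_X)

lemma square_simps:
  "bialgebroid_square R B s t = tensor R X X" "bialgebroid_tensor R B s t = pure_tensor R X X"
  by (simp_all add: bialgebroid_square_def bialgebroid_tensor_def)

text \<open>Left multiplication by a \<otimes> a'. It is defined for all a and a' because R acts on
  B by right multiplications, which commute with left ones.\<close>

definition left_mult2 where
  "left_mult2 a a' = tensor_lift XX.T (\<lambda>c c'. pure_tensor R X X (a \<otimes>\<^bsub>B\<^esub> c) (a' \<otimes>\<^bsub>B\<^esub> c'))"

lemma balanced_left_mult2: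
  assumes "a \<in> carrier B" "a' \<in> carrier B"
  shows "balanced_map R X X XX.T (\<lambda>c c'. pure_tensor R X X (a \<otimes>\<^bsub>B\<^esub> c) (a' \<otimes>\<^bsub>B\<^esub> c'))"
  by (rule balanced_mapI)
    (use assms XX.pure_balanced XX.pure_closed XX.pure_add_left XX.pure_add_right
      in \<open>simp_all add: B.r_distr B.m_assoc[symmetric]\<close>)

context
  fixes a a' assumes a [simp]: "a \<in> carrier B" "a' \<in> carrier B"
begin

lemma left_mult2_pure [simp]:
  "\<lbrakk>c \<in> carrier B; c' \<in> carrier B\<rbrakk>
    \<Longrightarrow> left_mult2 a a' (pure_tensor R X X c c') = pure_tensor R X X (a \<otimes>\<^bsub>B\<^esub> c) (a' \<otimes>\<^bsub>B\<^esub> c')"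
  unfolding left_mult2_def by (subst XX.lift_pure) (simp_all add: balanced_left_mult2 XX.abelian_group_tensor)

lemma left_mult2_closed [simp]: "u \<in> carrier XX.T \<Longrightarrow> left_mult2 a a' u \<in> carrier XX.T"
  unfolding left_mult2_def by (rule XX.lift_closed) (simp_all add: balanced_left_mult2 XX.abelian_group_tensor)

lemma left_mult2_add [simp]:
  "\<lbrakk>u \<in> carrier XX.T; v \<in> carrier XX.T\<rbrakk>
    \<Longrightarrow> left_mult2 a a' (u \<oplus>\<^bsub>XX.T\<^esub> v) = left_mult2 a a' u \<oplus>\<^bsub>XX.T\<^esub> left_mult2 a a' v"
  unfolding left_mult2_def by (rule XX.lift_add) (simp_all add: balanced_left_mult2 XX.abelian_group_tensor)

end

lemma pure_closed_B [simp]: "\<lbrakk>x \<in> carrier B; y \<in> carrier B\<rbrakk> \<Longrightarrow> pure_tensor R X X x y \<in> carrier XX.T"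
  using XX.pure_closed by simp

lemma left_mult2_left_mult2:
  assumes "a \<in> carrier B" "a' \<in> carrier B" "c \<in> carrier B" "c' \<in> carrier B" "u \<in> carrier XX.T"
  shows "left_mult2 a a' (left_mult2 c c' u) = left_mult2 (a \<otimes>\<^bsub>B\<^esub> c) (a' \<otimes>\<^bsub>B\<^esub> c') u"
  using assms(5) by (induction u rule: XX.tensor_induct) (use assms(1-4) in \<open>simp_all add: B.m_assoc\<close>)

lemma left_mult2_one: "u \<in> carrier XX.T \<Longrightarrow> left_mult2 \<one>\<^bsub>B\<^esub> \<one>\<^bsub>B\<^esub> u = u"
  by (induction u rule: XX.tensor_induct) simp_all

lemma left_mult2_add_args:
  assumes "u \<in> carrier XX.T" "a \<in> carrier B" "c \<in> carrier B" "a' \<in> carrier B"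
  shows "left_mult2 (a \<oplus>\<^bsub>B\<^esub> c) a' u = left_mult2 a a' u \<oplus>\<^bsub>XX.T\<^esub> left_mult2 c a' u"
    and "left_mult2 a' (a \<oplus>\<^bsub>B\<^esub> c) u = left_mult2 a' a u \<oplus>\<^bsub>XX.T\<^esub> left_mult2 a' c u"
  using assms(1) by (induction u rule: XX.tensor_induct;
    use assms(2-4) XX.pure_add_left XX.pure_add_right in \<open>simp add: B.l_distr XX.T.add.m_ac\<close>)+

abbreviation "TP \<equiv> takeuchi_product R B s t"

text \<open>Inserting a unit into the untouched factor makes both sides of the Takeuchi condition
  instances of \<open>left_mult2\<close>, which is also the inner lift of the product.\<close>

lemma takeuchi_simps:
  "carrier TP = {U \<in> carrier XX.T. \<forall>r\<in>carrier R. left_mult2 (s r) \<one>\<^bsub>B\<^esub> U = left_mult2 \<one>\<^bsub>B\<^esub> (t r) U}"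
  "U \<otimes>\<^bsub>TP\<^esub> V = tensor_lift XX.T (\<lambda>a a'. left_mult2 a a' V) U"
  "\<one>\<^bsub>TP\<^esub> = pure_tensor R X X \<one>\<^bsub>B\<^esub> \<one>\<^bsub>B\<^esub>" "\<zero>\<^bsub>TP\<^esub> = \<zero>\<^bsub>XX.T\<^esub>"
  "add TP = add XX.T"
proof -
  have 1: "tensor_lift XX.T (\<lambda>c c'. pure_tensor R X X (s r \<otimes>\<^bsub>B\<^esub> c) c') U = left_mult2 (s r) \<one>\<^bsub>B\<^esub> U"
    "tensor_lift XX.T (\<lambda>c c'. pure_tensor R X X c (t r \<otimes>\<^bsub>B\<^esub> c')) U = left_mult2 \<one>\<^bsub>B\<^esub> (t r) U"
    if r: "r \<in> carrier R" and U: "U \<in> carrier XX.T" for r U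
  proof -
    have b: "balanced_map R X X XX.T (\<lambda>c c'. pure_tensor R X X (s r \<otimes>\<^bsub>B\<^esub> c) c')"
      "balanced_map R X X XX.T (\<lambda>c c'. pure_tensor R X X c (t r \<otimes>\<^bsub>B\<^esub> c'))"
      by (rule balanced_mapI;
        use r XX.pure_balanced XX.pure_add_left XX.pure_add_right in \<open>simp add: B.r_distr B.m_assoc[symmetric]\<close>)+
    note l = XX.lift_pure[OF XX.abelian_group_tensor] XX.lift_add[OF XX.abelian_group_tensor]
    show "tensor_lift XX.T (\<lambda>c c'. pure_tensor R X X (s r \<otimes>\<^bsub>B\<^esub> c) c') U = left_mult2 (s r) \<one>\<^bsub>B\<^esub> U"
      using U by (induction U rule: XX.tensor_induct) (use r l[OF b(1)] in simp_all)
    show "tensor_lift XX.T (\<lambda>c c'. pure_tensor R X X c (t r \<otimes>\<^bsub>B\<^esub> c')) U = left_mult2 \<one>\<^bsub>B\<^esub> (t r) U"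
      using U by (induction U rule: XX.tensor_induct) (use r l[OF b(2)] in simp_all)
  qed
  show "carrier TP = {U \<in> carrier XX.T. \<forall>r\<in>carrier R. left_mult2 (s r) \<one>\<^bsub>B\<^esub> U = left_mult2 \<one>\<^bsub>B\<^esub> (t r) U}"
    unfolding takeuchi_product_def Let_def by (auto simp: square_simps 1)
qed (simp_all add: takeuchi_product_def Let_def square_simps left_mult2_def)

text \<open>Moving r across the tensor sign amounts to exchanging
  \<open>left_mult2 (s r) \<one>\<close> and \<open>left_mult2 \<one> (t r)\<close> on
  \<open>V\<close>, which is the Takeuchi condition for \<open>V\<close>.\<close>

lemma balanced_takeuchi_mult:
  assumes V: "V \<in> carrier TP"
  shows "balanced_map R X X XX.T (\<lambda>a a'. left_mult2 a a' V)"
proof (rule balanced_mapI)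
  have V': "V \<in> carrier XX.T" using V by (simp add: takeuchi_simps)
  fix x r y assume *: "x \<in> carrier X" "r \<in> carrier R" "y \<in> carrier X"
  have "left_mult2 x y (left_mult2 (s r) \<one>\<^bsub>B\<^esub> V) = left_mult2 x y (left_mult2 \<one>\<^bsub>B\<^esub> (t r) V)"
    using V * by (simp add: takeuchi_simps)
  then show "left_mult2 (ract X x r) y V = left_mult2 x (lact X r y) V"
    using V' * by (simp add: left_mult2_left_mult2)
qed (use V in \<open>simp_all add: takeuchi_simps left_mult2_add_args\<close>)

text \<open>The left factor ranges over the whole tensor square, so that identities of the Takeuchi
  ring can be proved by induction on pure tensors in that factor.\<close>

lemma takeuchi_mult:
  assumes "V \<in> carrier TP"
  shows "\<lbrakk>a \<in> carrier B; a' \<in> carrier B\<rbrakk> \<Longrightarrow> pure_tensor R X X a a' \<otimes>\<^bsub>TP\<^esub> V = left_mult2 a a' V"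
    and "\<lbrakk>U \<in> carrier XX.T; U' \<in> carrier XX.T\<rbrakk>
      \<Longrightarrow> (U \<oplus>\<^bsub>XX.T\<^esub> U') \<otimes>\<^bsub>TP\<^esub> V = U \<otimes>\<^bsub>TP\<^esub> V \<oplus>\<^bsub>XX.T\<^esub> U' \<otimes>\<^bsub>TP\<^esub> V"
    and "U \<in> carrier XX.T \<Longrightarrow> U \<otimes>\<^bsub>TP\<^esub> V \<in> carrier XX.T"
  unfolding takeuchi_simps
  by (simp_all add: XX.lift_pure XX.lift_add XX.lift_closed XX.abelian_group_tensor
      balanced_takeuchi_mult[OF assms])

lemma left_mult2_takeuchi_mult:
  assumes "V \<in> carrier TP" "a \<in> carrier B" "a' \<in> carrier B" "U \<in> carrier XX.T"
  shows "left_mult2 a a' (U \<otimes>\<^bsub>TP\<^esub> V) = left_mult2 a a' U \<otimes>\<^bsub>TP\<^esub> V"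
  using assms(4)
proof (induction U rule: XX.tensor_induct)
  case (pure x y)
  then show ?case using assms(1-3) by (simp add: takeuchi_mult left_mult2_left_mult2 takeuchi_simps(1))
next
  case (add u v)
  then show ?case using assms(1-3) by (simp add: takeuchi_mult)
qed

text \<open>\<open>left_mult2\<close> touches only the left factor of a product, so the Takeuchi
  condition of \<open>U\<close> passes to the product.\<close>

lemma takeuchi_mult_closed:
  assumes "U \<in> carrier TP" "V \<in> carrier TP"
  shows "U \<otimes>\<^bsub>TP\<^esub> V \<in> carrier TP"
proof -
  have U: "U \<in> carrier XX.T" "\<And>r. r \<in> carrier R \<Longrightarrow> left_mult2 (s r) \<one>\<^bsub>B\<^esub> U = left_mult2 \<one>\<^bsub>B\<^esub> (t r) U"
    using assms(1) by (auto simp: takeuchi_simps(1))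
  then show ?thesis
    using assms(2) takeuchi_mult(3)[OF assms(2) U(1)]
    by (auto simp: takeuchi_simps(1)[THEN eqset_imp_iff] left_mult2_takeuchi_mult)
qed

lemma takeuchi_mult_assoc:
  assumes "U \<in> carrier XX.T" "V \<in> carrier TP" "W \<in> carrier TP"
  shows "(U \<otimes>\<^bsub>TP\<^esub> V) \<otimes>\<^bsub>TP\<^esub> W = U \<otimes>\<^bsub>TP\<^esub> (V \<otimes>\<^bsub>TP\<^esub> W)"
  using assms(1)
proof (induction U rule: XX.tensor_induct)
  case (pure x y)
  then show ?case using assms(2,3) takeuchi_mult_closed[OF assms(2,3)]
    by (simp add: takeuchi_mult left_mult2_takeuchi_mult takeuchi_simps(1))
next
  case (add u v)
  then show ?case using assms(2,3) takeuchi_mult_closed[OF assms(2,3)]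
    by (simp add: takeuchi_mult)
qed

lemma takeuchi_mult_add_right:
  assumes "U \<in> carrier XX.T" "V \<in> carrier TP" "W \<in> carrier TP" "V \<oplus>\<^bsub>XX.T\<^esub> W \<in> carrier TP"
  shows "U \<otimes>\<^bsub>TP\<^esub> (V \<oplus>\<^bsub>XX.T\<^esub> W) = U \<otimes>\<^bsub>TP\<^esub> V \<oplus>\<^bsub>XX.T\<^esub> U \<otimes>\<^bsub>TP\<^esub> W"
  using assms(1)
proof (induction U rule: XX.tensor_induct)
  case (pure x y)
  then show ?case using assms(2-4)
    by (simp add: takeuchi_mult takeuchi_simps(1))
next
  case (add u v)
  then show ?case using assms(2-4)
    by (simp add: takeuchi_mult XX.T.add.m_ac)
qed

lemma left_mult2_zero: "\<lbrakk>a \<in> carrier B; a' \<in> carrier B\<rbrakk> \<Longrightarrow> left_mult2 a a' \<zero>\<^bsub>XX.T\<^esub> = \<zero>\<^bsub>XX.T\<^esub>"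
  by (rule additive_zero) (simp_all add: XX.abelian_group_tensor)

lemma left_mult2_uminus:
  assumes "a \<in> carrier B" "a' \<in> carrier B" "u \<in> carrier XX.T"
  shows "left_mult2 a a' (\<ominus>\<^bsub>XX.T\<^esub> u) = \<ominus>\<^bsub>XX.T\<^esub> left_mult2 a a' u"
  using left_mult2_add[OF assms(1,2), of "\<ominus>\<^bsub>XX.T\<^esub> u" u] assms
  by (simp add: XX.T.l_neg left_mult2_zero XX.T.minus_equality)

lemma ring_takeuchi: "ring TP"
proof (rule ringI)
  show "abelian_group TP"
  proof (rule abelian_groupI)
    fix x assume x: "x \<in> carrier TP"
    show "\<exists>y\<in>carrier TP. y \<oplus>\<^bsub>TP\<^esub> x = \<zero>\<^bsub>TP\<^esub>"
      by (rule bexI[of _ "\<ominus>\<^bsub>XX.T\<^esub> x"]) (use x in \<open>simp_all add: takeuchi_simps XX.T.l_neg left_mult2_uminus\<close>)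
  qed (auto simp: takeuchi_simps left_mult2_zero XX.T.add.m_ac)
  \<comment> \<open>For the unit, the Takeuchi condition is the balancing relation s(r) \<otimes> 1
    = 1 \<otimes> t(r).\<close>
  have one: "\<one>\<^bsub>TP\<^esub> \<in> carrier TP"
    using XX.pure_balanced[of "\<one>\<^bsub>B\<^esub>" _ "\<one>\<^bsub>B\<^esub>"] by (simp add: takeuchi_simps(1,3))
  show "monoid TP"
  proof
    fix U assume U: "U \<in> carrier TP"
    then have U': "U \<in> carrier XX.T" by (simp add: takeuchi_simps(1))
    show "\<one>\<^bsub>TP\<^esub> \<otimes>\<^bsub>TP\<^esub> U = U"
      using U U' by (simp add: takeuchi_simps(3) takeuchi_mult left_mult2_one)
    show "U \<otimes>\<^bsub>TP\<^esub> \<one>\<^bsub>TP\<^esub> = U"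
      using U'
    proof (induction U rule: XX.tensor_induct)
      case (pure x y)
      then show ?case using takeuchi_mult(1)[OF one, of x y] by (simp add: takeuchi_simps(3))
    next
      case (add u v)
      then show ?case using takeuchi_mult(2)[OF one, of u v] by simp
    qed
  qed (simp_all add: one takeuchi_mult_closed, simp add: takeuchi_mult_assoc takeuchi_simps(1))
  fix U V W assume *: "U \<in> carrier TP" "V \<in> carrier TP" "W \<in> carrier TP"
  have T: "U \<in> carrier XX.T" "V \<in> carrier XX.T" "W \<in> carrier XX.T"
    using * by (simp_all add: takeuchi_simps(1))
  have UV: "U \<oplus>\<^bsub>XX.T\<^esub> V \<in> carrier TP" using * by (simp add: takeuchi_simps(1))
  show "(U \<oplus>\<^bsub>TP\<^esub> V) \<otimes>\<^bsub>TP\<^esub> W = U \<otimes>\<^bsub>TP\<^esub> W \<oplus>\<^bsub>TP\<^esub> V \<otimes>\<^bsub>TP\<^esub> W"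
    using * T by (simp add: takeuchi_simps(5) takeuchi_mult)
  show "W \<otimes>\<^bsub>TP\<^esub> (U \<oplus>\<^bsub>TP\<^esub> V) = W \<otimes>\<^bsub>TP\<^esub> U \<oplus>\<^bsub>TP\<^esub> W \<otimes>\<^bsub>TP\<^esub> V"
    using * T UV by (simp add: takeuchi_simps(5) takeuchi_mult_add_right)
qed

end

section \<open>Ring extensions\<close>

locale ring_extension = N: ring N + M: ring M
  for N :: "('n, 'i) ring_scheme" and M :: "('m, 'j) ring_scheme" (structure) and f :: "'n \<Rightarrow> 'm" +
  assumes ext_hom: "f \<in> ring_hom N M"
begin

lemma f_closed [simp]: "n \<in> carrier N \<Longrightarrow> f n \<in> carrier M"
  using ext_hom by (auto simp: ring_hom_def)

lemma f_hom:
  "\<lbrakk>n \<in> carrier N; n' \<in> carrier N\<rbrakk> \<Longrightarrow> f (n \<oplus>\<^bsub>N\<^esub> n') = f n \<oplus> f n'"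
  "\<lbrakk>n \<in> carrier N; n' \<in> carrier N\<rbrakk> \<Longrightarrow> f (n \<otimes>\<^bsub>N\<^esub> n') = f n \<otimes> f n'"
  "f \<one>\<^bsub>N\<^esub> = \<one>"
  using ext_hom by (auto simp: ring_hom_def)

abbreviation "M_N \<equiv> restrict_scalars (\<lambda>x. x) f (regular_bimodule M)"
abbreviation "N_M \<equiv> restrict_scalars f (\<lambda>x. x) (regular_bimodule M)"
abbreviation "T \<equiv> ext_tensor N M f"
abbreviation pt (infixl \<open>\<boxdot>\<close> 72) where "x \<boxdot> y \<equiv> ext_pure N M f x y"
abbreviation lT (infixr \<open>\<cdot>\<^sub>l\<close> 71) where "x \<cdot>\<^sub>l u \<equiv> lact T x u"
abbreviation rT (infixl \<open>\<cdot>\<^sub>r\<close> 71) where "u \<cdot>\<^sub>r x \<equiv> ract T u x"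

lemma restrict_regular_simps [simp]:
  "carrier (restrict_scalars g h (regular_bimodule M)) = carrier M"
  "\<zero>\<^bsub>restrict_scalars g h (regular_bimodule M)\<^esub> = \<zero>"
  "x \<oplus>\<^bsub>restrict_scalars g h (regular_bimodule M)\<^esub> y = x \<oplus> y"
  "lact (restrict_scalars g h (regular_bimodule M)) l x = g l \<otimes> x"
  "ract (restrict_scalars g h (regular_bimodule M)) x r = x \<otimes> h r"
  by (simp_all add: restrict_scalars_def regular_bimodule_def)

lemma abelian_group_restrict_regular: "abelian_group (restrict_scalars g h (regular_bimodule M))"
  by (rule abelian_groupI) (auto simp: M.add.m_ac intro: bexI M.l_neg)

lemma bimodule_M_N: "bimodule M N M_N"
proof -
  interpret X: abelian_group M_N by (rule abelian_group_restrict_regular)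
  show ?thesis by standard (simp_all add: f_hom M.l_distr M.r_distr M.m_assoc)
qed

lemma bimodule_N_M: "bimodule N M N_M"
proof -
  interpret X: abelian_group N_M by (rule abelian_group_restrict_regular)
  show ?thesis by standard (simp_all add: f_hom M.l_distr M.r_distr M.m_assoc)
qed

sublocale TT: tensor_product M N M M_N N_M
  by (simp add: tensor_product_def bimodule_M_N bimodule_N_M)

sublocale T: bimodule M M T
  using TT.bimodule_tensor by (simp add: ext_tensor_def)

lemmas pt_closed [simp] = TT.pure_closed[folded ext_tensor_def ext_pure_def, simplified]
lemmas pt_add_left = TT.pure_add_left[folded ext_tensor_def ext_pure_def, simplified]
lemmas pt_add_right = TT.pure_add_right[folded ext_tensor_def ext_pure_def, simplified]
lemmas pt_balanced = TT.pure_balanced[folded ext_tensor_def ext_pure_def, simplified]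
lemmas ext_tensor_induct [consumes 1, case_names pure add] =
  TT.tensor_induct[folded ext_tensor_def ext_pure_def, simplified]
lemmas lact_pt [simp] = TT.lact_pure[folded ext_tensor_def ext_pure_def, simplified]
lemmas ract_pt [simp] = TT.ract_pure[folded ext_tensor_def ext_pure_def, simplified]

abbreviation "bal \<equiv> balanced_map N M_N N_M"

lemmas ext_lift_pure = TT.lift_pure[folded ext_tensor_def ext_pure_def, simplified]
lemmas ext_lift_add = TT.lift_add[folded ext_tensor_def ext_pure_def, simplified]
lemmas ext_lift_closed = TT.lift_closed[folded ext_tensor_def ext_pure_def, simplified]
lemmas ext_lift_cong = TT.lift_cong[folded ext_tensor_def ext_pure_def, simplified]
lemmas ext_lift_simps = ext_lift_pure ext_lift_add ext_lift_closed

lemmas T_simps [simp] = T.lact_closed T.ract_closed T.lact_add T.ract_add T.one_lact T.one_ract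
lemmas T_ac = T.X.add.m_assoc T.X.add.m_comm T.X.add.m_lcomm
lemmas T_abelian = T.X.abelian_group_axioms
lemmas M_abelian = M.abelian_group_axioms

lemma balI:
  assumes "\<And>x y. \<lbrakk>x \<in> carrier M; y \<in> carrier M\<rbrakk> \<Longrightarrow> \<phi> x y \<in> carrier A"
    and "\<And>x x' y. \<lbrakk>x \<in> carrier M; x' \<in> carrier M; y \<in> carrier M\<rbrakk> \<Longrightarrow> \<phi> (x \<oplus> x') y = \<phi> x y \<oplus>\<^bsub>A\<^esub> \<phi> x' y"
    and "\<And>x y y'. \<lbrakk>x \<in> carrier M; y \<in> carrier M; y' \<in> carrier M\<rbrakk> \<Longrightarrow> \<phi> x (y \<oplus> y') = \<phi> x y \<oplus>\<^bsub>A\<^esub> \<phi> x y'"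
    and "\<And>x n y. \<lbrakk>x \<in> carrier M; n \<in> carrier N; y \<in> carrier M\<rbrakk> \<Longrightarrow> \<phi> (x \<otimes> f n) y = \<phi> x (f n \<otimes> y)"
  shows "bal A \<phi>"
  by (rule balanced_mapI) (use assms in simp_all)

section \<open>The centralizer R and the ring B\<close>

abbreviation "R \<equiv> centralizer_ring N M f"
abbreviation "B \<equiv> tensor_ring N M f"

lemma R_simps [simp]:
  "add R = add M" "mult R = mult M" "\<one>\<^bsub>R\<^esub> = \<one>" "\<zero>\<^bsub>R\<^esub> = \<zero>"
  by (simp_all add: centralizer_ring_def)

lemma mem_R: "r \<in> carrier R \<longleftrightarrow> r \<in> carrier M \<and> (\<forall>n\<in>carrier N. f n \<otimes> r = r \<otimes> f n)"
  by (simp add: centralizer_ring_def invariant_elements_def)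

lemma R_closed [simp]: "r \<in> carrier R \<Longrightarrow> r \<in> carrier M"
  by (simp add: mem_R)

lemma R_commute: "\<lbrakk>r \<in> carrier R; n \<in> carrier N\<rbrakk> \<Longrightarrow> f n \<otimes> r = r \<otimes> f n"
  by (simp add: mem_R)

lemma ring_R: "ring R"
proof -
  have "subring (carrier R) M"
  proof (rule M.subringI)
    fix h assume h: "h \<in> carrier R"
    show "\<ominus> h \<in> carrier R" using h by (simp add: mem_R M.l_minus M.r_minus)
  next
    fix h k assume *: "h \<in> carrier R" "k \<in> carrier R"
    then have hk: "h \<in> carrier M" "k \<in> carrier M" by auto
    have "f n \<otimes> (h \<otimes> k) = h \<otimes> k \<otimes> f n" if n: "n \<in> carrier N" for n
    proof -
      have "f n \<otimes> (h \<otimes> k) = h \<otimes> (f n \<otimes> k)"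
        using n hk R_commute[OF *(1) n] by (simp add: M.m_assoc[symmetric])
      then show ?thesis using n hk R_commute[OF *(2) n] by (simp add: M.m_assoc)
    qed
    then show "h \<otimes> k \<in> carrier R" using hk by (simp add: mem_R)
    show "h \<oplus> k \<in> carrier R" using * by (simp add: mem_R M.l_distr M.r_distr)
  qed (auto simp: mem_R)
  then have "ring (M\<lparr>carrier := carrier R\<rparr>)" by (rule M.subring_is_ring)
  then show ?thesis by (simp add: centralizer_ring_def)
qed

sublocale R: ring R by (rule ring_R)

lemma mem_B: "u \<in> carrier B \<longleftrightarrow> u \<in> carrier T \<and> (\<forall>n\<in>carrier N. f n \<cdot>\<^sub>l u = u \<cdot>\<^sub>r f n)"
  by (simp add: tensor_ring_def Let_def invariant_elements_def restrict_scalars_def)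

lemma B_closed [simp]: "u \<in> carrier B \<Longrightarrow> u \<in> carrier T"
  by (simp add: mem_B)

lemma B_commute: "\<lbrakk>u \<in> carrier B; n \<in> carrier N\<rbrakk> \<Longrightarrow> f n \<cdot>\<^sub>l u = u \<cdot>\<^sub>r f n"
  by (simp add: mem_B)

text \<open>For \<open>c \<in> B\<close> this is the \<open>M\<close>-\<open>M\<close>-bimodule endomorphism of \<open>M \<otimes> M\<close> that maps \<open>1 \<otimes> 1\<close> to \<open>c\<close>;
  the product of \<open>B\<close> is composition of these endomorphisms.\<close>

definition bimod_end where
  "bimod_end c = tensor_lift T (\<lambda>x y. (x \<cdot>\<^sub>l c) \<cdot>\<^sub>r y)"

text \<open>Balancing compares n to the left of \<open>c\<close> with n to the right of it;
  membership of \<open>c\<close> in B identifies the two.\<close>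

lemma bal_bimod_end: "c \<in> carrier B \<Longrightarrow> bal T (\<lambda>x y. (x \<cdot>\<^sub>l c) \<cdot>\<^sub>r y)"
  by (rule balI)
    (simp_all add: T.add_lact T.add_ract T.mult_lact B_commute T.mult_ract T.lact_ract)

lemma bimod_end_pt [simp]:
  "\<lbrakk>c \<in> carrier B; x \<in> carrier M; y \<in> carrier M\<rbrakk> \<Longrightarrow> bimod_end c (x \<boxdot> y) = (x \<cdot>\<^sub>l c) \<cdot>\<^sub>r y"
  by (simp add: bimod_end_def ext_lift_simps bal_bimod_end T_abelian)

lemma bimod_end_closed [simp]: "\<lbrakk>c \<in> carrier B; u \<in> carrier T\<rbrakk> \<Longrightarrow> bimod_end c u \<in> carrier T"
  by (simp add: bimod_end_def ext_lift_simps bal_bimod_end T_abelian)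

lemma bimod_end_add [simp]:
  "\<lbrakk>c \<in> carrier B; u \<in> carrier T; v \<in> carrier T\<rbrakk>
    \<Longrightarrow> bimod_end c (u \<oplus>\<^bsub>T\<^esub> v) = bimod_end c u \<oplus>\<^bsub>T\<^esub> bimod_end c v"
  by (simp add: bimod_end_def ext_lift_simps bal_bimod_end T_abelian)

lemma bimod_end_lact [simp]:
  assumes "c \<in> carrier B" "x \<in> carrier M" "u \<in> carrier T"
  shows "bimod_end c (x \<cdot>\<^sub>l u) = x \<cdot>\<^sub>l bimod_end c u"
  using assms(3) by (induction u rule: ext_tensor_induct)
    (use assms(1,2) in \<open>simp_all add: T.mult_lact T.lact_ract\<close>)

lemma bimod_end_ract [simp]:
  assumes "c \<in> carrier B" "x \<in> carrier M" "u \<in> carrier T"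
  shows "bimod_end c (u \<cdot>\<^sub>r x) = bimod_end c u \<cdot>\<^sub>r x"
  using assms(3) by (induction u rule: ext_tensor_induct)
    (use assms(1,2) in \<open>simp_all add: T.mult_ract\<close>)

lemma bimod_end_B [simp]: "\<lbrakk>c \<in> carrier B; u \<in> carrier B\<rbrakk> \<Longrightarrow> bimod_end c u \<in> carrier B"
  unfolding mem_B[of "bimod_end c u"] by (metis B_closed B_commute bimod_end_closed bimod_end_lact bimod_end_ract f_closed)

text \<open>Both sides are bimodule endomorphisms with the same value at 1 \<otimes> 1. This is the
  associativity of B.\<close>

lemma bimod_end_comp:
  assumes "c \<in> carrier B" "d \<in> carrier B" "u \<in> carrier T"
  shows "bimod_end (bimod_end c d) u = bimod_end c (bimod_end d u)"
  using assms(3) by (induction u rule: ext_tensor_induct) (use assms(1,2) in simp_all)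

lemma bimod_end_one: "u \<in> carrier T \<Longrightarrow> \<one> \<boxdot> \<one> \<in> carrier B \<Longrightarrow> bimod_end (\<one> \<boxdot> \<one>) u = u"
  by (induction u rule: ext_tensor_induct) simp_all

lemma bimod_end_add_arg:
  assumes "c \<in> carrier B" "d \<in> carrier B" "c \<oplus>\<^bsub>T\<^esub> d \<in> carrier B" "u \<in> carrier T"
  shows "bimod_end (c \<oplus>\<^bsub>T\<^esub> d) u = bimod_end c u \<oplus>\<^bsub>T\<^esub> bimod_end d u"
  using assms(4) by (induction u rule: ext_tensor_induct) (use assms(1-3) in \<open>simp_all add: T_ac\<close>)

text \<open>For fixed x' and y' the inner lift of the product is x' c y', so the outer lift is
  \<open>bimod_end c\<close> evaluated at \<open>d\<close>.\<close>

lemma B_simps [simp]: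
  "\<lbrakk>c \<in> carrier B; d \<in> carrier B\<rbrakk> \<Longrightarrow> c \<otimes>\<^bsub>B\<^esub> d = bimod_end c d"
  "\<one>\<^bsub>B\<^esub> = \<one> \<boxdot> \<one>" "\<zero>\<^bsub>B\<^esub> = \<zero>\<^bsub>T\<^esub>" "add B = add T"
proof -
  assume c: "c \<in> carrier B" and d: "d \<in> carrier B"
  have inner: "tensor_lift T (\<lambda>x y. (x' \<otimes> x) \<boxdot> (y \<otimes> y')) u = (x' \<cdot>\<^sub>l u) \<cdot>\<^sub>r y'"
    if x': "x' \<in> carrier M" and y': "y' \<in> carrier M" and u: "u \<in> carrier T" for x' y' u
  proof -
    have b: "bal T (\<lambda>x y. (x' \<otimes> x) \<boxdot> (y \<otimes> y'))"
      by (rule balI) (use x' y' in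
        \<open>simp_all add: M.l_distr M.r_distr pt_add_left pt_add_right M.m_assoc[symmetric] pt_balanced\<close>)
    show ?thesis
      using u by (induction u rule: ext_tensor_induct)
        (use x' y' in \<open>simp_all add: ext_lift_simps[OF T_abelian b]\<close>)
  qed
  have "c \<otimes>\<^bsub>B\<^esub> d = tensor_lift T (\<lambda>x' y'. tensor_lift T (\<lambda>x y. (x' \<otimes> x) \<boxdot> (y \<otimes> y')) c) d"
    by (simp add: tensor_ring_def Let_def)
  also have "\<dots> = bimod_end c d"
    unfolding bimod_end_def
    by (rule ext_lift_cong[OF T_abelian bal_bimod_end[OF c]]) (use c d inner in simp_all)
  finally show "c \<otimes>\<^bsub>B\<^esub> d = bimod_end c d" .
qed (simp_all add: tensor_ring_def Let_def)

lemma B_one [simp]: "\<one> \<boxdot> \<one> \<in> carrier B"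
  using pt_balanced[of \<one> _ \<one>] by (simp add: mem_B)

lemma B_add [simp]: "\<lbrakk>c \<in> carrier B; d \<in> carrier B\<rbrakk> \<Longrightarrow> c \<oplus>\<^bsub>T\<^esub> d \<in> carrier B"
  by (simp add: mem_B)

lemma lact_zero: "x \<in> carrier M \<Longrightarrow> x \<cdot>\<^sub>l \<zero>\<^bsub>T\<^esub> = \<zero>\<^bsub>T\<^esub>"
  and ract_zero: "x \<in> carrier M \<Longrightarrow> \<zero>\<^bsub>T\<^esub> \<cdot>\<^sub>r x = \<zero>\<^bsub>T\<^esub>"
  by (rule additive_zero; simp add: T_abelian)+

lemma lact_uminus: "\<lbrakk>x \<in> carrier M; u \<in> carrier T\<rbrakk> \<Longrightarrow> x \<cdot>\<^sub>l (\<ominus>\<^bsub>T\<^esub> u) = \<ominus>\<^bsub>T\<^esub> (x \<cdot>\<^sub>l u)"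
  using T.lact_add[of x "\<ominus>\<^bsub>T\<^esub> u" u] by (simp add: T.X.l_neg lact_zero T.X.minus_equality)

lemma ract_uminus: "\<lbrakk>x \<in> carrier M; u \<in> carrier T\<rbrakk> \<Longrightarrow> (\<ominus>\<^bsub>T\<^esub> u) \<cdot>\<^sub>r x = \<ominus>\<^bsub>T\<^esub> (u \<cdot>\<^sub>r x)"
  using T.ract_add[of x "\<ominus>\<^bsub>T\<^esub> u" u] by (simp add: T.X.l_neg ract_zero T.X.minus_equality)

lemma ring_B: "ring B"
proof (rule ringI)
  show "abelian_group B"
  proof (rule abelian_groupI)
    fix x assume x: "x \<in> carrier B"
    show "\<exists>y\<in>carrier B. y \<oplus>\<^bsub>B\<^esub> x = \<zero>\<^bsub>B\<^esub>"
      by (rule bexI[of _ "\<ominus>\<^bsub>T\<^esub> x"]) (use x in \<open>simp_all add: mem_B T.X.l_neg lact_uminus ract_uminus\<close>)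
  qed (simp_all add: T_ac, simp add: mem_B lact_zero ract_zero)
  show "monoid B"
    by standard (simp_all add: bimod_end_comp bimod_end_one)
qed (simp_all add: bimod_end_add_arg)

sublocale B: ring B by (rule ring_B)

abbreviation "s \<equiv> D2_source N M f"
abbreviation "t \<equiv> D2_target N M f"

lemma source_eq: "s r = \<one> \<boxdot> r" and target_eq: "t r = r \<boxdot> \<one>"
  by (simp_all add: D2_source_def D2_target_def)

lemma source_B [simp]: "r \<in> carrier R \<Longrightarrow> \<one> \<boxdot> r \<in> carrier B"
  using pt_balanced[of \<one> _ r] by (auto simp: mem_B R_commute)

lemma target_B [simp]: "r \<in> carrier R \<Longrightarrow> r \<boxdot> \<one> \<in> carrier B"
  using pt_balanced[of r _ \<one>] by (auto simp: mem_B R_commute)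

lemma R_add_mult [simp]:
  "\<lbrakk>r \<in> carrier R; r' \<in> carrier R\<rbrakk> \<Longrightarrow> r \<oplus> r' \<in> carrier R"
  "\<lbrakk>r \<in> carrier R; r' \<in> carrier R\<rbrakk> \<Longrightarrow> r \<otimes> r' \<in> carrier R"
  using R.a_closed R.m_closed by simp_all

text \<open>In B the left tensor factors multiply in reversed order and the right ones in the given
  order: hence t reverses products and s preserves them. Their images commute because they occupy
  different factors.\<close>

sublocale St: source_target R B s t
proof
  show "s \<in> ring_hom R B"
    by (rule ring_hom_memI) (simp_all add: source_eq pt_add_right)
  show "t \<in> ring_hom (opposite_ring R) B"
    by (rule ring_hom_memI) (simp_all add: opposite_ring_def target_eq pt_add_left)
qed (simp add: source_eq target_eq)

text \<open>Thus the R-bimodule structure that a bialgebroid takes from right multiplication by s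
  and t is the restriction of the M-bimodule structure of M \<otimes> M.\<close>

lemma bimod_end_source_target [simp]:
  "\<lbrakk>c \<in> carrier B; r \<in> carrier R\<rbrakk> \<Longrightarrow> bimod_end c (s r) = c \<cdot>\<^sub>r r"
  "\<lbrakk>c \<in> carrier B; r \<in> carrier R\<rbrakk> \<Longrightarrow> bimod_end c (t r) = r \<cdot>\<^sub>l c"
  by (simp_all add: source_eq target_eq)

lemma lact_B [simp]: "\<lbrakk>r \<in> carrier R; c \<in> carrier B\<rbrakk> \<Longrightarrow> r \<cdot>\<^sub>l c \<in> carrier B"
  using bimod_end_B[of c "r \<boxdot> \<one>"] by simp

lemma ract_B [simp]: "\<lbrakk>r \<in> carrier R; c \<in> carrier B\<rbrakk> \<Longrightarrow> c \<cdot>\<^sub>r r \<in> carrier B"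
  using bimod_end_B[of c "\<one> \<boxdot> r"] by simp

section \<open>Right N-linear maps and their contractions\<close>

definition right_linear where
  "right_linear \<phi> \<longleftrightarrow> (\<forall>x\<in>carrier M. \<phi> x \<in> carrier M)
    \<and> (\<forall>x\<in>carrier M. \<forall>y\<in>carrier M. \<phi> (x \<oplus> y) = \<phi> x \<oplus> \<phi> y)
    \<and> (\<forall>x\<in>carrier M. \<forall>n\<in>carrier N. \<phi> (x \<otimes> f n) = \<phi> x \<otimes> f n)"

lemma right_linearD:
  assumes "right_linear \<phi>"
  shows "x \<in> carrier M \<Longrightarrow> \<phi> x \<in> carrier M"
    and "\<lbrakk>x \<in> carrier M; y \<in> carrier M\<rbrakk> \<Longrightarrow> \<phi> (x \<oplus> y) = \<phi> x \<oplus> \<phi> y"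
    and "\<lbrakk>x \<in> carrier M; n \<in> carrier N\<rbrakk> \<Longrightarrow> \<phi> (x \<otimes> f n) = \<phi> x \<otimes> f n"
  using assms by (auto simp: right_linear_def)

lemma right_linear_id [simp]: "right_linear (\<lambda>x. x)"
  by (simp add: right_linear_def)

lemma right_linear_comp: "\<lbrakk>right_linear \<phi>; right_linear \<psi>\<rbrakk> \<Longrightarrow> right_linear (\<lambda>x. \<phi> (\<psi> x))"
  by (simp add: right_linear_def)

text \<open>Together with \<open>right_linear_comp\<close> this admits \<phi> \<circ> \<lambda>(m)
  for every m in M. Left N-linearity would in general be lost here unless m centralizes N.\<close>

lemma right_linear_left_mult: "m \<in> carrier M \<Longrightarrow> right_linear (\<lambda>x. m \<otimes> x)"
  by (simp add: right_linear_def M.r_distr M.m_assoc)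

text \<open>\<open>contract \<phi>\<close> and \<open>apply_left \<phi>\<close> are the maps \<open>\<mu>\<^sub>\<phi>\<close> and \<open>\<phi>\<^sub>*\<close> of the introduction.\<close>

definition contract where "contract \<phi> = tensor_lift M (\<lambda>x y. \<phi> x \<otimes> y)"

definition apply_left where "apply_left \<phi> = tensor_lift T (\<lambda>x y. \<phi> x \<boxdot> y)"

lemma bal_contract: "right_linear \<phi> \<Longrightarrow> bal M (\<lambda>x y. \<phi> x \<otimes> y)"
  by (rule balI) (simp_all add: right_linearD M.l_distr M.r_distr M.m_assoc)

lemma bal_apply_left: "right_linear \<phi> \<Longrightarrow> bal T (\<lambda>x y. \<phi> x \<boxdot> y)"
  by (rule balI) (simp_all add: right_linearD pt_add_left pt_add_right pt_balanced)

context
  fixes \<phi> assumes \<phi>: "right_linear \<phi>"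
begin

lemma contract_pt [simp]: "\<lbrakk>x \<in> carrier M; y \<in> carrier M\<rbrakk> \<Longrightarrow> contract \<phi> (x \<boxdot> y) = \<phi> x \<otimes> y"
  by (simp add: contract_def ext_lift_simps bal_contract \<phi> M_abelian)

lemma contract_closed [simp]: "u \<in> carrier T \<Longrightarrow> contract \<phi> u \<in> carrier M"
  by (simp add: contract_def ext_lift_simps bal_contract \<phi> M_abelian)

lemma contract_add [simp]:
  "\<lbrakk>u \<in> carrier T; v \<in> carrier T\<rbrakk> \<Longrightarrow> contract \<phi> (u \<oplus>\<^bsub>T\<^esub> v) = contract \<phi> u \<oplus> contract \<phi> v"
  by (simp add: contract_def ext_lift_simps bal_contract \<phi> M_abelian)

lemma contract_ract [simp]:
  assumes "u \<in> carrier T" "m \<in> carrier M"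
  shows "contract \<phi> (u \<cdot>\<^sub>r m) = contract \<phi> u \<otimes> m"
  using assms(1) by (induction u rule: ext_tensor_induct)
    (use assms(2) right_linearD[OF \<phi>] in \<open>simp_all add: M.m_assoc M.l_distr\<close>)

lemma apply_left_pt [simp]: "\<lbrakk>x \<in> carrier M; y \<in> carrier M\<rbrakk> \<Longrightarrow> apply_left \<phi> (x \<boxdot> y) = \<phi> x \<boxdot> y"
  by (simp add: apply_left_def ext_lift_simps bal_apply_left \<phi> T_abelian)

lemma apply_left_closed [simp]: "u \<in> carrier T \<Longrightarrow> apply_left \<phi> u \<in> carrier T"
  by (simp add: apply_left_def ext_lift_simps bal_apply_left \<phi> T_abelian)

lemma apply_left_add [simp]:
  "\<lbrakk>u \<in> carrier T; v \<in> carrier T\<rbrakk> \<Longrightarrow> apply_left \<phi> (u \<oplus>\<^bsub>T\<^esub> v) = apply_left \<phi> u \<oplus>\<^bsub>T\<^esub> apply_left \<phi> v"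
  by (simp add: apply_left_def ext_lift_simps bal_apply_left \<phi> T_abelian)

lemma apply_left_ract [simp]:
  assumes "u \<in> carrier T" "m \<in> carrier M"
  shows "apply_left \<phi> (u \<cdot>\<^sub>r m) = apply_left \<phi> u \<cdot>\<^sub>r m"
  using assms(1) by (induction u rule: ext_tensor_induct)
    (use assms(2) right_linearD[OF \<phi>] in simp_all)

lemma contract_lact:
  assumes "u \<in> carrier T" "m \<in> carrier M"
  shows "contract \<phi> (m \<cdot>\<^sub>l u) = contract (\<lambda>x. \<phi> (m \<otimes> x)) u"
proof -
  have r: "right_linear (\<lambda>x. \<phi> (m \<otimes> x))"
    using right_linear_comp[OF \<phi> right_linear_left_mult[OF assms(2)]] .
  note e = ext_lift_simps[OF M_abelian bal_contract[OF r], folded contract_def]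
  show ?thesis
    using assms(1) by (induction u rule: ext_tensor_induct) (use assms(2) e in simp_all)
qed

lemma apply_left_lact:
  assumes "u \<in> carrier T" "m \<in> carrier M"
  shows "apply_left \<phi> (m \<cdot>\<^sub>l u) = apply_left (\<lambda>x. \<phi> (m \<otimes> x)) u"
proof -
  have r: "right_linear (\<lambda>x. \<phi> (m \<otimes> x))"
    using right_linear_comp[OF \<phi> right_linear_left_mult[OF assms(2)]] .
  note e = ext_lift_simps[OF T_abelian bal_apply_left[OF r], folded apply_left_def]
  show ?thesis
    using assms(1) by (induction u rule: ext_tensor_induct) (use assms(2) e in simp_all)
qed

text \<open>In x f(n) a the factor f(n) passes to the right of \<open>a\<close>, which commutes with
  N, and then out of the contraction. Such functionals absorb a product with \<open>a\<close>, see
  \<open>contract_bimod_end\<close>.\<close>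

lemma right_linear_contract:
  assumes a: "a \<in> carrier B"
  shows "right_linear (\<lambda>x. contract \<phi> (x \<cdot>\<^sub>l a))"
  unfolding right_linear_def
  using a contract_ract by (simp add: T.add_lact T.mult_lact B_commute flip: T.lact_ract)

end

lemma contract_apply_left:
  assumes "right_linear \<phi>" "right_linear \<psi>" "u \<in> carrier T"
  shows "contract \<phi> (apply_left \<psi> u) = contract (\<lambda>x. \<phi> (\<psi> x)) u"
  using assms(3) by (induction u rule: ext_tensor_induct)
    (use assms(1,2) right_linearD[OF assms(2)] in \<open>simp_all add: right_linear_comp\<close>)

lemma apply_left_apply_left:
  assumes "right_linear \<phi>" "right_linear \<psi>" "u \<in> carrier T"
  shows "apply_left \<phi> (apply_left \<psi> u) = apply_left (\<lambda>x. \<phi> (\<psi> x)) u"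
  using assms(3) by (induction u rule: ext_tensor_induct)
    (use assms(1,2) right_linearD[OF assms(2)] in \<open>simp_all add: right_linear_comp\<close>)

lemma contract_bimod_end:
  assumes "right_linear \<phi>" "a \<in> carrier B" "u \<in> carrier T"
  shows "contract \<phi> (bimod_end a u) = contract (\<lambda>x. contract \<phi> (x \<cdot>\<^sub>l a)) u"
  using assms(3) by (induction u rule: ext_tensor_induct)
    (use assms(1,2) in \<open>simp_all add: right_linear_contract\<close>)

end

section \<open>The bialgebroid of a depth two extension\<close>

locale D2_extension = ring_extension N M f
  for N :: "('n, 'i) ring_scheme" and M :: "('m, 'j) ring_scheme" (structure) and f :: "'n \<Rightarrow> 'm" +
  fixes I :: "'k set" and b :: "'k \<Rightarrow> (('m \<times> 'm) \<Rightarrow>\<^sub>0 int) set" and \<beta> :: "'k \<Rightarrow> 'm \<Rightarrow> 'm"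
  assumes quasibasis: "left_D2_quasibasis N M f I b \<beta>"
begin

lemma finite_I [simp]: "finite I"
  using quasibasis by (simp add: left_D2_quasibasis_def)

lemma b_B [simp]: "i \<in> I \<Longrightarrow> b i \<in> carrier B"
  using quasibasis by (simp add: left_D2_quasibasis_def tensor_ring_def Let_def)

lemma \<beta>_bimodule_hom:
  "i \<in> I \<Longrightarrow> \<beta> i \<in> bimodule_hom N N (restrict_scalars f f (regular_bimodule M))
      (restrict_scalars f f (regular_bimodule M))"
  using quasibasis by (simp add: left_D2_quasibasis_def)

lemma right_linear_\<beta> [simp]: "i \<in> I \<Longrightarrow> right_linear (\<beta> i)"
  using \<beta>_bimodule_hom[of i] by (auto simp: right_linear_def bimodule_hom_def)

lemma \<beta>_closed [simp]: "\<lbrakk>i \<in> I; x \<in> carrier M\<rbrakk> \<Longrightarrow> \<beta> i x \<in> carrier M"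
  by (simp add: right_linearD)

lemma \<beta>_left: "\<lbrakk>i \<in> I; x \<in> carrier M; n \<in> carrier N\<rbrakk> \<Longrightarrow> \<beta> i (f n \<otimes> x) = f n \<otimes> \<beta> i x"
  using \<beta>_bimodule_hom[of i] by (auto simp: bimodule_hom_def)

lemma quasibasis_sum: "m \<in> carrier M \<Longrightarrow> (\<Oplus>\<^bsub>T\<^esub>i\<in>I. b i \<cdot>\<^sub>r \<beta> i m) = m \<boxdot> \<one>"
  using quasibasis by (simp add: left_D2_quasibasis_def)

text \<open>Contraction along an N-bilinear \<phi> is a map of N-bimodules from M \<otimes> M to M,
  so it preserves commuting with N. It is applied to the \<beta> i and, for the counit, to the
  identity.\<close>

lemma contract_R:
  assumes \<phi>: "right_linear \<phi>" "\<And>n x. \<lbrakk>n \<in> carrier N; x \<in> carrier M\<rbrakk> \<Longrightarrow> \<phi> (f n \<otimes> x) = f n \<otimes> \<phi> x"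
    and c: "c \<in> carrier B"
  shows "contract \<phi> c \<in> carrier R"
proof -
  have "contract \<phi> (f n \<cdot>\<^sub>l u) = f n \<otimes> contract \<phi> u" if n: "n \<in> carrier N" and u: "u \<in> carrier T" for n u
    using u by (induction u rule: ext_tensor_induct)
      (use n \<phi> right_linearD[OF \<phi>(1)] in \<open>simp_all add: M.m_assoc M.r_distr\<close>)
  then have "f n \<otimes> contract \<phi> c = contract \<phi> c \<otimes> f n" if "n \<in> carrier N" for n
    using that c \<phi>(1) by (metis B_closed B_commute contract_ract f_closed)
  then show ?thesis
    using c \<phi>(1) by (auto simp: mem_R[of "contract \<phi> c"])
qed

lemma apply_left_B:
  assumes \<phi>: "right_linear \<phi>" "\<And>n x. \<lbrakk>n \<in> carrier N; x \<in> carrier M\<rbrakk> \<Longrightarrow> \<phi> (f n \<otimes> x) = f n \<otimes> \<phi> x"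
    and c: "c \<in> carrier B"
  shows "apply_left \<phi> c \<in> carrier B"
proof -
  have "apply_left \<phi> (f n \<cdot>\<^sub>l u) = f n \<cdot>\<^sub>l apply_left \<phi> u" if n: "n \<in> carrier N" and u: "u \<in> carrier T" for n u
    using u by (induction u rule: ext_tensor_induct)
      (use n \<phi> right_linearD[OF \<phi>(1)] in simp_all)
  then have "f n \<cdot>\<^sub>l apply_left \<phi> c = apply_left \<phi> c \<cdot>\<^sub>r f n" if "n \<in> carrier N" for n
    using that c \<phi>(1) by (metis B_closed B_commute apply_left_ract f_closed)
  then show ?thesis
    using c \<phi>(1) by (auto simp: mem_B[of "apply_left \<phi> c"])
qed

lemma contract_\<beta>_R [simp]: "\<lbrakk>i \<in> I; c \<in> carrier B\<rbrakk> \<Longrightarrow> contract (\<beta> i) c \<in> carrier R"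
  by (simp add: contract_R \<beta>_left)

lemma apply_left_\<beta>_B [simp]: "\<lbrakk>i \<in> I; c \<in> carrier B\<rbrakk> \<Longrightarrow> apply_left (\<beta> i) c \<in> carrier B"
  by (simp add: apply_left_B \<beta>_left)

section \<open>Consequences of the quasibasis identity\<close>

lemma finsum_B:
  assumes "\<And>i. i \<in> J \<Longrightarrow> g i \<in> carrier B"
  shows "(\<Oplus>\<^bsub>B\<^esub>i\<in>J. g i) = (\<Oplus>\<^bsub>T\<^esub>i\<in>J. g i)"
  by (rule additive_finsum[where h="\<lambda>x. x", OF B.abelian_group_axioms T_abelian])
    (use assms in simp_all)

text \<open>On x \<otimes> y this is the quasibasis identity at x, multiplied by y on the
  right.\<close>

lemma quasibasis_expand:
  assumes "u \<in> carrier T"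
  shows "(\<Oplus>\<^bsub>T\<^esub>i\<in>I. b i \<cdot>\<^sub>r contract (\<beta> i) u) = u"
  using assms
proof (induction u rule: ext_tensor_induct)
  case (pure x y)
  have "(\<Oplus>\<^bsub>T\<^esub>i\<in>I. b i \<cdot>\<^sub>r contract (\<beta> i) (x \<boxdot> y)) = (\<Oplus>\<^bsub>T\<^esub>i\<in>I. (b i \<cdot>\<^sub>r \<beta> i x) \<cdot>\<^sub>r y)"
    by (rule T.X.finsum_cong') (use pure in \<open>auto simp: T.mult_ract\<close>)
  also have "\<dots> = (\<Oplus>\<^bsub>T\<^esub>i\<in>I. b i \<cdot>\<^sub>r \<beta> i x) \<cdot>\<^sub>r y"
    by (rule additive_finsum[symmetric, OF T_abelian T_abelian]) (use pure in simp_all)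
  finally show ?case using pure by (simp add: quasibasis_sum)
next
  case (add u v)
  have "(\<Oplus>\<^bsub>T\<^esub>i\<in>I. b i \<cdot>\<^sub>r contract (\<beta> i) (u \<oplus>\<^bsub>T\<^esub> v))
      = (\<Oplus>\<^bsub>T\<^esub>i\<in>I. b i \<cdot>\<^sub>r contract (\<beta> i) u \<oplus>\<^bsub>T\<^esub> b i \<cdot>\<^sub>r contract (\<beta> i) v)"
    by (rule T.X.finsum_cong') (use add in \<open>auto simp: T.add_ract\<close>)
  also have "\<dots> = (\<Oplus>\<^bsub>T\<^esub>i\<in>I. b i \<cdot>\<^sub>r contract (\<beta> i) u) \<oplus>\<^bsub>T\<^esub> (\<Oplus>\<^bsub>T\<^esub>i\<in>I. b i \<cdot>\<^sub>r contract (\<beta> i) v)"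
    by (rule T.X.finsum_addf) (use add in auto)
  finally show ?case using add by simp
qed

text \<open>Contract the quasibasis identity at x along \<phi>. In effect \<phi> is a left M-linear
  combination of the \<beta> i, with coefficients \<open>contract \<phi> (b i)\<close>.\<close>

lemma contract_quasibasis:
  assumes \<phi>: "right_linear \<phi>" and x: "x \<in> carrier M"
  shows "(\<Oplus>i\<in>I. contract \<phi> (b i) \<otimes> \<beta> i x) = \<phi> x"
proof -
  have "(\<Oplus>i\<in>I. contract \<phi> (b i) \<otimes> \<beta> i x) = (\<Oplus>i\<in>I. contract \<phi> (b i \<cdot>\<^sub>r \<beta> i x))"
    by (rule M.finsum_cong') (use \<phi> x in auto)
  also have "\<dots> = contract \<phi> (\<Oplus>\<^bsub>T\<^esub>i\<in>I. b i \<cdot>\<^sub>r \<beta> i x)"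
    by (rule additive_finsum[symmetric, OF T_abelian M_abelian]) (use \<phi> x in simp_all)
  finally show ?thesis using \<phi> x by (simp add: quasibasis_sum right_linearD)
qed

text \<open>On x \<otimes> y this is \<open>contract_quasibasis\<close> tensored with y. The left
  side is what a collapsed comultiplication looks like.\<close>

lemma apply_left_quasibasis:
  assumes \<phi>: "right_linear \<phi>" and "u \<in> carrier T"
  shows "(\<Oplus>\<^bsub>T\<^esub>i\<in>I. contract \<phi> (b i) \<cdot>\<^sub>l apply_left (\<beta> i) u) = apply_left \<phi> u"
  using assms(2)
proof (induction u rule: ext_tensor_induct)
  case (pure x y)
  have "(\<Oplus>\<^bsub>T\<^esub>i\<in>I. contract \<phi> (b i) \<cdot>\<^sub>l apply_left (\<beta> i) (x \<boxdot> y))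
      = (\<Oplus>\<^bsub>T\<^esub>i\<in>I. (contract \<phi> (b i) \<otimes> \<beta> i x) \<boxdot> y)"
    by (rule T.X.finsum_cong') (use pure \<phi> in auto)
  also have "\<dots> = (\<Oplus>i\<in>I. contract \<phi> (b i) \<otimes> \<beta> i x) \<boxdot> y"
    by (rule additive_finsum[symmetric, OF M_abelian T_abelian]) (use pure \<phi> in \<open>simp_all add: pt_add_left\<close>)
  finally show ?case using pure \<phi> by (simp add: contract_quasibasis)
next
  case (add u v)
  have "(\<Oplus>\<^bsub>T\<^esub>i\<in>I. contract \<phi> (b i) \<cdot>\<^sub>l apply_left (\<beta> i) (u \<oplus>\<^bsub>T\<^esub> v))
      = (\<Oplus>\<^bsub>T\<^esub>i\<in>I. contract \<phi> (b i) \<cdot>\<^sub>l apply_left (\<beta> i) u \<oplus>\<^bsub>T\<^esub> contract \<phi> (b i) \<cdot>\<^sub>l apply_left (\<beta> i) v)"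
    by (rule T.X.finsum_cong') (use add \<phi> in auto)
  also have "\<dots> = (\<Oplus>\<^bsub>T\<^esub>i\<in>I. contract \<phi> (b i) \<cdot>\<^sub>l apply_left (\<beta> i) u)
      \<oplus>\<^bsub>T\<^esub> (\<Oplus>\<^bsub>T\<^esub>i\<in>I. contract \<phi> (b i) \<cdot>\<^sub>l apply_left (\<beta> i) v)"
    by (rule T.X.finsum_addf) (use add \<phi> in auto)
  finally show ?case using add \<phi> by simp
qed

section \<open>Collapsing B \<otimes> B into M \<otimes> M\<close>

abbreviation "X \<equiv> bialgebroid_bimodule B s t"
abbreviation "W \<equiv> tensor R X X"
abbreviation pB (infixl \<open>\<diamondop>\<close> 72) where "c \<diamondop> d \<equiv> pure_tensor R X X c d"

sublocale W: bimodule R R W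
  by (rule St.XX.bimodule_tensor)

lemmas W_abelian = St.XX.T.abelian_group_axioms

text \<open>The target is M \<otimes> M because for general \<phi> the coefficient
  \<open>contract \<phi> c\<close> lies merely in M; for \<phi> = \<beta> i it lies in R and the
  values fall into B.\<close>

definition collapse where "collapse \<phi> = tensor_lift T (\<lambda>c d. contract \<phi> c \<cdot>\<^sub>l d)"

lemma bal_collapse: "right_linear \<phi> \<Longrightarrow> balanced_map R X X T (\<lambda>c d. contract \<phi> c \<cdot>\<^sub>l d)"
  by (rule balanced_mapI) (simp_all add: T.add_lact T.mult_lact)

lemma lact_W_pure [simp]:
  "\<lbrakk>r \<in> carrier R; c \<in> carrier B; d \<in> carrier B\<rbrakk> \<Longrightarrow> lact W r (c \<diamondop> d) = (r \<cdot>\<^sub>l c) \<diamondop> d"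
  by (simp add: St.XX.lact_pure)

lemma ract_W_pure [simp]:
  "\<lbrakk>r \<in> carrier R; c \<in> carrier B; d \<in> carrier B\<rbrakk> \<Longrightarrow> ract W (c \<diamondop> d) r = c \<diamondop> (d \<cdot>\<^sub>r r)"
  by (simp add: St.XX.ract_pure)

lemmas W_simps [simp] = W.lact_closed W.ract_closed W.lact_add W.ract_add W.one_lact W.one_ract

lemma pB_add:
  "\<lbrakk>c \<in> carrier B; c' \<in> carrier B; d \<in> carrier B\<rbrakk> \<Longrightarrow> (c \<oplus>\<^bsub>T\<^esub> c') \<diamondop> d = c \<diamondop> d \<oplus>\<^bsub>W\<^esub> c' \<diamondop> d"
  "\<lbrakk>c \<in> carrier B; d \<in> carrier B; d' \<in> carrier B\<rbrakk> \<Longrightarrow> c \<diamondop> (d \<oplus>\<^bsub>T\<^esub> d') = c \<diamondop> d \<oplus>\<^bsub>W\<^esub> c \<diamondop> d'"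
  using St.XX.pure_add_left[of c c' d] St.XX.pure_add_right[of c d d'] by simp_all

lemma pB_balanced:
  "\<lbrakk>c \<in> carrier B; r \<in> carrier R; d \<in> carrier B\<rbrakk> \<Longrightarrow> (c \<cdot>\<^sub>r r) \<diamondop> d = c \<diamondop> (r \<cdot>\<^sub>l d)"
  using St.XX.pure_balanced[of c r d] by simp

lemmas W_induct [consumes 1, case_names pure add] = St.XX.tensor_induct[simplified]

context
  fixes \<phi> assumes \<phi> [simp]: "right_linear \<phi>"
begin

lemma collapse_pure [simp]:
  "\<lbrakk>c \<in> carrier B; d \<in> carrier B\<rbrakk> \<Longrightarrow> collapse \<phi> (c \<diamondop> d) = contract \<phi> c \<cdot>\<^sub>l d"
  by (simp add: collapse_def St.XX.lift_pure bal_collapse T_abelian)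

lemma collapse_closed [simp]: "U \<in> carrier W \<Longrightarrow> collapse \<phi> U \<in> carrier T"
  by (simp add: collapse_def St.XX.lift_closed bal_collapse T_abelian)

lemma collapse_add [simp]:
  "\<lbrakk>U \<in> carrier W; V \<in> carrier W\<rbrakk> \<Longrightarrow> collapse \<phi> (U \<oplus>\<^bsub>W\<^esub> V) = collapse \<phi> U \<oplus>\<^bsub>T\<^esub> collapse \<phi> V"
  by (simp add: collapse_def St.XX.lift_add bal_collapse T_abelian)

lemma collapse_finsum:
  "(\<And>i. i \<in> J \<Longrightarrow> g i \<in> carrier W) \<Longrightarrow> collapse \<phi> (\<Oplus>\<^bsub>W\<^esub>i\<in>J. g i) = (\<Oplus>\<^bsub>T\<^esub>i\<in>J. collapse \<phi> (g i))"
  by (rule additive_finsum[OF W_abelian T_abelian]) simp_all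

lemma collapse_ract:
  assumes "U \<in> carrier W" "r \<in> carrier R"
  shows "collapse \<phi> (ract W U r) = collapse \<phi> U \<cdot>\<^sub>r r"
  using assms(1) by (induction U rule: W_induct) (use assms(2) in \<open>simp_all add: T.lact_ract\<close>)

lemma collapse_lact:
  assumes "U \<in> carrier W" "r \<in> carrier R"
  shows "collapse \<phi> (lact W r U) = collapse (\<lambda>x. \<phi> (r \<otimes> x)) U"
proof -
  have r: "right_linear (\<lambda>x. \<phi> (r \<otimes> x))"
    using right_linear_comp[OF \<phi> right_linear_left_mult] assms(2) by simp
  note e = St.XX.lift_pure[OF T_abelian bal_collapse[OF r], folded collapse_def]
    St.XX.lift_add[OF T_abelian bal_collapse[OF r], folded collapse_def]
  show ?thesis
    using assms(1) by (induction U rule: W_induct) (use assms(2) in \<open>simp_all add: e contract_lact\<close>)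
qed

text \<open>Left multiplication by c \<otimes> d in the tensor square becomes a change of
  functional, which absorbs \<open>c\<close>, followed by the endomorphism of \<open>d\<close>; the
  latter is left M-linear and so commutes with the contracted coefficient.\<close>

lemma collapse_left_mult2:
  assumes "c \<in> carrier B" "d \<in> carrier B" "U \<in> carrier W"
  shows "collapse \<phi> (St.left_mult2 c d U) = bimod_end d (collapse (\<lambda>x. contract \<phi> (x \<cdot>\<^sub>l c)) U)"
proof -
  note r = right_linear_contract[OF \<phi> assms(1)]
  note e = St.XX.lift_pure[OF T_abelian bal_collapse[OF r], folded collapse_def]
    St.XX.lift_add[OF T_abelian bal_collapse[OF r], folded collapse_def]
    St.XX.lift_closed[OF T_abelian bal_collapse[OF r], folded collapse_def]
  show ?thesis
    using assms(3) by (induction U rule: W_induct)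
      (use assms(1,2) in \<open>simp_all add: e contract_bimod_end contract_closed[OF r]\<close>)
qed

end

lemma collapse_\<beta>_B [simp]:
  assumes "i \<in> I" "U \<in> carrier W"
  shows "collapse (\<beta> i) U \<in> carrier B"
  using assms(2) by (induction U rule: W_induct) (use assms(1) in simp_all)

text \<open>Hence an element \<open>U\<close> of \<open>B \<otimes> B\<close> is determined by the elements \<open>collapse (\<beta> k) U\<close> of \<open>M \<otimes> M\<close>.\<close>

lemma collapse_expand:
  assumes "U \<in> carrier W"
  shows "(\<Oplus>\<^bsub>W\<^esub>k\<in>I. b k \<diamondop> collapse (\<beta> k) U) = U"
  using assms
proof (induction U rule: W_induct)
  case (pure c d)
  \<comment> \<open>The coefficient \<open>contract (\<beta> k) c\<close> lies in R and may cross
    the tensor sign; what remains is \<open>quasibasis_expand\<close> in the first factor.\<close>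
  have "(\<Oplus>\<^bsub>W\<^esub>k\<in>I. b k \<diamondop> collapse (\<beta> k) (c \<diamondop> d)) = (\<Oplus>\<^bsub>W\<^esub>k\<in>I. (b k \<cdot>\<^sub>r contract (\<beta> k) c) \<diamondop> d)"
    by (rule St.XX.T.finsum_cong') (use pure in \<open>auto simp: pB_balanced\<close>)
  also have "\<dots> = (\<Oplus>\<^bsub>B\<^esub>k\<in>I. b k \<cdot>\<^sub>r contract (\<beta> k) c) \<diamondop> d"
    by (rule additive_finsum[symmetric, OF B.abelian_group_axioms W_abelian])
      (use pure in \<open>simp_all add: pB_add\<close>)
  finally show ?case using pure by (simp add: finsum_B quasibasis_expand)
next
  case (add U V)
  have "(\<Oplus>\<^bsub>W\<^esub>k\<in>I. b k \<diamondop> collapse (\<beta> k) (U \<oplus>\<^bsub>W\<^esub> V))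
      = (\<Oplus>\<^bsub>W\<^esub>k\<in>I. b k \<diamondop> collapse (\<beta> k) U \<oplus>\<^bsub>W\<^esub> b k \<diamondop> collapse (\<beta> k) V)"
    by (rule St.XX.T.finsum_cong') (use add in \<open>auto simp: pB_add\<close>)
  also have "\<dots> = (\<Oplus>\<^bsub>W\<^esub>k\<in>I. b k \<diamondop> collapse (\<beta> k) U) \<oplus>\<^bsub>W\<^esub> (\<Oplus>\<^bsub>W\<^esub>k\<in>I. b k \<diamondop> collapse (\<beta> k) V)"
    by (rule St.XX.T.finsum_addf) (use add in auto)
  finally show ?case using add by simp
qed

lemma collapse_eqI:
  assumes "U \<in> carrier W" "V \<in> carrier W"
    and "\<And>\<phi>. right_linear \<phi> \<Longrightarrow> collapse \<phi> U = collapse \<phi> V"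
  shows "U = V"
proof -
  have "(\<Oplus>\<^bsub>W\<^esub>k\<in>I. b k \<diamondop> collapse (\<beta> k) U) = (\<Oplus>\<^bsub>W\<^esub>k\<in>I. b k \<diamondop> collapse (\<beta> k) V)"
    by (rule St.XX.T.finsum_cong') (use assms in auto)
  then show ?thesis by (simp only: collapse_expand assms(1,2))
qed

section \<open>The comultiplication\<close>

abbreviation "\<Delta> \<equiv> D2_comult N M f I b \<beta>"

lemma comult_eq: "\<Delta> c = (\<Oplus>\<^bsub>W\<^esub>i\<in>I. b i \<diamondop> apply_left (\<beta> i) c)"
  by (simp add: D2_comult_def Let_def apply_left_def St.square_simps)

lemma comult_closed [simp]: "c \<in> carrier B \<Longrightarrow> \<Delta> c \<in> carrier W"
  unfolding comult_eq by (rule St.XX.T.finsum_closed) auto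

text \<open>Collapsing term by term yields the sum of \<open>apply_left_quasibasis\<close>; its
  value no longer mentions the quasibasis.\<close>

lemma collapse_comult:
  assumes "right_linear \<phi>" "c \<in> carrier B"
  shows "collapse \<phi> (\<Delta> c) = apply_left \<phi> c"
proof -
  have "collapse \<phi> (\<Delta> c) = (\<Oplus>\<^bsub>T\<^esub>i\<in>I. collapse \<phi> (b i \<diamondop> apply_left (\<beta> i) c))"
    unfolding comult_eq by (rule collapse_finsum) (use assms in auto)
  also have "\<dots> = (\<Oplus>\<^bsub>T\<^esub>i\<in>I. contract \<phi> (b i) \<cdot>\<^sub>l apply_left (\<beta> i) c)"
    by (rule T.X.finsum_cong') (use assms in auto)
  finally show ?thesis using assms by (simp add: apply_left_quasibasis)
qed

text \<open>This characterizes \<Delta> without its defining sum: a law for \<Delta> follows once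
  the proposed value collapses correctly along every \<phi>.\<close>

lemma comult_unique:
  assumes "U \<in> carrier W" "c \<in> carrier B"
    and "\<And>\<phi>. right_linear \<phi> \<Longrightarrow> collapse \<phi> U = apply_left \<phi> c"
  shows "U = \<Delta> c"
  by (rule collapse_eqI) (simp_all add: assms collapse_comult)

lemma comult_add: "\<lbrakk>c \<in> carrier B; d \<in> carrier B\<rbrakk> \<Longrightarrow> \<Delta> (c \<oplus>\<^bsub>T\<^esub> d) = \<Delta> c \<oplus>\<^bsub>W\<^esub> \<Delta> d"
  by (rule comult_unique[symmetric]) (simp_all add: collapse_comult)

lemma comult_lact: "\<lbrakk>r \<in> carrier R; c \<in> carrier B\<rbrakk> \<Longrightarrow> \<Delta> (r \<cdot>\<^sub>l c) = lact W r (\<Delta> c)"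
  by (rule comult_unique[symmetric])
    (simp_all add: collapse_lact collapse_comult apply_left_lact right_linear_comp right_linear_left_mult)

lemma comult_ract: "\<lbrakk>r \<in> carrier R; c \<in> carrier B\<rbrakk> \<Longrightarrow> \<Delta> (c \<cdot>\<^sub>r r) = ract W (\<Delta> c) r"
  by (rule comult_unique[symmetric]) (simp_all add: collapse_ract collapse_comult)

lemma comult_one: "\<Delta> (\<one> \<boxdot> \<one>) = (\<one> \<boxdot> \<one>) \<diamondop> (\<one> \<boxdot> \<one>)"
  by (rule comult_unique[symmetric]) (simp_all add: right_linearD)

lemma comult_hom: "\<Delta> \<in> bimodule_hom R R X W"
  by (simp add: bimodule_hom_def comult_add comult_lact comult_ract)

text \<open>Both sides collapse along \<phi> to the image of \<open>c\<close> under x \<otimes> y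
  \<mapsto> \<phi>(x) r \<otimes> y: in one case r enters through the functional, in the other
  through \<open>bimod_end (t r)\<close>.\<close>

lemma comult_takeuchi: "c \<in> carrier B \<Longrightarrow> \<Delta> c \<in> carrier St.TP"
proof -
  assume c: "c \<in> carrier B"
  have "St.left_mult2 (s r) (\<one> \<boxdot> \<one>) (\<Delta> c) = St.left_mult2 (\<one> \<boxdot> \<one>) (t r) (\<Delta> c)"
    if r: "r \<in> carrier R" for r
  proof -
    have e: "collapse \<phi> (St.left_mult2 (s r) (\<one> \<boxdot> \<one>) (\<Delta> c))
        = collapse \<phi> (St.left_mult2 (\<one> \<boxdot> \<one>) (t r) (\<Delta> c))" if \<phi>: "right_linear \<phi>" for \<phi>
    proof -
      have 1: "right_linear (\<lambda>x. contract \<phi> (x \<cdot>\<^sub>l s r))" "right_linear (\<lambda>x. contract \<phi> (x \<cdot>\<^sub>l (\<one> \<boxdot> \<one>)))"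
        by (rule right_linear_contract[OF \<phi>]; use r in simp)+
      have st: "s r = \<one> \<boxdot> r" "t r = r \<boxdot> \<one>" by (simp_all add: source_eq target_eq)
      have "apply_left (\<lambda>x. contract \<phi> (x \<cdot>\<^sub>l s r)) u
          = bimod_end (t r) (apply_left (\<lambda>x. contract \<phi> (x \<cdot>\<^sub>l (\<one> \<boxdot> \<one>))) u)" if "u \<in> carrier T" for u
        using that by (induction u rule: ext_tensor_induct)
          (use 1 \<phi> r in \<open>simp_all add: st right_linearD\<close>)
      then show ?thesis
        using 1 \<phi> r c by (simp add: collapse_left_mult2 collapse_comult bimod_end_one)
    qed
    show ?thesis
      by (rule collapse_eqI[OF _ _ e]) (use r c in simp_all)
  qed
  then show ?thesis using c by (simp add: St.takeuchi_simps(1))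
qed

text \<open>Collapsing the product gives a sum over i in which \<open>b i\<close> sits inside the
  functional applied to \<open>d\<close> and \<beta> i acts on \<open>c\<close>. Replacing
  \<open>d\<close> by x \<otimes> y, the sum over i is \<open>apply_left_quasibasis\<close> for z
  \<mapsto> \<phi>(x z), and the result is \<open>apply_left \<phi>\<close> of x c y.\<close>

lemma comult_mult:
  assumes c: "c \<in> carrier B" and d: "d \<in> carrier B"
  shows "\<Delta> (bimod_end c d) = \<Delta> c \<otimes>\<^bsub>St.TP\<^esub> \<Delta> d"
proof (rule comult_unique[symmetric])
  let ?c = "\<lambda>i. apply_left (\<beta> i) c"
  note V = comult_takeuchi[OF d]
  show "\<Delta> c \<otimes>\<^bsub>St.TP\<^esub> \<Delta> d \<in> carrier W" "bimod_end c d \<in> carrier B"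
    using c d by (simp_all add: St.takeuchi_mult(3)[OF V])
  fix \<phi> assume \<phi>: "right_linear \<phi>"
  have \<psi>: "right_linear (\<lambda>x. contract \<phi> (x \<cdot>\<^sub>l b i))" if "i \<in> I" for i
    using that by (intro right_linear_contract[OF \<phi>]) simp
  have "\<Delta> c \<otimes>\<^bsub>St.TP\<^esub> \<Delta> d = (\<Oplus>\<^bsub>W\<^esub>i\<in>I. b i \<diamondop> ?c i) \<otimes>\<^bsub>St.TP\<^esub> \<Delta> d"
    by (simp only: comult_eq)
  also have "\<dots> = (\<Oplus>\<^bsub>W\<^esub>i\<in>I. (b i \<diamondop> ?c i) \<otimes>\<^bsub>St.TP\<^esub> \<Delta> d)"
    by (rule additive_finsum[OF W_abelian W_abelian]) (use c St.takeuchi_mult[OF V] in simp_all)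
  also have "\<dots> = (\<Oplus>\<^bsub>W\<^esub>i\<in>I. St.left_mult2 (b i) (?c i) (\<Delta> d))"
    by (rule St.XX.T.finsum_cong') (use c d St.takeuchi_mult(1)[OF V] in auto)
  finally have "collapse \<phi> (\<Delta> c \<otimes>\<^bsub>St.TP\<^esub> \<Delta> d)
      = (\<Oplus>\<^bsub>T\<^esub>i\<in>I. collapse \<phi> (St.left_mult2 (b i) (?c i) (\<Delta> d)))"
    using c d by (simp add: collapse_finsum[OF \<phi>])
  also have "\<dots> = (\<Oplus>\<^bsub>T\<^esub>i\<in>I. bimod_end (?c i) (apply_left (\<lambda>x. contract \<phi> (x \<cdot>\<^sub>l b i)) d))"
    by (rule T.X.finsum_cong')
      (use c d collapse_left_mult2[OF \<phi>] collapse_comult[OF \<psi>] apply_left_closed[OF \<psi>] in auto)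
  also have "\<dots> = apply_left \<phi> (bimod_end c d)"
  proof -
    \<comment> \<open>\<open>d\<close> is generalized to all of M \<otimes> M, since the pure
      tensors of the induction need not lie in B.\<close>
    have "(\<Oplus>\<^bsub>T\<^esub>i\<in>I. bimod_end (?c i) (apply_left (\<lambda>x. contract \<phi> (x \<cdot>\<^sub>l b i)) u))
        = apply_left \<phi> (bimod_end c u)" if "u \<in> carrier T" for u
      using that
    proof (induction u rule: ext_tensor_induct)
      case (pure x y)
      have \<phi>x: "right_linear (\<lambda>z. \<phi> (x \<otimes> z))"
        using right_linear_comp[OF \<phi> right_linear_left_mult] pure by simp
      have "(\<Oplus>\<^bsub>T\<^esub>i\<in>I. bimod_end (?c i) (apply_left (\<lambda>x. contract \<phi> (x \<cdot>\<^sub>l b i)) (x \<boxdot> y)))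
          = (\<Oplus>\<^bsub>T\<^esub>i\<in>I. (contract (\<lambda>z. \<phi> (x \<otimes> z)) (b i) \<cdot>\<^sub>l ?c i) \<cdot>\<^sub>r y)"
        by (rule T.X.finsum_cong')
          (use pure c \<phi> \<phi>x apply_left_pt[OF \<psi>] contract_lact[OF \<phi>, symmetric] contract_closed[OF \<phi>] in auto)
      also have "\<dots> = (\<Oplus>\<^bsub>T\<^esub>i\<in>I. contract (\<lambda>z. \<phi> (x \<otimes> z)) (b i) \<cdot>\<^sub>l ?c i) \<cdot>\<^sub>r y"
        by (rule additive_finsum[symmetric, OF T_abelian T_abelian])
          (use pure c contract_closed[OF \<phi>x] in simp_all)
      also have "\<dots> = apply_left (\<lambda>z. \<phi> (x \<otimes> z)) c \<cdot>\<^sub>r y"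
        using c by (simp add: apply_left_quasibasis[OF \<phi>x])
      finally show ?case using pure c \<phi> by (simp add: apply_left_lact)
    next
      case (add u v)
      have "(\<Oplus>\<^bsub>T\<^esub>i\<in>I. bimod_end (?c i) (apply_left (\<lambda>x. contract \<phi> (x \<cdot>\<^sub>l b i)) (u \<oplus>\<^bsub>T\<^esub> v)))
        = (\<Oplus>\<^bsub>T\<^esub>i\<in>I. bimod_end (?c i) (apply_left (\<lambda>x. contract \<phi> (x \<cdot>\<^sub>l b i)) u)
            \<oplus>\<^bsub>T\<^esub> bimod_end (?c i) (apply_left (\<lambda>x. contract \<phi> (x \<cdot>\<^sub>l b i)) v))"
        by (rule T.X.finsum_cong')
          (use add c apply_left_add[OF \<psi>] apply_left_closed[OF \<psi>] in auto)
      also have "\<dots> = (\<Oplus>\<^bsub>T\<^esub>i\<in>I. bimod_end (?c i) (apply_left (\<lambda>x. contract \<phi> (x \<cdot>\<^sub>l b i)) u))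
          \<oplus>\<^bsub>T\<^esub> (\<Oplus>\<^bsub>T\<^esub>i\<in>I. bimod_end (?c i) (apply_left (\<lambda>x. contract \<phi> (x \<cdot>\<^sub>l b i)) v))"
        by (rule T.X.finsum_addf) (use add c apply_left_closed[OF \<psi>] in auto)
      finally show ?case using add c \<phi> by simp
    qed
    then show ?thesis using d by simp
  qed
  finally show "collapse \<phi> (\<Delta> c \<otimes>\<^bsub>St.TP\<^esub> \<Delta> d) = apply_left \<phi> (bimod_end c d)" .
qed

lemma comult_ring_hom: "ring_hom_ring B St.TP \<Delta>"
proof -
  have "\<Delta> \<in> ring_hom B St.TP"
    by (rule ring_hom_memI)
      (simp_all add: comult_takeuchi comult_mult comult_add comult_one St.takeuchi_simps(3,5))
  then show ?thesis
    by (simp add: ring_hom_ring_def ring_hom_ring_axioms_def ring_B St.ring_takeuchi)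
qed

sublocale Tri: tensor_triple R R R R X X X
  by (simp add: tensor_triple_def tensor_product_def St.bimodule_X)

text \<open>With \<open>?c i\<close> for the second factors of \<Delta>(c), the left side expands to
  the double sum of b j \<otimes> (\<open>apply_left (\<beta> j) (b i)\<close> \<otimes>
  \<open>?c i\<close>), the right side to the sum of b j \<otimes> \<Delta>(\<open>?c j\<close>).
  The claim thus reduces to one identity in B \<otimes> B for each j.\<close>

lemma comult_coassoc:
  assumes c: "c \<in> carrier B"
  shows "tensor_assoc R R X X X (tensor_map R W X \<Delta> (\<lambda>a. a) (\<Delta> c)) = tensor_map R X W (\<lambda>a. a) \<Delta> (\<Delta> c)"
proof -
  let ?c = "\<lambda>i. apply_left (\<beta> i) c"
  let ?L = "Tri.XY_Z.T" and ?R = "Tri.X_YZ.T"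
  have L: "abelian_group ?L" and R: "abelian_group ?R"
    by (rule Tri.XY_Z.abelian_group_tensor Tri.X_YZ.abelian_group_tensor)+
  note Ls = Tri.XY_Z.pure_closed Tri.XY_Z.pure_add_left Tri.XY_Z.pure_add_right Tri.XY_Z.pure_balanced
  note Rs = Tri.X_YZ.pure_closed Tri.X_YZ.pure_add_left Tri.X_YZ.pure_add_right Tri.X_YZ.pure_balanced
  \<comment> \<open>The two tensor maps are well defined because \<Delta> is R-linear: on the right
    for this one, on the left for \<open>bR\<close>.\<close>
  have bL: "balanced_map R X X ?L (\<lambda>x y. pure_tensor R W X (\<Delta> x) y)"
    by (rule balanced_mapI)
      (use Tri.XY_Z.pure_balanced[of "\<Delta> _"] in \<open>simp_all add: Ls Ls(2,3)[simplified] comult_add comult_ract\<close>)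
  have bR: "balanced_map R X X ?R (\<lambda>x y. pure_tensor R X W x (\<Delta> y))"
    by (rule balanced_mapI)
      (use Tri.X_YZ.pure_balanced[of _ _ "\<Delta> _"] in \<open>simp_all add: Rs Rs(2,3)[simplified] comult_add comult_lact\<close>)
  have "tensor_map R W X \<Delta> (\<lambda>a. a) (\<Delta> c)
      = (\<Oplus>\<^bsub>?L\<^esub>i\<in>I. tensor_map R W X \<Delta> (\<lambda>a. a) (b i \<diamondop> ?c i))"
    unfolding comult_eq[of c] tensor_map_def
    by (rule St.XX.lift_finsum[OF L bL]) (use c in simp)
  also have "\<dots> = (\<Oplus>\<^bsub>?L\<^esub>i\<in>I. pure_tensor R W X (\<Delta> (b i)) (?c i))"
    unfolding tensor_map_def
    by (rule Tri.XY_Z.T.finsum_cong') (use c St.XX.lift_pure[OF L bL] Ls(1) in auto)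
  finally have "tensor_assoc R R X X X (tensor_map R W X \<Delta> (\<lambda>a. a) (\<Delta> c))
      = tensor_lift ?R Tri.assoc_slice (\<Oplus>\<^bsub>?L\<^esub>i\<in>I. pure_tensor R W X (\<Delta> (b i)) (?c i))"
    by (simp only: Tri.tensor_assoc_eq)
  also have "\<dots> = (\<Oplus>\<^bsub>?R\<^esub>i\<in>I. tensor_lift ?R Tri.assoc_slice (pure_tensor R W X (\<Delta> (b i)) (?c i)))"
    by (rule Tri.XY_Z.lift_finsum[OF R Tri.balanced_assoc]) (use c Ls(1) in simp)
  also have "\<dots> = (\<Oplus>\<^bsub>?R\<^esub>i\<in>I. \<Oplus>\<^bsub>?R\<^esub>j\<in>I. pure_tensor R X W (b j) (apply_left (\<beta> j) (b i) \<diamondop> ?c i))"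
  proof (rule Tri.X_YZ.T.finsum_cong'[OF refl])
    fix i assume i: "i \<in> I"
    have "tensor_lift ?R Tri.assoc_slice (pure_tensor R W X (\<Delta> (b i)) (?c i)) = Tri.assoc_slice (\<Delta> (b i)) (?c i)"
      using Tri.XY_Z.lift_pure[OF R Tri.balanced_assoc, of "\<Delta> (b i)" "?c i"] i c by simp
    also have "\<dots> = (\<Oplus>\<^bsub>?R\<^esub>j\<in>I. Tri.assoc_slice (b j \<diamondop> apply_left (\<beta> j) (b i)) (?c i))"
      unfolding comult_eq by (rule St.XX.lift_finsum[OF R Tri.balanced_assoc_inner]) (use i c in simp_all)
    also have "\<dots> = (\<Oplus>\<^bsub>?R\<^esub>j\<in>I. pure_tensor R X W (b j) (apply_left (\<beta> j) (b i) \<diamondop> ?c i))"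
      by (rule Tri.X_YZ.T.finsum_cong')
        (use i c St.XX.lift_pure[OF R Tri.balanced_assoc_inner[of "?c i"]] Rs(1) in auto)
    finally show "tensor_lift ?R Tri.assoc_slice (pure_tensor R W X (\<Delta> (b i)) (?c i)) = \<dots>" .
  qed (use c Rs(1) in \<open>auto intro!: Tri.X_YZ.T.finsum_closed\<close>)
  also have "\<dots> = (\<Oplus>\<^bsub>?R\<^esub>j\<in>I. \<Oplus>\<^bsub>?R\<^esub>i\<in>I. pure_tensor R X W (b j) (apply_left (\<beta> j) (b i) \<diamondop> ?c i))"
    by (rule Tri.X_YZ.T.finsum_swap) (use c Rs(1) in auto)
  also have "\<dots> = (\<Oplus>\<^bsub>?R\<^esub>j\<in>I. pure_tensor R X W (b j) (\<Delta> (?c j)))"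
  proof (rule Tri.X_YZ.T.finsum_cong'[OF refl])
    fix j assume j: "j \<in> I"
    \<comment> \<open>The left side is not the defining sum of the right side. Collapsed along
      \<phi> it becomes the sum of \<open>apply_left_quasibasis\<close> for \<phi> \<circ> \<beta>
      j, and \<open>comult_unique\<close> concludes.\<close>
    have "(\<Oplus>\<^bsub>W\<^esub>i\<in>I. apply_left (\<beta> j) (b i) \<diamondop> ?c i) = \<Delta> (?c j)"
    proof (rule comult_unique)
      fix \<phi> assume \<phi>: "right_linear \<phi>"
      note \<phi>j = right_linear_comp[OF \<phi> right_linear_\<beta>[OF j]]
      have "collapse \<phi> (\<Oplus>\<^bsub>W\<^esub>i\<in>I. apply_left (\<beta> j) (b i) \<diamondop> ?c i)
          = (\<Oplus>\<^bsub>T\<^esub>i\<in>I. collapse \<phi> (apply_left (\<beta> j) (b i) \<diamondop> ?c i))"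
        by (rule collapse_finsum[OF \<phi>]) (use j c in simp)
      also have "\<dots> = (\<Oplus>\<^bsub>T\<^esub>i\<in>I. contract (\<lambda>x. \<phi> (\<beta> j x)) (b i) \<cdot>\<^sub>l ?c i)"
        by (rule T.X.finsum_cong') (use j c \<phi> contract_closed[OF \<phi>j] in \<open>auto simp: contract_apply_left\<close>)
      also have "\<dots> = apply_left \<phi> (?c j)"
        using apply_left_quasibasis[OF \<phi>j, of c] apply_left_apply_left[OF \<phi>, of "\<beta> j" c] j c by simp
      finally show "collapse \<phi> (\<Oplus>\<^bsub>W\<^esub>i\<in>I. apply_left (\<beta> j) (b i) \<diamondop> ?c i) = apply_left \<phi> (?c j)" .
    qed (use j c in \<open>auto intro!: St.XX.T.finsum_closed\<close>)
    moreover have "(\<Oplus>\<^bsub>?R\<^esub>i\<in>I. pure_tensor R X W (b j) (apply_left (\<beta> j) (b i) \<diamondop> ?c i))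
        = pure_tensor R X W (b j) (\<Oplus>\<^bsub>W\<^esub>i\<in>I. apply_left (\<beta> j) (b i) \<diamondop> ?c i)"
      by (rule additive_finsum[symmetric, OF W_abelian R]) (use j c Rs in simp_all)
    ultimately show "(\<Oplus>\<^bsub>?R\<^esub>i\<in>I. pure_tensor R X W (b j) (apply_left (\<beta> j) (b i) \<diamondop> ?c i))
        = pure_tensor R X W (b j) (\<Delta> (?c j))" by simp
  qed (use c Rs(1) in auto)
  also have "\<dots> = (\<Oplus>\<^bsub>?R\<^esub>j\<in>I. tensor_map R X W (\<lambda>a. a) \<Delta> (b j \<diamondop> ?c j))"
    unfolding tensor_map_def
    by (rule Tri.X_YZ.T.finsum_cong') (use c St.XX.lift_pure[OF R bR] Rs(1) in auto)
  also have "\<dots> = tensor_map R X W (\<lambda>a. a) \<Delta> (\<Delta> c)"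
    unfolding comult_eq[of c] tensor_map_def
    by (rule St.XX.lift_finsum[symmetric, OF R bR]) (use c in simp)
  finally show ?thesis .
qed

section \<open>The counit\<close>

abbreviation "\<epsilon> \<equiv> D2_counit M"

lemma counit_eq: "\<epsilon> = contract (\<lambda>x. x)"
  by (simp add: D2_counit_def contract_def fun_eq_iff)

lemma counit_pt [simp]: "\<lbrakk>x \<in> carrier M; y \<in> carrier M\<rbrakk> \<Longrightarrow> \<epsilon> (x \<boxdot> y) = x \<otimes> y"
  and counit_M [simp]: "u \<in> carrier T \<Longrightarrow> \<epsilon> u \<in> carrier M"
  and counit_add [simp]: "\<lbrakk>u \<in> carrier T; v \<in> carrier T\<rbrakk> \<Longrightarrow> \<epsilon> (u \<oplus>\<^bsub>T\<^esub> v) = \<epsilon> u \<oplus> \<epsilon> v"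
  and counit_ract [simp]: "\<lbrakk>u \<in> carrier T; m \<in> carrier M\<rbrakk> \<Longrightarrow> \<epsilon> (u \<cdot>\<^sub>r m) = \<epsilon> u \<otimes> m"
  by (simp_all add: counit_eq)

lemma counit_lact [simp]:
  assumes "u \<in> carrier T" "m \<in> carrier M"
  shows "\<epsilon> (m \<cdot>\<^sub>l u) = m \<otimes> \<epsilon> u"
  using assms(1) by (induction u rule: ext_tensor_induct)
    (use assms(2) in \<open>simp_all add: M.m_assoc M.r_distr\<close>)

lemma counit_R [simp]: "c \<in> carrier B \<Longrightarrow> \<epsilon> c \<in> carrier R"
  by (simp add: counit_eq contract_R)

lemma counit_source_target [simp]: "r \<in> carrier R \<Longrightarrow> \<epsilon> (s r) = r" "r \<in> carrier R \<Longrightarrow> \<epsilon> (t r) = r"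
  by (simp_all add: source_eq target_eq)

text \<open>At x \<otimes> y the value is x \<epsilon>(c) y, so only \<epsilon>(c) matters. Since
  s(\<epsilon>(c)) and t(\<epsilon>(c)) have the same counit as c, both multiplicative counit axioms
  follow.\<close>

lemma counit_bimod_end:
  assumes "c \<in> carrier B" "u \<in> carrier T" "c' \<in> carrier B" "\<epsilon> c = \<epsilon> c'"
  shows "\<epsilon> (bimod_end c u) = \<epsilon> (bimod_end c' u)"
  using assms(2) by (induction u rule: ext_tensor_induct) (use assms(1,3,4) in simp_all)

text \<open>This is \<open>apply_left_quasibasis\<close> for the identity functional.\<close>

lemma counit_left_comult:
  assumes c: "c \<in> carrier B"
  shows "tensor_lift B (\<lambda>a a'. lact X (\<epsilon> a) a') (\<Delta> c) = c"
proof -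
  have bal: "balanced_map R X X B (\<lambda>a a'. lact X (\<epsilon> a) a')"
    by (rule balanced_mapI) (simp_all add: T.add_lact T.mult_lact)
  have "tensor_lift B (\<lambda>a a'. lact X (\<epsilon> a) a') (\<Delta> c)
      = (\<Oplus>\<^bsub>B\<^esub>i\<in>I. tensor_lift B (\<lambda>a a'. lact X (\<epsilon> a) a') (b i \<diamondop> apply_left (\<beta> i) c))"
    unfolding comult_eq by (rule St.XX.lift_finsum[OF B.abelian_group_axioms bal]) (use c in simp)
  also have "\<dots> = (\<Oplus>\<^bsub>B\<^esub>i\<in>I. \<epsilon> (b i) \<cdot>\<^sub>l apply_left (\<beta> i) c)"
    by (rule B.finsum_cong') (use c St.XX.lift_pure[OF B.abelian_group_axioms bal] in auto)
  also have "\<dots> = apply_left (\<lambda>x. x) c"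
    using c apply_left_quasibasis[OF right_linear_id, of c] by (simp add: finsum_B counit_eq[symmetric])
  also have "\<dots> = c"
  proof -
    have "apply_left (\<lambda>x. x) u = u" if "u \<in> carrier T" for u
      using that by (induction u rule: ext_tensor_induct) simp_all
    then show ?thesis using c by simp
  qed
  finally show ?thesis .
qed

text \<open>The counit after \<open>apply_left (\<beta> i)\<close> is
  \<open>contract (\<beta> i)\<close>, so this is \<open>quasibasis_expand\<close>.\<close>

lemma counit_right_comult:
  assumes c: "c \<in> carrier B"
  shows "tensor_lift B (\<lambda>a a'. ract X a (\<epsilon> a')) (\<Delta> c) = c"
proof -
  have bal: "balanced_map R X X B (\<lambda>a a'. ract X a (\<epsilon> a'))"
    by (rule balanced_mapI) (simp_all add: T.add_ract T.mult_ract)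
  have "tensor_lift B (\<lambda>a a'. ract X a (\<epsilon> a')) (\<Delta> c)
      = (\<Oplus>\<^bsub>B\<^esub>i\<in>I. tensor_lift B (\<lambda>a a'. ract X a (\<epsilon> a')) (b i \<diamondop> apply_left (\<beta> i) c))"
    unfolding comult_eq by (rule St.XX.lift_finsum[OF B.abelian_group_axioms bal]) (use c in simp)
  also have "\<dots> = (\<Oplus>\<^bsub>B\<^esub>i\<in>I. b i \<cdot>\<^sub>r contract (\<beta> i) c)"
    by (rule B.finsum_cong') (use c St.XX.lift_pure[OF B.abelian_group_axioms bal]
        contract_apply_left[OF right_linear_id right_linear_\<beta>] in \<open>auto simp: counit_eq\<close>)
  also have "\<dots> = c"
    using c by (simp add: finsum_B quasibasis_expand)
  finally show ?thesis .
qed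

lemma counit_hom: "\<epsilon> \<in> bimodule_hom R R X (regular_bimodule R)"
  by (simp add: bimodule_hom_def regular_bimodule_def)

theorem right_bialgebroid: "right_bialgebroid R B s t \<Delta> \<epsilon>"
proof (intro right_bialgebroid.intro right_bialgebroid_axioms.intro ring_R ring_B)
  show "\<epsilon> (t (\<epsilon> c) \<otimes>\<^bsub>B\<^esub> d) = \<epsilon> (c \<otimes>\<^bsub>B\<^esub> d)" "\<epsilon> (s (\<epsilon> c) \<otimes>\<^bsub>B\<^esub> d) = \<epsilon> (c \<otimes>\<^bsub>B\<^esub> d)"
    if "c \<in> carrier B" "d \<in> carrier B" for c d
    using that counit_bimod_end[of "t (\<epsilon> c)" d c] counit_bimod_end[of "s (\<epsilon> c)" d c] by simp_all
qed (use St.source_hom St.target_hom St.source_target St.bimodule_X comult_hom counit_hom comult_coassoc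
    counit_left_comult counit_right_comult comult_ring_hom in \<open>simp_all add: St.square_simps Let_def\<close>)

end

section \<open>The module algebroid of endomorphisms\<close>

context ring_extension begin

abbreviation "E \<equiv> left_End N M f"
abbreviation act (infixl \<open>\<triangleleft>\<close> 72) where "\<xi> \<triangleleft> c \<equiv> End_action M \<xi> c"

lemma mem_E:
  "\<xi> \<in> carrier E \<longleftrightarrow> \<xi> \<in> extensional (carrier M)
    \<and> (\<forall>x\<in>carrier M. \<xi> x \<in> carrier M)
    \<and> (\<forall>x\<in>carrier M. \<forall>y\<in>carrier M. \<xi> (x \<oplus> y) = \<xi> x \<oplus> \<xi> y)
    \<and> (\<forall>n\<in>carrier N. \<forall>x\<in>carrier M. \<xi> (f n \<otimes> x) = f n \<otimes> \<xi> x)"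
  by (auto simp: left_End_def PiE_def)

lemma E_simps [simp]:
  "\<xi> \<otimes>\<^bsub>E\<^esub> \<eta> = compose (carrier M) \<xi> \<eta>" "\<one>\<^bsub>E\<^esub> = (\<lambda>x\<in>carrier M. x)"
  "\<zero>\<^bsub>E\<^esub> = (\<lambda>x\<in>carrier M. \<zero>)" "\<xi> \<oplus>\<^bsub>E\<^esub> \<eta> = (\<lambda>x\<in>carrier M. \<xi> x \<oplus> \<eta> x)"
  by (simp_all add: left_End_def)

lemma E_closed [simp]: "\<lbrakk>\<xi> \<in> carrier E; x \<in> carrier M\<rbrakk> \<Longrightarrow> \<xi> x \<in> carrier M"
  and E_add: "\<lbrakk>\<xi> \<in> carrier E; x \<in> carrier M; y \<in> carrier M\<rbrakk> \<Longrightarrow> \<xi> (x \<oplus> y) = \<xi> x \<oplus> \<xi> y"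
  and E_lin: "\<lbrakk>\<xi> \<in> carrier E; n \<in> carrier N; x \<in> carrier M\<rbrakk> \<Longrightarrow> \<xi> (f n \<otimes> x) = f n \<otimes> \<xi> x"
  by (simp_all add: mem_E)

lemma E_eqI:
  assumes "\<xi> \<in> carrier E" "\<eta> \<in> carrier E" "\<And>x. x \<in> carrier M \<Longrightarrow> \<xi> x = \<eta> x"
  shows "\<xi> = \<eta>"
  using assms by (auto simp: mem_E intro: extensionalityI)

lemma E_compose: "\<lbrakk>\<xi> \<in> carrier E; \<eta> \<in> carrier E\<rbrakk> \<Longrightarrow> compose (carrier M) \<xi> \<eta> \<in> carrier E"
  by (simp add: mem_E compose_def)

lemma E_plus: "\<lbrakk>\<xi> \<in> carrier E; \<eta> \<in> carrier E\<rbrakk> \<Longrightarrow> (\<lambda>x\<in>carrier M. \<xi> x \<oplus> \<eta> x) \<in> carrier E"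
  unfolding mem_E[of "\<lambda>x\<in>carrier M. _ x"] by (simp add: E_add E_lin M.add.m_ac M.r_distr)

lemma ring_E: "ring E"
proof (rule ringI)
  show "abelian_group E"
  proof (rule abelian_groupI)
    fix \<xi> assume \<xi>: "\<xi> \<in> carrier E"
    show "\<exists>\<eta>\<in>carrier E. \<eta> \<oplus>\<^bsub>E\<^esub> \<xi> = \<zero>\<^bsub>E\<^esub>"
    proof
      show "(\<lambda>x\<in>carrier M. \<ominus> \<xi> x) \<in> carrier E"
        unfolding mem_E[of "\<lambda>x\<in>carrier M. _ x"]
        using \<xi> by (simp add: E_add E_lin M.minus_add M.r_minus M.add.m_comm)
    qed (use \<xi> in \<open>auto simp: M.l_neg\<close>)
    show "\<zero>\<^bsub>E\<^esub> \<oplus>\<^bsub>E\<^esub> \<xi> = \<xi>"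
      using \<xi> by (intro extensionalityI[of _ "carrier M"]) (simp_all add: mem_E)
  qed (auto simp: E_plus M.add.m_ac, simp add: mem_E)
  show "monoid E"
  proof
    fix \<xi> assume \<xi>: "\<xi> \<in> carrier E"
    show "\<one>\<^bsub>E\<^esub> \<otimes>\<^bsub>E\<^esub> \<xi> = \<xi>" "\<xi> \<otimes>\<^bsub>E\<^esub> \<one>\<^bsub>E\<^esub> = \<xi>"
      using \<xi> by (auto intro!: extensionalityI[of _ "carrier M"] simp: mem_E compose_def)
  qed (simp_all add: E_compose, auto simp: compose_def mem_E)
qed (auto simp: compose_def E_add)

sublocale E: ring E by (rule ring_E)

lemma E_finsum_apply:
  assumes "\<And>i. i \<in> J \<Longrightarrow> g i \<in> carrier E" "x \<in> carrier M"
  shows "(\<Oplus>\<^bsub>E\<^esub>i\<in>J. g i) x = (\<Oplus>i\<in>J. g i x)"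
  by (rule additive_finsum[where h="\<lambda>\<xi>. \<xi> x", OF E.abelian_group_axioms M_abelian]) (use assms in auto)

text \<open>The value of the action at a fixed point m, with the tensor as last argument and ranging
  over M \<otimes> M. The lift is balanced because \<xi> is left N-linear.\<close>

definition act_at where "act_at \<xi> m = tensor_lift M (\<lambda>x y. x \<otimes> \<xi> (y \<otimes> m))"

lemma act_apply: "m \<in> carrier M \<Longrightarrow> (\<xi> \<triangleleft> c) m = act_at \<xi> m c"
  by (simp add: End_action_def act_at_def)

lemma bal_act_at:
  assumes "\<xi> \<in> carrier E" "m \<in> carrier M"
  shows "bal M (\<lambda>x y. x \<otimes> \<xi> (y \<otimes> m))"
  by (rule balI) (use assms in \<open>simp_all add: E_add M.l_distr M.r_distr M.m_assoc E_lin\<close>)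

context
  fixes \<xi> m assumes \<xi> [simp]: "\<xi> \<in> carrier E" and m [simp]: "m \<in> carrier M"
begin

lemma act_at_simps [simp]:
  "\<lbrakk>x \<in> carrier M; y \<in> carrier M\<rbrakk> \<Longrightarrow> act_at \<xi> m (x \<boxdot> y) = x \<otimes> \<xi> (y \<otimes> m)"
  "u \<in> carrier T \<Longrightarrow> act_at \<xi> m u \<in> carrier M"
  "\<lbrakk>u \<in> carrier T; v \<in> carrier T\<rbrakk> \<Longrightarrow> act_at \<xi> m (u \<oplus>\<^bsub>T\<^esub> v) = act_at \<xi> m u \<oplus> act_at \<xi> m v"
  by (simp_all add: act_at_def ext_lift_simps[OF M_abelian bal_act_at])

lemma act_at_lact [simp]:
  assumes "x \<in> carrier M" "u \<in> carrier T"
  shows "act_at \<xi> m (x \<cdot>\<^sub>l u) = x \<otimes> act_at \<xi> m u"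
  using assms(2) by (induction u rule: ext_tensor_induct)
    (use assms(1) in \<open>simp_all add: M.m_assoc M.r_distr\<close>)

end

lemma act_at_ract:
  assumes "\<xi> \<in> carrier E" "m \<in> carrier M" "x \<in> carrier M" "u \<in> carrier T"
  shows "act_at \<xi> m (u \<cdot>\<^sub>r x) = act_at \<xi> (x \<otimes> m) u"
  using assms(4) by (induction u rule: ext_tensor_induct)
    (use assms(1-3) in \<open>simp_all add: M.m_assoc\<close>)

lemma act_at_add_point:
  assumes "\<xi> \<in> carrier E" "m \<in> carrier M" "m' \<in> carrier M" "u \<in> carrier T"
  shows "act_at \<xi> (m \<oplus> m') u = act_at \<xi> m u \<oplus> act_at \<xi> m' u"
  using assms(4) by (induction u rule: ext_tensor_induct)
    (use assms(1-3) in \<open>simp_all add: M.r_distr E_add M.add.m_ac\<close>)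

text \<open>For left N-linearity, a factor f(n) at the point moves to the right of \<open>c\<close>
  by \<open>act_at_ract\<close>, passes \<open>c\<close>, and leaves on the left by
  \<open>act_at_lact\<close>.\<close>

lemma act_closed [simp]:
  assumes \<xi>: "\<xi> \<in> carrier E" and c: "c \<in> carrier B"
  shows "\<xi> \<triangleleft> c \<in> carrier E"
proof -
  have "act_at \<xi> (f n \<otimes> m) c = f n \<otimes> act_at \<xi> m c" if "n \<in> carrier N" "m \<in> carrier M" for n m
    using act_at_ract[OF \<xi>, of m "f n" c] act_at_lact[OF \<xi>, of m "f n" c] B_commute[OF c] that c by simp
  moreover have "\<xi> \<triangleleft> c \<in> extensional (carrier M)" by (simp add: End_action_def)
  ultimately show ?thesis
    unfolding mem_E using assms by (simp add: act_apply act_at_add_point)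
qed

text \<open>On x \<otimes> y both sides are x (\<xi> \<triangleleft> c)(y m). For \<open>u\<close>
  in B this is compatibility with products; the order of factors in B is what makes the action a
  right one.\<close>

lemma act_at_bimod_end:
  assumes "\<xi> \<in> carrier E" "c \<in> carrier B" "m \<in> carrier M" "u \<in> carrier T"
  shows "act_at \<xi> m (bimod_end c u) = act_at (\<xi> \<triangleleft> c) m u"
  using assms(4) by (induction u rule: ext_tensor_induct)
    (use assms(1-3) in \<open>simp_all add: act_at_ract act_apply\<close>)

lemma act_at_plus:
  assumes "\<xi> \<in> carrier E" "\<eta> \<in> carrier E" "m \<in> carrier M" "u \<in> carrier T"
  shows "act_at (\<xi> \<oplus>\<^bsub>E\<^esub> \<eta>) m u = act_at \<xi> m u \<oplus> act_at \<eta> m u"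
  using assms(4) E_plus[OF assms(1,2)]
  by (induction u rule: ext_tensor_induct)
    (use assms(1-3) in \<open>simp_all add: M.r_distr M.add.m_ac\<close>)

lemma right_module_E: "right_module B E (End_action M)"
proof (intro right_module.intro right_module_axioms.intro ring_B E.abelian_group_axioms)
  fix \<xi> \<eta> c assume *: "\<xi> \<in> carrier E" "\<eta> \<in> carrier E" "c \<in> carrier B"
  show "(\<xi> \<oplus>\<^bsub>E\<^esub> \<eta>) \<triangleleft> c = \<xi> \<triangleleft> c \<oplus>\<^bsub>E\<^esub> \<eta> \<triangleleft> c"
  proof (rule E_eqI)
    fix x assume "x \<in> carrier M"
    then show "((\<xi> \<oplus>\<^bsub>E\<^esub> \<eta>) \<triangleleft> c) x = (\<xi> \<triangleleft> c \<oplus>\<^bsub>E\<^esub> \<eta> \<triangleleft> c) x"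
      using * act_at_plus[of \<xi> \<eta> x c] by (simp add: act_apply)
  qed (use * E_plus in simp_all)
next
  fix \<xi> c d assume *: "\<xi> \<in> carrier E" "c \<in> carrier B" "d \<in> carrier B"
  show "\<xi> \<triangleleft> (c \<oplus>\<^bsub>B\<^esub> d) = \<xi> \<triangleleft> c \<oplus>\<^bsub>E\<^esub> \<xi> \<triangleleft> d"
    by (rule E_eqI) (use * E_plus in \<open>simp_all add: act_apply\<close>)
  show "\<xi> \<triangleleft> (c \<otimes>\<^bsub>B\<^esub> d) = (\<xi> \<triangleleft> c) \<triangleleft> d"
    by (rule E_eqI) (use * in \<open>simp_all add: act_apply act_at_bimod_end\<close>)
next
  fix \<xi> assume "\<xi> \<in> carrier E"
  then show "\<xi> \<triangleleft> \<one>\<^bsub>B\<^esub> = \<xi>"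
    by (intro E_eqI) (simp_all add: act_apply)
qed simp

sublocale act: right_module B E "End_action M"
  by (rule right_module_E)

abbreviation "Y \<equiv> module_algebroid_bimodule E (End_action M) s t"

lemma Y_simps [simp]:
  "carrier Y = carrier E" "\<zero>\<^bsub>Y\<^esub> = \<zero>\<^bsub>E\<^esub>" "add Y = add E"
  "lact Y r \<xi> = \<xi> \<triangleleft> t r" "ract Y \<xi> r = \<xi> \<triangleleft> s r"
  by (simp_all add: module_algebroid_bimodule_def)

lemma act_source_apply: "\<lbrakk>\<xi> \<in> carrier E; r \<in> carrier R; m \<in> carrier M\<rbrakk> \<Longrightarrow> (\<xi> \<triangleleft> s r) m = \<xi> (r \<otimes> m)"
  and act_target_apply: "\<lbrakk>\<xi> \<in> carrier E; r \<in> carrier R; m \<in> carrier M\<rbrakk> \<Longrightarrow> (\<xi> \<triangleleft> t r) m = r \<otimes> \<xi> m"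
  by (simp_all add: act_apply source_eq target_eq)

lemma source_target_one: "s \<one> = \<one> \<boxdot> \<one>" "t \<one> = \<one> \<boxdot> \<one>"
  by (simp_all add: source_eq target_eq)

lemma bimodule_Y: "bimodule R R Y"
proof (intro bimodule.intro bimodule_axioms.intro ring_R)
  show "abelian_group Y"
    by (rule abelian_groupI)
      (auto simp: E.add.m_ac simp del: E_simps intro: bexI E.l_neg E.a_inv_closed)
qed (simp, simp, (rule E_eqI; simp add: E_plus E_add source_target_one act.act_one[unfolded B_simps] act_source_apply act_target_apply M.l_distr M.r_distr M.m_assoc)+)

sublocale YY: tensor_product R R R Y Y
  by (simp add: tensor_product_def bimodule_Y)

text \<open>Both sides map x to \<xi>(r \<eta>(x)).\<close>

lemma mult_balanced:
  assumes "\<xi> \<in> carrier E" "\<eta> \<in> carrier E" "r \<in> carrier R"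
  shows "(\<xi> \<triangleleft> s r) \<otimes>\<^bsub>E\<^esub> \<eta> = \<xi> \<otimes>\<^bsub>E\<^esub> (\<eta> \<triangleleft> t r)"
  using assms by (auto simp: compose_def act_source_apply act_target_apply)

lemma mult_source_target:
  assumes "\<xi> \<in> carrier E" "\<eta> \<in> carrier E" "r \<in> carrier R"
  shows "(\<xi> \<triangleleft> t r) \<otimes>\<^bsub>E\<^esub> \<eta> = (\<xi> \<otimes>\<^bsub>E\<^esub> \<eta>) \<triangleleft> t r" "\<xi> \<otimes>\<^bsub>E\<^esub> (\<eta> \<triangleleft> s r) = (\<xi> \<otimes>\<^bsub>E\<^esub> \<eta>) \<triangleleft> s r"
  by (rule E_eqI; use assms E_compose in \<open>simp add: compose_def act_source_apply act_target_apply\<close>)+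

lemma balanced_mult_E: "balanced_map R Y Y E (\<otimes>\<^bsub>E\<^esub>)"
  by (rule balanced_mapI) (simp_all add: E.l_distr E.r_distr mult_balanced del: E_simps)

lemma mult_E_tensor:
  "\<exists>\<mu>\<in>bimodule_hom R R (tensor R Y Y) Y.
    \<forall>\<xi>\<in>carrier E. \<forall>\<eta>\<in>carrier E. \<mu> (pure_tensor R Y Y \<xi> \<eta>) = \<xi> \<otimes>\<^bsub>E\<^esub> \<eta>"
proof (intro bexI ballI)
  note l = YY.lift_pure[OF E.abelian_group_axioms balanced_mult_E]
    YY.lift_add[OF E.abelian_group_axioms balanced_mult_E]
    YY.lift_closed[OF E.abelian_group_axioms balanced_mult_E]
  show "tensor_lift E (\<otimes>\<^bsub>E\<^esub>) (pure_tensor R Y Y \<xi> \<eta>) = \<xi> \<otimes>\<^bsub>E\<^esub> \<eta>"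
    if "\<xi> \<in> carrier E" "\<eta> \<in> carrier E" for \<xi> \<eta>
    using that by (simp add: l del: E_simps)
  interpret T2: bimodule R R YY.T by (rule YY.bimodule_tensor)
  have "tensor_lift E (\<otimes>\<^bsub>E\<^esub>) (lact YY.T r u) = tensor_lift E (\<otimes>\<^bsub>E\<^esub>) u \<triangleleft> t r"
    "tensor_lift E (\<otimes>\<^bsub>E\<^esub>) (ract YY.T u r) = tensor_lift E (\<otimes>\<^bsub>E\<^esub>) u \<triangleleft> s r"
    if r: "r \<in> carrier R" and u: "u \<in> carrier YY.T" for r u
    using u by (induction u rule: YY.tensor_induct;
      use r in \<open>simp add: l YY.lact_pure YY.ract_pure mult_source_target T2.lact_closed T2.ract_closed
        T2.lact_add T2.ract_add act.add_act del: E_simps\<close>)+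
  then show "tensor_lift E (\<otimes>\<^bsub>E\<^esub>) \<in> bimodule_hom R R (tensor R Y Y) Y"
    by (simp add: bimodule_hom_def l del: E_simps)
qed

end

context D2_extension begin

text \<open>With x \<otimes> y in place of \<open>c\<close>, the i-th term at m is the action of
  \<xi> through \<open>b i\<close> at the point \<beta> i(x) \<eta>(y m). Moving \<beta> i(x) into
  the tensor turns the sum into the quasibasis identity at x, leaving x \<xi>(\<eta>(y m)).\<close>

lemma mult_E_act:
  assumes \<xi>: "\<xi> \<in> carrier E" and \<eta>: "\<eta> \<in> carrier E" and c: "c \<in> carrier B"
  shows "(\<xi> \<otimes>\<^bsub>E\<^esub> \<eta>) \<triangleleft> c = tensor_lift E (\<lambda>a a'. (\<xi> \<triangleleft> a) \<otimes>\<^bsub>E\<^esub> (\<eta> \<triangleleft> a')) (\<Delta> c)"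
proof -
  let ?g = "\<lambda>i. (\<xi> \<triangleleft> b i) \<otimes>\<^bsub>E\<^esub> (\<eta> \<triangleleft> apply_left (\<beta> i) c)"
  have bal: "balanced_map R X X E (\<lambda>a a'. (\<xi> \<triangleleft> a) \<otimes>\<^bsub>E\<^esub> (\<eta> \<triangleleft> a'))"
  proof (rule balanced_mapI)
    fix x r y assume "x \<in> carrier X" "r \<in> carrier R" "y \<in> carrier X"
    then show "(\<xi> \<triangleleft> ract X x r) \<otimes>\<^bsub>E\<^esub> (\<eta> \<triangleleft> y) = (\<xi> \<triangleleft> x) \<otimes>\<^bsub>E\<^esub> (\<eta> \<triangleleft> lact X r y)"
      using \<xi> \<eta> mult_balanced[of "\<xi> \<triangleleft> x" "\<eta> \<triangleleft> y" r] by (simp add: act.act_mult del: E_simps B_simps(1))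
  qed (use \<xi> \<eta> act.act_add[unfolded B_simps] in \<open>simp_all add: E.l_distr E.r_distr del: E_simps\<close>)
  have "tensor_lift E (\<lambda>a a'. (\<xi> \<triangleleft> a) \<otimes>\<^bsub>E\<^esub> (\<eta> \<triangleleft> a')) (\<Delta> c)
      = (\<Oplus>\<^bsub>E\<^esub>i\<in>I. tensor_lift E (\<lambda>a a'. (\<xi> \<triangleleft> a) \<otimes>\<^bsub>E\<^esub> (\<eta> \<triangleleft> a')) (b i \<diamondop> apply_left (\<beta> i) c))"
    unfolding comult_eq by (rule St.XX.lift_finsum[OF E.abelian_group_axioms bal]) (use c in simp)
  also have "\<dots> = (\<Oplus>\<^bsub>E\<^esub>i\<in>I. ?g i)"
    by (rule E.finsum_cong') (use c \<xi> \<eta> St.XX.lift_pure[OF E.abelian_group_axioms bal] E_compose in auto)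
  also have "\<dots> = (\<xi> \<otimes>\<^bsub>E\<^esub> \<eta>) \<triangleleft> c"
  proof (rule E_eqI)
    have g: "?g i \<in> carrier E" if "i \<in> I" for i using that c \<xi> \<eta> E_compose by simp
    then show "(\<Oplus>\<^bsub>E\<^esub>i\<in>I. ?g i) \<in> carrier E" by (intro E.finsum_closed) auto
    show "(\<xi> \<otimes>\<^bsub>E\<^esub> \<eta>) \<triangleleft> c \<in> carrier E" using c \<xi> \<eta> E_compose by simp
    fix m assume m: "m \<in> carrier M"
    have comp: "compose (carrier M) \<xi> \<eta> \<in> carrier E" using \<xi> \<eta> E_compose by simp
    \<comment> \<open>Stated for all of M \<otimes> M so that induction on pure tensors
      applies.\<close>
    have "(\<Oplus>i\<in>I. act_at \<xi> (act_at \<eta> m (apply_left (\<beta> i) u)) (b i)) = act_at (compose (carrier M) \<xi> \<eta>) m u"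
      if "u \<in> carrier T" for u
      using that
    proof (induction u rule: ext_tensor_induct)
      case (pure x y)
      have "(\<Oplus>i\<in>I. act_at \<xi> (act_at \<eta> m (apply_left (\<beta> i) (x \<boxdot> y))) (b i))
          = (\<Oplus>i\<in>I. act_at \<xi> (\<eta> (y \<otimes> m)) (b i \<cdot>\<^sub>r \<beta> i x))"
        by (rule M.finsum_cong') (use pure m \<xi> \<eta> in \<open>auto simp: act_at_ract\<close>)
      also have "\<dots> = act_at \<xi> (\<eta> (y \<otimes> m)) (\<Oplus>\<^bsub>T\<^esub>i\<in>I. b i \<cdot>\<^sub>r \<beta> i x)"
        by (rule additive_finsum[symmetric, OF T_abelian M_abelian]) (use pure m \<xi> \<eta> in simp_all)
      finally show ?case using pure m \<xi> \<eta> comp by (simp add: quasibasis_sum compose_eq)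
    next
      case (add u v)
      have "(\<Oplus>i\<in>I. act_at \<xi> (act_at \<eta> m (apply_left (\<beta> i) (u \<oplus>\<^bsub>T\<^esub> v))) (b i))
          = (\<Oplus>i\<in>I. act_at \<xi> (act_at \<eta> m (apply_left (\<beta> i) u)) (b i)
              \<oplus> act_at \<xi> (act_at \<eta> m (apply_left (\<beta> i) v)) (b i))"
        by (rule M.finsum_cong') (use add m \<xi> \<eta> in \<open>auto simp: act_at_add_point\<close>)
      also have "\<dots> = (\<Oplus>i\<in>I. act_at \<xi> (act_at \<eta> m (apply_left (\<beta> i) u)) (b i))
          \<oplus> (\<Oplus>i\<in>I. act_at \<xi> (act_at \<eta> m (apply_left (\<beta> i) v)) (b i))"
        by (rule M.finsum_addf) (use add m \<xi> \<eta> in auto)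
      finally show ?case using add m comp by simp
    qed
    moreover have "(\<Oplus>\<^bsub>E\<^esub>i\<in>I. ?g i) m = (\<Oplus>i\<in>I. ?g i m)"
      by (rule E_finsum_apply) (use g m in auto)
    moreover have "(\<Oplus>i\<in>I. ?g i m) = (\<Oplus>i\<in>I. act_at \<xi> (act_at \<eta> m (apply_left (\<beta> i) c)) (b i))"
      by (rule M.finsum_cong') (use c m \<xi> \<eta> in \<open>auto simp: compose_def act_apply\<close>)
    ultimately show "(\<Oplus>\<^bsub>E\<^esub>i\<in>I. ?g i) m = ((\<xi> \<otimes>\<^bsub>E\<^esub> \<eta>) \<triangleleft> c) m"
      using c m by (simp add: act_apply)
  qed
  finally show ?thesis by simp
qed

text \<open>So \<open>c\<close> acts on the unit as \<lambda>(\<epsilon>(c)), which is also how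
  s(\<epsilon>(c)) acts on it; this is the unit axiom of a module algebroid.\<close>

lemma act_at_one:
  assumes "m \<in> carrier M" "u \<in> carrier T"
  shows "act_at \<one>\<^bsub>E\<^esub> m u = \<epsilon> u \<otimes> m"
  using assms(2) E.one_closed
  by (induction u rule: ext_tensor_induct) (use assms(1) in \<open>simp_all add: M.m_assoc M.l_distr\<close>)

theorem right_module_algebroid: "right_module_algebroid R B s t \<Delta> \<epsilon> E (End_action M)"
proof (intro right_module_algebroid.intro right_module_algebroid_axioms.intro
    right_bialgebroid ring_E right_module_E bimodule_Y)
  show "lact Y r \<one>\<^bsub>E\<^esub> = ract Y \<one>\<^bsub>E\<^esub> r" if "r \<in> carrier R" for r
    by (rule E_eqI) (use that E.one_closed in \<open>simp_all add: act_source_apply act_target_apply\<close>)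
  show "\<one>\<^bsub>E\<^esub> \<triangleleft> c = ract Y \<one>\<^bsub>E\<^esub> (\<epsilon> c)" if c: "c \<in> carrier B" for c
  proof (rule E_eqI)
    fix m assume "m \<in> carrier M"
    then show "(\<one>\<^bsub>E\<^esub> \<triangleleft> c) m = (ract Y \<one>\<^bsub>E\<^esub> (\<epsilon> c)) m"
      using c act_at_one[of m c] E.one_closed by (simp add: act_apply[of m _ c] act_source_apply)
  qed (use c E.one_closed in \<open>simp_all del: E_simps\<close>)
qed (use mult_E_tensor mult_E_act in \<open>simp_all add: Let_def del: E_simps\<close>)

end

section \<open>Invariants\<close>

context ring_extension begin

section \<open>Right depth two: generation of M \<otimes> M by B\<close>

lemma power_simps:
  "carrier (bimodule_power n M_N) = {..<n} \<rightarrow>\<^sub>E carrier M"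
  "\<zero>\<^bsub>bimodule_power n M_N\<^esub> = (\<lambda>i\<in>{..<n}. \<zero>)"
  "u \<oplus>\<^bsub>bimodule_power n M_N\<^esub> v = (\<lambda>i\<in>{..<n}. u i \<oplus> v i)"
  "lact (bimodule_power n M_N) m u = (\<lambda>i\<in>{..<n}. m \<otimes> u i)"
  "ract (bimodule_power n M_N) u k = (\<lambda>i\<in>{..<n}. u i \<otimes> f k)"
  by (simp_all add: bimodule_power_def)

lemma bimodule_power: "bimodule M N (bimodule_power n M_N)"
proof (intro bimodule.intro bimodule_axioms.intro M.ring_axioms N.ring_axioms)
  show "abelian_group (bimodule_power n M_N)"
  proof (rule abelian_groupI)
    fix u assume u: "u \<in> carrier (bimodule_power n M_N)"
    show "\<exists>v\<in>carrier (bimodule_power n M_N). v \<oplus>\<^bsub>bimodule_power n M_N\<^esub> u = \<zero>\<^bsub>bimodule_power n M_N\<^esub>"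
      by (rule bexI[of _ "\<lambda>i\<in>{..<n}. \<ominus> u i"])
        (use u in \<open>auto simp: power_simps PiE_iff M.l_neg intro!: restrict_ext\<close>)
  qed (auto simp: power_simps PiE_iff M.add.m_ac extensional_def fun_eq_iff)
qed (auto simp: power_simps PiE_iff extensional_def fun_eq_iff M.l_distr M.r_distr M.m_assoc f_hom)

text \<open>Writing \<open>M \<otimes> M\<close> as a summand of a power of \<open>M\<close>, the projections of the standard basis vectors
  lie in \<open>B\<close>, so \<open>B\<close> generates \<open>M \<otimes> M\<close> as a left \<open>M\<close>-module.\<close>

lemma right_D2_generated:
  assumes D2: "right_D2 N M f"
    and G: "G \<subseteq> carrier T" "carrier B \<subseteq> G" "\<And>u v. \<lbrakk>u \<in> G; v \<in> G\<rbrakk> \<Longrightarrow> u \<oplus>\<^bsub>T\<^esub> v \<in> G"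
      "\<And>m u. \<lbrakk>m \<in> carrier M; u \<in> G\<rbrakk> \<Longrightarrow> m \<cdot>\<^sub>l u \<in> G"
  shows "G = carrier T"
proof -
  obtain n P h Q where P: "subbimodule M N P (bimodule_power n M_N)"
    and Q: "subbimodule M N Q (bimodule_power n M_N)"
    and PQ: "P \<inter> Q = {\<zero>\<^bsub>bimodule_power n M_N\<^esub>}" "P <+>\<^bsub>bimodule_power n M_N\<^esub> Q = carrier (bimodule_power n M_N)"
    and h: "h \<in> bimodule_hom M N (restrict_scalars (\<lambda>x. x) f T) (bimodule_power n M_N\<lparr>carrier := P\<rparr>)"
    and bij: "bij_betw h (carrier T) P"
    using D2 by (auto simp: right_D2_def iso_to_direct_summand_def direct_summand_def restrict_scalars_def)
  define V where "V = bimodule_power n M_N"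
  interpret V: bimodule M N V unfolding V_def by (rule bimodule_power)
  have V: "abelian_group V" unfolding V_def using bimodule_power bimodule.axioms(3) by blast
  note Ps = subbimoduleD[OF P[folded V_def] V] and Qs = subbimoduleD[OF Q[folded V_def] V]
  have PV [simp]: "p \<in> carrier V" if "p \<in> P" for p using that Ps(1) by blast
  have QV [simp]: "q \<in> carrier V" if "q \<in> Q" for q using that Qs(1) by blast
  have hP [simp]: "h u \<in> P" if "u \<in> carrier T" for u
    using bij that by (auto simp: bij_betw_def)
  have h_inj: "u = v" if "h u = h v" "u \<in> carrier T" "v \<in> carrier T" for u v
    using bij that by (auto simp: bij_betw_def inj_on_def)
  have h_add: "h (u \<oplus>\<^bsub>T\<^esub> v) = h u \<oplus>\<^bsub>V\<^esub> h v" if "u \<in> carrier T" "v \<in> carrier T" for u v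
    using h that by (simp add: bimodule_hom_def restrict_scalars_def V_def)
  have h_lact: "h (m \<cdot>\<^sub>l u) = lact V m (h u)" if "m \<in> carrier M" "u \<in> carrier T" for m u
    using h that by (simp add: bimodule_hom_def restrict_scalars_def V_def)
  have h_ract: "h (u \<cdot>\<^sub>r f k) = ract V (h u) k" if "k \<in> carrier N" "u \<in> carrier T" for k u
    using h that by (simp add: bimodule_hom_def restrict_scalars_def V_def)
  \<comment> \<open>Uniqueness of the P-component: the difference of two of them is also a
    difference of Q-components and lies in the trivial intersection.\<close>
  have unique: "p = p'" if "p \<oplus>\<^bsub>V\<^esub> q = p' \<oplus>\<^bsub>V\<^esub> q'" "p \<in> P" "p' \<in> P" "q \<in> Q" "q' \<in> Q" for p p' q q'
  proof -
    have "p \<oplus>\<^bsub>V\<^esub> \<ominus>\<^bsub>V\<^esub> p' = q' \<oplus>\<^bsub>V\<^esub> \<ominus>\<^bsub>V\<^esub> q"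
    proof -
      have "p \<oplus>\<^bsub>V\<^esub> \<ominus>\<^bsub>V\<^esub> p' = (p \<oplus>\<^bsub>V\<^esub> q) \<oplus>\<^bsub>V\<^esub> \<ominus>\<^bsub>V\<^esub> q \<oplus>\<^bsub>V\<^esub> \<ominus>\<^bsub>V\<^esub> p'"
        using that(2-5) by (simp add: V.X.add.m_assoc V.X.r_neg)
      also have "\<dots> = (p' \<oplus>\<^bsub>V\<^esub> \<ominus>\<^bsub>V\<^esub> p') \<oplus>\<^bsub>V\<^esub> (q' \<oplus>\<^bsub>V\<^esub> \<ominus>\<^bsub>V\<^esub> q)"
        unfolding that(1) using that(2-5) by (simp add: V.X.add.m_ac)
      finally show ?thesis using that by (simp add: V.X.r_neg)
    qed
    moreover have "p \<oplus>\<^bsub>V\<^esub> \<ominus>\<^bsub>V\<^esub> p' \<in> P" "q' \<oplus>\<^bsub>V\<^esub> \<ominus>\<^bsub>V\<^esub> q \<in> Q"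
      using that Ps Qs by auto
    ultimately have "p \<oplus>\<^bsub>V\<^esub> \<ominus>\<^bsub>V\<^esub> p' = \<zero>\<^bsub>V\<^esub>" using PQ(1) by (auto simp: V_def)
    then show ?thesis
      using V.X.minus_equality[of p "\<ominus>\<^bsub>V\<^esub> p'"] that by simp
  qed
  have decompose: "\<exists>u\<in>carrier T. \<exists>q\<in>Q. v = h u \<oplus>\<^bsub>V\<^esub> q" if "v \<in> carrier V" for v
  proof -
    have "v \<in> P <+>\<^bsub>V\<^esub> Q" using that PQ(2) by (simp only: V_def)
    then obtain p q where p: "p \<in> P" and q: "q \<in> Q" "v = p \<oplus>\<^bsub>V\<^esub> q"
      unfolding set_add_def' by blast
    obtain u where "u \<in> carrier T" "h u = p"
      using p bij_betw_imp_surj_on[OF bij] by blast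
    then show ?thesis using q by blast
  qed
  \<comment> \<open>The vectors whose P-component comes from \<open>G\<close>. They are shown to be
    the whole power by reaching the standard basis vectors.\<close>
  define H where "H = {v. \<exists>u\<in>G. \<exists>q\<in>Q. v = h u \<oplus>\<^bsub>V\<^esub> q}"
  have H_add: "v \<oplus>\<^bsub>V\<^esub> w \<in> H" if v: "v \<in> H" and w: "w \<in> H" for v w
  proof -
    obtain u q u' q' where *: "u \<in> G" "q \<in> Q" "v = h u \<oplus>\<^bsub>V\<^esub> q" "u' \<in> G" "q' \<in> Q" "w = h u' \<oplus>\<^bsub>V\<^esub> q'"
      using v w unfolding H_def by blast
    then have "v \<oplus>\<^bsub>V\<^esub> w = h (u \<oplus>\<^bsub>T\<^esub> u') \<oplus>\<^bsub>V\<^esub> (q \<oplus>\<^bsub>V\<^esub> q')"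
      using G(1) by (simp add: h_add V.X.add.m_ac subset_iff)
    then show ?thesis unfolding H_def using * G(3) Qs(3) by blast
  qed
  have H_lact: "lact V m v \<in> H" if v: "v \<in> H" and m: "m \<in> carrier M" for v m
  proof -
    obtain u q where *: "u \<in> G" "q \<in> Q" "v = h u \<oplus>\<^bsub>V\<^esub> q"
      using v unfolding H_def by blast
    then have "lact V m v = h (m \<cdot>\<^sub>l u) \<oplus>\<^bsub>V\<^esub> lact V m q"
      using G(1) m by (simp add: h_lact V.lact_add subset_iff)
    then show ?thesis unfolding H_def using * m G(4) Qs(5) by blast
  qed
  define e where "e k = (\<lambda>i\<in>{..<n}. if i = k then \<one> else \<zero>)" for k
  have eV: "e k \<in> carrier V" for k by (auto simp: e_def V_def power_simps)
  have e_H: "e k \<in> H" for k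
  proof -
    obtain u q where u: "u \<in> carrier T" and q: "q \<in> Q" and e: "e k = h u \<oplus>\<^bsub>V\<^esub> q"
      using decompose[OF eV] by blast
    \<comment> \<open>The coordinates of \<open>e k\<close> are 0 and 1, so N acts on it equally
      from both sides. Both actions respect P and Q, hence the P-component of \<open>e k\<close>,
      and with it \<open>u\<close>, commutes with N.\<close>
    have "f x \<cdot>\<^sub>l u = u \<cdot>\<^sub>r f x" if x: "x \<in> carrier N" for x
    proof -
      have "h (f x \<cdot>\<^sub>l u) \<oplus>\<^bsub>V\<^esub> lact V (f x) q = lact V (f x) (e k)"
        using u q x by (simp add: e h_lact V.lact_add)
      also have "\<dots> = ract V (e k) x"
        using x by (auto simp: e_def V_def power_simps fun_eq_iff)
      also have "\<dots> = h (u \<cdot>\<^sub>r f x) \<oplus>\<^bsub>V\<^esub> ract V q x"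
        using u q x by (simp add: e h_ract V.ract_add)
      finally have "h (f x \<cdot>\<^sub>l u) = h (u \<cdot>\<^sub>r f x)"
        by (rule unique) (use u q x Qs(5,6) in auto)
      then show ?thesis using h_inj u x by simp
    qed
    then have "u \<in> G" using u G(2) by (auto simp: mem_B)
    then show ?thesis unfolding H_def using q e by blast
  qed
  have zero_H: "\<zero>\<^bsub>V\<^esub> \<in> H"
  proof -
    have "\<zero>\<^bsub>T\<^esub> \<in> G" using G(2) B.zero_closed by auto
    moreover have "h \<zero>\<^bsub>T\<^esub> = \<zero>\<^bsub>V\<^esub>" by (rule additive_zero[OF T_abelian V]) (simp_all add: h_add)
    ultimately show ?thesis unfolding H_def using Qs(2) by force
  qed
  have H: "v \<in> H" if v: "v \<in> carrier V" for v
  proof -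
    \<comment> \<open>Induction on the number of leading coordinates kept; from k = n on the
      truncations no longer change.\<close>
    have "(\<lambda>i\<in>{..<n}. if i < k then v i else \<zero>) \<in> H" for k
    proof (induction k)
      case 0
      have "(\<lambda>i\<in>{..<n}. if i < 0 then v i else \<zero>) = \<zero>\<^bsub>V\<^esub>"
        by (simp only: V_def power_simps not_less_zero if_False)
      then show ?case using zero_H by simp
    next
      case (Suc k)
      show ?case
      proof (cases "k < n")
        case True
        then have vk: "v k \<in> carrier M" using v by (auto simp: V_def power_simps)
        have "(\<lambda>i\<in>{..<n}. if i < Suc k then v i else \<zero>)
            = (\<lambda>i\<in>{..<n}. if i < k then v i else \<zero>) \<oplus>\<^bsub>V\<^esub> lact V (v k) (e k)"
          using v vk by (auto simp: V_def power_simps e_def fun_eq_iff less_Suc_eq PiE_iff)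
        then show ?thesis using H_add[OF Suc.IH H_lact[OF e_H vk]] by (simp only:)
      next
        case False
        then have "(\<lambda>i\<in>{..<n}. if i < Suc k then v i else \<zero>) = (\<lambda>i\<in>{..<n}. if i < k then v i else \<zero>)"
          by (auto simp: fun_eq_iff)
        then show ?thesis using Suc.IH by (simp only:)
      qed
    qed
    moreover have "(\<lambda>i\<in>{..<n}. if i < n then v i else \<zero>) = v"
      using v by (auto simp: V_def power_simps PiE_iff extensional_def fun_eq_iff)
    ultimately show ?thesis by metis
  qed
  \<comment> \<open>The vector \<open>h u\<close> is its own P-component, and since it lies in
    \<open>H\<close> this component is also \<open>h g\<close> for some g in
    \<open>G\<close>.\<close>
  have "u \<in> G" if u: "u \<in> carrier T" for u
  proof -
    obtain g q where g: "g \<in> G" "q \<in> Q" "h u = h g \<oplus>\<^bsub>V\<^esub> q"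
      using H[of "h u"] u unfolding H_def by auto
    have "h u = h g"
    proof (rule unique)
      show "h u \<oplus>\<^bsub>V\<^esub> \<zero>\<^bsub>V\<^esub> = h g \<oplus>\<^bsub>V\<^esub> q" using u by (simp flip: g(3))
      show "h g \<in> P" using g(1) G(1) by (intro hP) blast
    qed (use g(2) u Qs(2) in simp_all)
    then have "u = g" by (rule h_inj) (use u g(1) G(1) in auto)
    then show ?thesis using g(1) by simp
  qed
  then show ?thesis using G(1) by blast
qed

section \<open>Right multiplications and invariants\<close>

lemma right_mult_E: "m \<in> carrier M \<Longrightarrow> right_mult M m \<in> carrier E"
  by (simp add: mem_E right_mult_def M.l_distr M.m_assoc)

lemma right_mult_apply [simp]: "x \<in> carrier M \<Longrightarrow> right_mult M m x = x \<otimes> m"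
  by (simp add: right_mult_def)

lemma subring_right_mult: "subring (right_mult M ` carrier M) E"
proof (rule E.subringI)
  show "right_mult M ` carrier M \<subseteq> carrier E" using right_mult_E by auto
  show "\<one>\<^bsub>E\<^esub> \<in> right_mult M ` carrier M"
  proof
    show "\<one>\<^bsub>E\<^esub> = right_mult M \<one>" by (auto simp: right_mult_def)
  qed simp
  have add: "right_mult M x \<oplus>\<^bsub>E\<^esub> right_mult M y = right_mult M (x \<oplus> y)"
    if "x \<in> carrier M" "y \<in> carrier M" for x y
    using that by (auto simp: right_mult_def M.r_distr)
  fix h assume "h \<in> right_mult M ` carrier M"
  then obtain m where m: "m \<in> carrier M" "h = right_mult M m" by blast
  have "\<ominus>\<^bsub>E\<^esub> h = right_mult M (\<ominus> m)"
  proof (rule E.minus_equality)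
    have "right_mult M \<zero> = \<zero>\<^bsub>E\<^esub>" by (auto simp: right_mult_def)
    then show "right_mult M (\<ominus> m) \<oplus>\<^bsub>E\<^esub> h = \<zero>\<^bsub>E\<^esub>"
      using m add[of "\<ominus> m" m] by (simp add: M.l_neg del: E_simps)
  qed (use m right_mult_E in auto)
  then show "\<ominus>\<^bsub>E\<^esub> h \<in> right_mult M ` carrier M" using m by blast
  fix k assume "k \<in> right_mult M ` carrier M"
  then obtain m' where m': "m' \<in> carrier M" "k = right_mult M m'" by blast
  show "h \<oplus>\<^bsub>E\<^esub> k \<in> right_mult M ` carrier M"
    using m m' add[of m m'] by (simp del: E_simps)
  \<comment> \<open>Composition reverses the order: x is first multiplied by m', then by m.\<close>
  have "h \<otimes>\<^bsub>E\<^esub> k = right_mult M (m' \<otimes> m)"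
    using m m' by (auto simp: compose_def right_mult_def M.m_assoc)
  then show "h \<otimes>\<^bsub>E\<^esub> k \<in> right_mult M ` carrier M"
    using m m' by blast
qed

end

context D2_extension begin

text \<open>Makes the R-bimodule structure of the bialgebroid explicit: right multiplication by t(r)
  s(r') is multiplication of the outer sides of the tensor by r and r'.\<close>

lemma mult_target_source:
  assumes "r \<in> carrier R" "r' \<in> carrier R" "c \<in> carrier B"
  shows "c \<otimes>\<^bsub>B\<^esub> (t r \<otimes>\<^bsub>B\<^esub> s r') = tensor_lift T (\<lambda>x y. (r \<otimes> x) \<boxdot> (y \<otimes> r')) c"
proof -
  have bal: "bal T (\<lambda>x y. (r \<otimes> x) \<boxdot> (y \<otimes> r'))"
    by (rule balI) (use assms in
      \<open>simp_all add: M.l_distr M.r_distr pt_add_left pt_add_right M.m_assoc[symmetric] pt_balanced\<close>)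
  have "tensor_lift T (\<lambda>x y. (r \<otimes> x) \<boxdot> (y \<otimes> r')) u = (r \<cdot>\<^sub>l u) \<cdot>\<^sub>r r'" if "u \<in> carrier T" for u
    using that by (induction u rule: ext_tensor_induct) (use assms in \<open>simp_all add: ext_lift_simps[OF T_abelian bal]\<close>)
  then show ?thesis using assms by simp
qed

text \<open>On a \<otimes> a' the action of \<rho>(m) at x is a (a' x m), and associativity collects
  the tensor into its counit.\<close>

lemma right_mult_invariant:
  assumes m: "m \<in> carrier M"
  shows "right_mult M m \<in> End_invariants N M f"
proof -
  have "act_at (right_mult M m) x u = \<epsilon> u \<otimes> (x \<otimes> m)" if "x \<in> carrier M" "u \<in> carrier T" for x u
    using that(2) by (induction u rule: ext_tensor_induct)
      (use that(1) m right_mult_E[OF m] in \<open>simp_all add: M.m_assoc M.l_distr\<close>)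
  then have "right_mult M m \<triangleleft> c = compose (carrier M) (left_mult M (\<epsilon> c)) (right_mult M m)"
    if "c \<in> carrier B" for c
    using that m right_mult_E[OF m]
    by (intro extensionalityI[of _ "carrier M"])
      (simp_all add: act_apply compose_eq left_mult_def compose_extensional, simp add: End_action_def)
  then show ?thesis using right_mult_E[OF m] by (simp add: End_invariants_def)
qed

lemma invariant_right_mult:
  assumes D2: "right_D2 N M f" and \<xi>: "\<xi> \<in> End_invariants N M f"
  shows "\<xi> = right_mult M (\<xi> \<one>)"
proof -
  have E: "\<xi> \<in> carrier E"
    and inv: "\<And>c. c \<in> carrier B \<Longrightarrow> \<xi> \<triangleleft> c = compose (carrier M) (left_mult M (\<epsilon> c)) \<xi>"
    using \<xi> by (auto simp: End_invariants_def)
  \<comment> \<open>The set where two left M-linear maps agree is closed under sums and left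
    multiplication; invariance evaluated at 1 puts B inside it.\<close>
  let ?G = "{u \<in> carrier T. act_at \<xi> \<one> u = \<epsilon> u \<otimes> \<xi> \<one>}"
  have "?G = carrier T"
  proof (rule right_D2_generated[OF D2])
    show "carrier B \<subseteq> ?G"
    proof
      fix c assume c: "c \<in> carrier B"
      then have "(\<xi> \<triangleleft> c) \<one> = \<epsilon> c \<otimes> \<xi> \<one>"
        using E by (simp add: inv compose_eq left_mult_def)
      then show "c \<in> ?G" using c by (simp add: act_apply)
    qed
  qed (use E in \<open>auto simp: M.l_distr M.m_assoc\<close>)
  then have at: "act_at \<xi> \<one> (\<one> \<boxdot> m) = \<epsilon> (\<one> \<boxdot> m) \<otimes> \<xi> \<one>" if "m \<in> carrier M" for m
    using that pt_closed[of \<one> m] by blast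
  have "\<xi> m = right_mult M (\<xi> \<one>) m" if "m \<in> carrier M" for m
    using at[OF that] that E by simp
  then show ?thesis
    by (rule E_eqI[OF E right_mult_E[OF E_closed[OF E M.one_closed]]])
qed

end

theorem theorem5p2:
  fixes N :: "('n, 'i) ring_scheme" and M :: "('m, 'j) ring_scheme" and f :: "'n \<Rightarrow> 'm"
    and I :: "'k set" and b :: "'k \<Rightarrow> (('m \<times> 'm) \<Rightarrow>\<^sub>0 int) set" and \<beta> :: "'k \<Rightarrow> 'm \<Rightarrow> 'm"
  assumes "ring_hom_ring N M f"
    and "D2 N M f"
    and "left_D2_quasibasis N M f I b \<beta>"
  shows "right_bialgebroid (centralizer_ring N M f) (tensor_ring N M f)
      (D2_source N M f) (D2_target N M f) (D2_comult N M f I b \<beta>) (D2_counit M)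
    \<and> (\<forall>r\<in>carrier (centralizer_ring N M f). \<forall>r'\<in>carrier (centralizer_ring N M f).
      \<forall>c\<in>carrier (tensor_ring N M f).
        c \<otimes>\<^bsub>tensor_ring N M f\<^esub> (D2_target N M f r \<otimes>\<^bsub>tensor_ring N M f\<^esub> D2_source N M f r')
          = tensor_lift (ext_tensor N M f) (\<lambda>x y. ext_pure N M f (r \<otimes>\<^bsub>M\<^esub> x) (y \<otimes>\<^bsub>M\<^esub> r')) c)
    \<and> right_module_algebroid (centralizer_ring N M f) (tensor_ring N M f)
      (D2_source N M f) (D2_target N M f) (D2_comult N M f I b \<beta>) (D2_counit M)
      (left_End N M f) (End_action M)
    \<and> subring (End_invariants N M f) (left_End N M f)
    \<and> End_invariants N M f = right_mult M ` carrier M"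
proof -
  interpret H: ring_hom_ring N M f by fact
  interpret D2_extension N M f I b \<beta>
    by (intro D2_extension.intro ring_extension.intro ring_extension_axioms.intro
        D2_extension_axioms.intro H.R.ring_axioms H.S.ring_axioms H.homh assms(3))
  have D2: "right_D2 N M f" using assms(2) by (simp add: D2_def)
  have inv: "End_invariants N M f = right_mult M ` carrier M"
  proof
    show "End_invariants N M f \<subseteq> right_mult M ` carrier M"
    proof
      fix \<xi> assume \<xi>: "\<xi> \<in> End_invariants N M f"
      then have "\<xi> \<one>\<^bsub>M\<^esub> \<in> carrier M" by (simp add: End_invariants_def)
      then show "\<xi> \<in> right_mult M ` carrier M" using invariant_right_mult[OF D2 \<xi>] by blast
    qed
  qed (use right_mult_invariant in blast)
  show ?thesis
    using right_bialgebroid right_module_algebroid mult_target_source subring_right_mult inv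
    by auto
qed

end
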